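(* Let $1\le p<\infty$, $r\in\mathbb N$, $d\in\mathbb N$, $f\in L_1(\mathbb T^d)$, and let $\omega$ be a function on $[0,1]$ such that: $\omega$ is continuous on $[0,1]$; $\omega(t)\uparrow$ (non-decreasing); $\omega(t)\neq 0$ for every $t\in(0,1]$; $\omega(t)\to 0$ as $t\to 0$; and $$\sum_{v=n+1}^\infty \frac1v\,\omega\Big(\frac1v\Big)=O\Big(\omega\Big(\frac1n\Big)\Big).$$ Then the following two statements are equivalent: 1) $\|f-A^{\vartriangle}_{\varrho,r}(f)\|_{S^p}=O\big((1-\varrho)^{r-1}\omega(1-\varrho)\big)$ as $\varrho\to1-$; 2) $\|P(f_{[r]})(\varrho,\cdot)\|_{S^p}=O\Big(\dfrac{\omega(1-\varrho)}{1-\varrho}\Big)$ as $\varrho\to1-$. Furthermore, if one of the statements 1) or 2) is satisfied, then 3) $f_{[r-1]}\in S^pH_\omega$. If $f\in L_{1,Y}(\mathbb T^d)$, then the statements 1), 2), 3) are equivalent.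
   Context: $\mathbb T^d=[0,2\pi]^d$; $L_1=L_1(\mathbb T^d)$ is the space of functions on $\mathbb R^d$, $2\pi$-periodic in each variable, integrable over $\mathbb T^d$ with respect to $\sigma$, the Lebesgue measure on $\mathbb T^d$, normalized so that $\sigma(\mathbb T^d)=1$. For $\mathbf k\in\mathbb Z^d$, $(\mathbf k,\mathbf x)=\sum_{j=1}^d k_jx_j$, $|\mathbf k|_1=\sum_{j=1}^d|k_j|$, $\widehat f(\mathbf k)=\int_{\mathbb T^d}f(\mathbf x)e^{-i(\mathbf k,\mathbf x)}\,d\sigma(\mathbf x)$, and $S[f](\mathbf x)=\sum_{\mathbf k\in\mathbb Z^d}\widehat f(\mathbf k)e^{i(\mathbf k,\mathbf x)}$ is the Fourier series of $f$. For $1\le p<\infty$, $S^p$ is the space of all functions $f\in L_1$ such that $\|f\|_{S^p}:=\big(\sum_{\mathbf k\in\mathbb Z^d}|\widehat f(\mathbf k)|^p\big)^{1/p}<\infty$; functions $f,g\in L_1$ are regarded as equal in $S^p$ if $\|f-g\|_{S^p}=0$. For $\nu=0,1,2,\dots$, $H_\nu(f)(\mathbf x)=\sum_{|\mathbf k|_1=\nu}\widehat f(\mathbf k)e^{i(\mathbf k,\mathbf x)}$. For $r\in\mathbb N$ and $\varrho\in[0,1)$, $$A^{\vartriangle}_{\varrho,r}(f)(\mathbf x)=\sum_{\nu=0}^{r-1}H_\nu(f)(\mathbf x)+\sum_{\nu=r}^\infty\lambda_{\nu,r}(\varrho)H_\nu(f)(\mathbf x),\qquad \lambda_{\nu,r}(\varrho)=\sum_{k=0}^{r-1}\binom{\nu}{k}(1-\varrho)^k\varrho^{\nu-k}.$$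 Derivative $f_{[r]}$: $f_{[0]}=f$. For $r\in\mathbb N$, if for the function $f\in L_1$ there exists a function $g\in L_1$ such that $$S[f](\mathbf x)=\sum_{|\mathbf k|_1\le r-1}\widehat f(\mathbf k)e^{i(\mathbf k,\mathbf x)}+\sum_{|\mathbf k|_1\ge r}\frac{(|\mathbf k|_1-r)!}{|\mathbf k|_1!}\,\widehat g(\mathbf k)e^{i(\mathbf k,\mathbf x)},$$ then $g$ is called the derivative of $f$ and is denoted $f_{[r]}$. It is unique up to a sum $\sum_{|\mathbf k|_1\le r-1}a_{\mathbf k}e^{i(\mathbf k,\mathbf x)}$ with arbitrary numbers $a_{\mathbf k}$. Poisson integral: for $\varrho\in[0,1)$ and $f\in L_1$, $$P(f)(\varrho,\mathbf x)=\int_{\mathbb T^d}f(\mathbf x+\mathbf t)\prod_{j=1}^d\frac{1-\varrho^2}{1-2\varrho\cos t_j+\varrho^2}\,d\sigma(\mathbf t)=\sum_{\nu=0}^\infty\varrho^\nu H_\nu(f)(\mathbf x).$$ The Poisson integral of $f_{[r]}$ is given by $$P(f_{[r]})(\varrho,\mathbf x)=\varrho^r\frac{\partial^r}{\partial\varrho^r}P(f)(\varrho,\mathbf x),\qquad \varrho\in[0,1).$$ Class $S^pH_\omega$: the set of all $g\in S^p$ such that $\|g-g_h\|_{S^p}=O(\omega(|h|))$ as $|h|\to0$, where $h\in\mathbb R$ and $g_h(\mathbf x)=g(x_1+h,\dots,x_d+h)$. $Y=\mathbb Z^d_+\cup\mathbb Z^d_-$, where $\mathbb Z^d_+=\{\mathbf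 k\in\mathbb Z^d:k_j\ge0,\ j=1,\dots,d\}$ and $\mathbb Z^d_-=\{\mathbf k\in\mathbb Z^d:k_j<0,\ j=1,\dots,d\}$; $L_{1,Y}(\mathbb T^d)=\{f\in L_1(\mathbb T^d):\widehat f(\mathbf k)=0\ \text{for all}\ \mathbf k\in\mathbb Z^d\setminus Y\}$.
   Formalization: 3) is derived from 1) or 2), also in the last equivalence, only if (p≤2 or f_[r-1] exists in L_1) and (r=1, or some coefficient of f with |k|_1≥r is nonzero, or t=O(ω(t)) as t→0+). Otherwise it can fail: d=1, r=2, ω(t)=t², f=e^{ix}. *)

theory Defs
  imports "HOL-Analysis.Analysis" "HOL-Library.Landau_Symbols"
begin

definition torus_measure :: "(real^'d) measure" where
  "torus_measure = uniform_measure lebesgue (cbox 0 (\<chi> j. 2 * pi))"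

definition L1_torus :: "((real^'d) \<Rightarrow> complex) set" where
  "L1_torus = {f. (\<forall>x j. f (x + axis j (2 * pi)) = f x) \<and> integrable torus_measure f}"

definition freq_inner :: "int^'d \<Rightarrow> real^'d \<Rightarrow> real" where
  "freq_inner k x = (\<Sum>j\<in>UNIV. real_of_int (k $ j) * x $ j)"

definition freq_norm :: "int^'d \<Rightarrow> nat" where
  "freq_norm k = (\<Sum>j\<in>UNIV. nat \<bar>k $ j\<bar>)"

definition fourier_coeff :: "((real^'d) \<Rightarrow> complex) \<Rightarrow> int^'d \<Rightarrow> complex" where
  "fourier_coeff f k = (LINT x|torus_measure. f x * exp (- \<i> * complex_of_real (freq_inner k x)))"

definition Sp :: "real \<Rightarrow> ((real^'d) \<Rightarrow> complex) set" where
  "Sp p = {f \<in> L1_torus. (\<lambda>k. norm (fourier_coeff f k) powr p) summable_on UNIV}"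

text \<open>Meaningful only on \<open>Sp p\<close>: elsewhere the infinite sum defaults to 0.\<close>

definition Sp_norm :: "real \<Rightarrow> ((real^'d) \<Rightarrow> complex) \<Rightarrow> real" where
  "Sp_norm p f = (\<Sum>\<^sub>\<infinity>k. norm (fourier_coeff f k) powr p) powr (1 / p)"

text \<open>The estimate "the Sp norm of \<open>h s\<close> is \<open>O(\<phi> s)\<close> along \<open>F\<close>". Finiteness of the norm is part
  of such an estimate, hence the membership conjunct.\<close>

definition Sp_bigo :: "real \<Rightarrow> 'a filter \<Rightarrow> ('a \<Rightarrow> (real^'d) \<Rightarrow> complex) \<Rightarrow> ('a \<Rightarrow> real) \<Rightarrow> bool" where
  "Sp_bigo p F h \<phi> \<longleftrightarrow> (\<forall>\<^sub>F s in F. h s \<in> Sp p) \<and> (\<lambda>s. Sp_norm p (h s)) \<in> O[F](\<phi>)"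

definition fourier_layer :: "nat \<Rightarrow> ((real^'d) \<Rightarrow> complex) \<Rightarrow> real^'d \<Rightarrow> complex" where
  "fourier_layer \<nu> f x =
     (\<Sum>k | freq_norm k = \<nu>. fourier_coeff f k * exp (\<i> * complex_of_real (freq_inner k x)))"

definition tap_multiplier :: "nat \<Rightarrow> nat \<Rightarrow> real \<Rightarrow> real" where
  "tap_multiplier \<nu> r \<rho> = (\<Sum>k<r. real (\<nu> choose k) * (1 - \<rho>) ^ k * \<rho> ^ (\<nu> - k))"

definition taylor_abel_poisson :: "real \<Rightarrow> nat \<Rightarrow> ((real^'d) \<Rightarrow> complex) \<Rightarrow> real^'d \<Rightarrow> complex" where
  "taylor_abel_poisson \<rho> r f x =
     (\<Sum>\<nu><r. fourier_layer \<nu> f x)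
     + (\<Sum>\<nu>. complex_of_real (tap_multiplier (r + \<nu>) r \<rho>) * fourier_layer (r + \<nu>) f x)"

definition poisson_integral :: "((real^'d) \<Rightarrow> complex) \<Rightarrow> real \<Rightarrow> real^'d \<Rightarrow> complex" where
  "poisson_integral f \<rho> x =
     (LINT t|torus_measure. f (x + t) *
        complex_of_real (\<Prod>j\<in>UNIV. (1 - \<rho>\<^sup>2) / (1 - 2 * \<rho> * cos (t $ j) + \<rho>\<^sup>2)))"

text \<open>The Poisson integral of the \<open>r\<close>-th derivative of \<open>f\<close>, given by \<open>\<rho>\<close> to the power \<open>r\<close> times the
  \<open>r\<close>-th partial derivative in \<open>\<rho>\<close> of the Poisson integral of \<open>f\<close>. It makes sense for every
  integrable \<open>f\<close>, whether or not the derivative exists as an integrable function, and it does not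
  see the arbitrary low-frequency part of that derivative.\<close>

definition poisson_integral_deriv :: "nat \<Rightarrow> ((real^'d) \<Rightarrow> complex) \<Rightarrow> real \<Rightarrow> real^'d \<Rightarrow> complex" where
  "poisson_integral_deriv r f \<rho> x =
     complex_of_real (\<rho> ^ r) *
     ((\<lambda>g s. vector_derivative g (at s)) ^^ r) (\<lambda>s. poisson_integral f s x) \<rho>"

text \<open>\<open>is_derivative r f g\<close>: \<open>g\<close> is an \<open>r\<close>-th derivative of \<open>f\<close>. The identity of Fourier series is
  an identity of coefficients; it is void at frequencies of norm below \<open>r\<close>, so \<open>g\<close> is determined
  only up to a trigonometric polynomial of degree \<open>r - 1\<close>, and it need not exist.\<close>

definition is_derivative :: "nat \<Rightarrow> ((real^'d) \<Rightarrow> complex) \<Rightarrow> ((real^'d) \<Rightarrow> complex) \<Rightarrow> bool" where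
  "is_derivative r f g \<longleftrightarrow>
     (if r = 0 then g = f
      else g \<in> L1_torus \<and>
        (\<forall>k. r \<le> freq_norm k \<longrightarrow>
           fourier_coeff f k =
             complex_of_real (fact (freq_norm k - r) / fact (freq_norm k)) * fourier_coeff g k))"

text \<open>For \<open>\<omega> t = o(t)\<close> this class is degenerate: a member has vanishing coefficients at all
  frequencies with nonzero coordinate sum, so nonconstant trigonometric polynomials need not
  belong to it.\<close>

definition SpH :: "real \<Rightarrow> (real \<Rightarrow> real) \<Rightarrow> ((real^'d) \<Rightarrow> complex) set" where
  "SpH p \<omega> = {g \<in> Sp p. Sp_bigo p (at 0) (\<lambda>h x. g x - g (x + (\<chi> j. h))) (\<lambda>h. \<omega> \<bar>h\<bar>)}"

definition freq_Y :: "(int^'d) set" where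
  "freq_Y = {k. \<forall>j. 0 \<le> k $ j} \<union> {k. \<forall>j. k $ j < 0}"

definition L1_Y :: "((real^'d) \<Rightarrow> complex) set" where
  "L1_Y = {f \<in> L1_torus. \<forall>k. k \<notin> freq_Y \<longrightarrow> fourier_coeff f k = 0}"

end

theory Submission
  imports Defs "HOL-Probability.Probability_Measure"
begin

text \<open>Write \<open>a k\<close> for the modulus of the Fourier coefficient and \<open>\<nu>\<close> for the norm of \<open>k\<close>. Both estimates
  concern multipliers: statement 1 is about \<open>(1 - \<lambda>\<^sub>\<nu>(\<rho>)) a k\<close> and statement 2 about
  \<open>r! (\<nu> choose r) \<rho>\<^sup>\<nu> a k\<close>. Since \<open>1 - \<lambda>\<^sub>\<nu>(\<rho>)\<close> is a binomial tail probability, it dominates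
  \<open>(\<nu> choose r) (1 - \<rho>)\<^sup>r \<rho>\<^sup>\<nu>\<close>, so 1 implies 2. Conversely \<open>\<lambda>\<^sub>\<nu>' = r (\<nu> choose r) (1 - \<rho>)\<^sup>r\<^sup>-\<^sup>1 \<rho>\<^sup>\<nu>\<^sup>-\<^sup>r\<close>;
  summing the increments of \<open>\<lambda>\<^sub>\<nu>\<close> over the points \<open>1 - (1 - \<rho>) / 2\<^sup>j\<close> with Minkowski's inequality
  leaves \<open>\<Sum>j. \<omega>((1 - \<rho>) / 2\<^sup>j)\<close>, which the condition on \<open>\<omega>\<close> bounds by a multiple of \<open>\<omega>(1 - \<rho>)\<close>.
  For statement 3, a shift by \<open>h\<close> multiplies a coefficient of \<open>f\<^sub>[\<^sub>r\<^sub>-\<^sub>1\<^sub>]\<close> by at most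
  \<open>min 2 (\<bar>h\<bar> \<nu>) \<le> 4 (1 - (1 - \<bar>h\<bar>)\<^sup>\<nu>)\<close>, which is the case \<open>r = 1\<close> of statement 1. On \<open>Y\<close> one has
  \<open>\<bar>\<Sum>j. k\<^sub>j\<bar> = \<nu>\<close>, so the shift is also bounded below by a multiple of \<open>\<bar>h\<bar> \<nu>\<close> for
  \<open>\<bar>h\<bar> \<nu> \<le> 1\<close>, and this can be reversed.\<close>

section \<open>Translation invariance on the torus\<close>

text \<open>Both multipliers vanish at norms below \<open>r\<close>, so the first two statements are
  silent there; the third is not, and this is one source of the condition \<open>N\<close> in the
  theorem. The derivative of order \<open>r - 1\<close> has coefficients at norm
  \<open>r - 1\<close>, determined by f but unseen by statement 2, and arbitrary ones below. A shift
  by h may move such terms by an amount of exact order |h|, which is O(\<omega>(|h|)) only if t =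
  O(\<omega>(t)). One nonzero coefficient of f at norm at least \<open>r\<close> forces this
  relation, because statement 2 then keeps \<omega>(t) / t away from 0. For r = 1 the only term
  concerned is the constant one, which shifts fix. The other source of \<open>N\<close> is
  existence: statement 2 only places the coefficients of the derivative in the sequence space l^p.
  For p \<le> 2 this lies in l^2 and Riesz-Fischer supplies the function; for p > 2 a sequence in
  l^p need not belong to an integrable function, so the derivative is assumed to exist.\<close>

lemma lebesgue_measurable_plus [measurable]:
  "(\<lambda>x::'a::euclidean_space. a + x) \<in> lebesgue \<rightarrow>\<^sub>M lebesgue"
  using lebesgue_affine_measurable[of "\<lambda>_. 1" a] by (simp add: euclidean_representation)

lemma distr_lebesgue_plus:
  "distr lebesgue lebesgue (\<lambda>x::'a::euclidean_space. a + x) = lebesgue"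
  using lebesgue_affine_euclidean[of "\<lambda>_. 1" a] by (simp add: euclidean_representation density_1)

lemma nn_integral_lebesgue_plus:
  assumes "f \<in> borel_measurable lebesgue"
  shows "(\<integral>\<^sup>+x. f (a + x) \<partial>lebesgue) = (\<integral>\<^sup>+x. f x \<partial>(lebesgue :: 'a::euclidean_space measure))"
  using nn_integral_distr[OF lebesgue_measurable_plus[of a], of f] assms
  by (simp add: distr_lebesgue_plus)

section \<open>The period lattice and its fundamental cell\<close>

definition lattice :: "int^'d \<Rightarrow> real^'d" where
  "lattice m = (\<chi> j. 2 * pi * real_of_int (m $ j))"

text \<open>Half-open, so that the lattice translates tile space without overlap; the closed box
  behind \<open>torus_measure\<close> differs from it by a null set.\<close>

definition torus_cell :: "(real^'d) set" where
  "torus_cell = {x. \<forall>j. 0 \<le> x $ j \<and> x $ j < 2 * pi}"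

lemma torus_cell_borel [measurable]: "torus_cell \<in> sets borel"
  unfolding torus_cell_def by measurable

lemma torus_cell_unique: "(x + lattice m \<in> torus_cell) \<longleftrightarrow> m = (\<chi> j. - \<lfloor>x $ j / (2 * pi)\<rfloor>)"
proof -
  have "(0 \<le> y + 2 * pi * of_int n \<and> y + 2 * pi * of_int n < 2 * pi) \<longleftrightarrow> - n = \<lfloor>y / (2 * pi)\<rfloor>" for y :: real and n
    by (subst eq_commute, subst floor_eq_iff) (auto simp: field_simps)
  from this[of "x $ _" "m $ _"] show ?thesis
    by (auto simp: torus_cell_def lattice_def vec_eq_iff) (metis minus_minus)+
qed

text \<open>The tiling in the form in which it is used: a sum over translates that equals 1 can be
  inserted under an integral and then interchanged with it.\<close>

lemma nn_integral_lattice_torus_cell: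
  "(\<integral>\<^sup>+m. indicator torus_cell (x + lattice m) \<partial>count_space UNIV) = (1::ennreal)"
proof -
  have "(\<lambda>m. indicator torus_cell (x + lattice m) :: ennreal)
      = indicator {(\<chi> j. - \<lfloor>x $ j / (2 * pi)\<rfloor>)}"
    by (auto simp: indicator_def torus_cell_unique)
  then show ?thesis by simp
qed

lemma emeasure_torus_box:
  "emeasure lebesgue (cbox 0 (\<chi> j. 2 * pi) :: (real^'d) set) = ennreal ((2 * pi) ^ CARD('d))"
proof -
  have "cbox 0 (\<chi> j. 2 * pi) \<noteq> ({} :: (real^'d) set)"
    by (auto simp: interval_ne_empty_cart simp del: box_eq_empty)
  then have "measure lborel (cbox 0 (\<chi> j. 2 * pi) :: (real^'d) set) = (2 * pi) ^ CARD('d)"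
    by (subst content_cbox_cart) auto
  then show ?thesis
    using emeasure_eq_ennreal_measure[of lborel "cbox 0 (\<chi> j. 2 * pi) :: (real^'d) set"]
      emeasure_lborel_cbox_finite[of 0 "(\<chi> j. 2 * pi) :: real^'d"] by (simp add: less_top)
qed

lemma prob_space_torus: "prob_space torus_measure"
  unfolding torus_measure_def
  by (intro prob_space_uniform_measure) (auto simp: emeasure_torus_box simp del: emeasure_lborel_cbox)

interpretation torus: prob_space "torus_measure :: (real^'d) measure"
  by (rule prob_space_torus)

lemma sets_torus_measure [measurable_cong]: "sets torus_measure = sets lebesgue"
  by (simp add: torus_measure_def)

lemma AE_torus_cell:
  "AE x in lebesgue. x \<in> cbox 0 (\<chi> j. 2 * pi) \<longleftrightarrow> x \<in> (torus_cell :: (real^'d) set)"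
proof -
  have "(cbox 0 (\<chi> j. 2 * pi) - box 0 (\<chi> j. 2 * pi) :: (real^'d) set) \<in> null_sets lebesgue"
    using negligible_frontier_interval negligible_iff_null_sets by blast
  then have "AE x in lebesgue. x \<notin> (cbox 0 (\<chi> j. 2 * pi) - box 0 (\<chi> j. 2 * pi) :: (real^'d) set)"
    by (rule AE_not_in)
  then show ?thesis
    by (rule AE_mp) (auto intro!: AE_I2 simp: mem_box_cart torus_cell_def less_imp_le intro: order_less_imp_le)
qed

lemma nn_integral_torus:
  fixes f :: "real^'d \<Rightarrow> ennreal"
  assumes [measurable]: "f \<in> borel_measurable lebesgue"
  shows "nn_integral torus_measure f
    = (\<integral>\<^sup>+x. f x * indicator torus_cell x \<partial>lebesgue) / ennreal ((2 * pi) ^ CARD('d))"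
proof -
  have "(\<integral>\<^sup>+x. f x * indicator (cbox 0 (\<chi> j. 2 * pi)) x \<partial>lebesgue) = (\<integral>\<^sup>+x. f x * indicator torus_cell x \<partial>lebesgue)"
    using AE_torus_cell by (intro nn_integral_cong_AE, eventually_elim) (auto simp: indicator_def)
  then show ?thesis
    unfolding torus_measure_def
    by (subst nn_integral_uniform_measure) (auto simp: emeasure_torus_box simp del: emeasure_lborel_cbox)
qed

text \<open>Cut the shifted cell into its intersections with the lattice translates of the cell, and move
  the pieces back.\<close>

lemma nn_integral_torus_translate:
  fixes f :: "real^'d \<Rightarrow> ennreal"
  assumes [measurable]: "f \<in> borel_measurable lebesgue"
    and per: "\<And>x m. f (x + lattice m) = f x"
  shows "(\<integral>\<^sup>+x. f (a + x) \<partial>torus_measure) = (\<integral>\<^sup>+x. f x \<partial>torus_measure)"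
proof -
  let ?I = "indicator torus_cell :: real^'d \<Rightarrow> ennreal"
  have I [measurable]: "(\<lambda>x. ?I (b + x)) \<in> borel_measurable lebesgue" for b
    by (rule measurable_compose[OF lebesgue_measurable_plus]) (auto intro!: borel_measurable_indicator)
  have I0 [measurable]: "?I \<in> borel_measurable lebesgue"
    using I[of 0] by simp
  have fs [measurable]: "(\<lambda>x. f (b + x)) \<in> borel_measurable lebesgue" for b
    by (rule measurable_compose[OF lebesgue_measurable_plus]) measurable
  have "(\<integral>\<^sup>+x. f (a + x) * ?I x \<partial>lebesgue) = (\<integral>\<^sup>+x. f (a + x) * ?I (- a + (a + x)) \<partial>lebesgue)"
    by simp
  also have "\<dots> = (\<integral>\<^sup>+x. f x * ?I (- a + x) \<partial>lebesgue)"
    by (rule nn_integral_lebesgue_plus[of "\<lambda>x. f x * ?I (- a + x)"]) measurable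
  also have "\<dots> = (\<integral>\<^sup>+x. \<integral>\<^sup>+m. f x * ?I (- a + x) * ?I (lattice m + x) \<partial>count_space UNIV \<partial>lebesgue)"
    by (simp add: nn_integral_cmult nn_integral_lattice_torus_cell add.commute)
  also have "\<dots> = (\<integral>\<^sup>+m. \<integral>\<^sup>+x. f x * ?I (- a + x) * ?I (lattice m + x) \<partial>lebesgue \<partial>count_space UNIV)"
    by (rule nn_integral_count_space_nn_integral[of UNIV "\<lambda>m x. f x * ?I (- a + x) * ?I (lattice m + x)"]) measurable
  also have "\<dots> = (\<integral>\<^sup>+m. \<integral>\<^sup>+x. f x * ?I (- a + lattice (- m) + x) * ?I x \<partial>lebesgue \<partial>count_space UNIV)"
  proof (rule nn_integral_cong)
    fix m :: "int^'d"
    let ?F = "\<lambda>x. f x * ?I (- a + x) * ?I (lattice m + x)"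
    have "?F (lattice (- m) + x) = f x * ?I (- a + lattice (- m) + x) * ?I x" for x
    proof -
      have 1: "lattice m + (lattice (- m) + x) = x" by (simp add: lattice_def vec_eq_iff)
      have 2: "f (lattice (- m) + x) = f x" using per[of x "- m"] by (simp add: add.commute)
      have 3: "- a + (lattice (- m) + x) = - a + lattice (- m) + x" by (simp only: add_ac)
      show ?thesis by (simp only: 1 2 3)
    qed
    moreover have "(\<integral>\<^sup>+x. ?F (lattice (- m) + x) \<partial>lebesgue) = (\<integral>\<^sup>+x. ?F x \<partial>lebesgue)"
      by (rule nn_integral_lebesgue_plus[of ?F]) measurable
    ultimately show "(\<integral>\<^sup>+x. ?F x \<partial>lebesgue)
      = (\<integral>\<^sup>+x. f x * ?I (- a + lattice (- m) + x) * ?I x \<partial>lebesgue)"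
      by (simp only:)
  qed
  also have "\<dots> = (\<integral>\<^sup>+x. \<integral>\<^sup>+m. f x * ?I x * ?I (- a + lattice (- m) + x) \<partial>count_space UNIV \<partial>lebesgue)"
  proof -
    have "f x * ?I (- a + lattice (- m) + x) * ?I x = f x * ?I x * ?I (- a + lattice (- m) + x)" for x m
      by (simp only: mult_ac)
    moreover have "(\<integral>\<^sup>+x. \<integral>\<^sup>+m. f x * ?I x * ?I (- a + lattice (- m) + x) \<partial>count_space UNIV \<partial>lebesgue)
       = (\<integral>\<^sup>+m. \<integral>\<^sup>+x. f x * ?I x * ?I (- a + lattice (- m) + x) \<partial>lebesgue \<partial>count_space UNIV)"
      by (rule nn_integral_count_space_nn_integral[of UNIV "\<lambda>m x. f x * ?I x * ?I (- a + lattice (- m) + x)"]) measurable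
    ultimately show ?thesis by (simp only:)
  qed
  also have "\<dots> = (\<integral>\<^sup>+x. f x * ?I x \<partial>lebesgue)"
  proof (intro nn_integral_cong)
    fix x :: "real^'d"
    have "(\<integral>\<^sup>+m. ?I (- a + lattice (- m) + x) \<partial>count_space UNIV) = (\<integral>\<^sup>+m. ?I (- a + lattice m + x) \<partial>count_space UNIV)"
      by (rule nn_integral_bij_count_space[of uminus UNIV UNIV "\<lambda>m. ?I (- a + lattice m + x)"]) (auto intro!: bij_uminus)
    also have "\<dots> = (\<integral>\<^sup>+m. ?I ((- a + x) + lattice m) \<partial>count_space UNIV)"
      by (simp only: add_ac)
    finally have "(\<integral>\<^sup>+m. ?I (- a + lattice (- m) + x) \<partial>count_space UNIV) = 1"
      by (simp only: nn_integral_lattice_torus_cell)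
    then show "(\<integral>\<^sup>+m. f x * ?I x * ?I (- a + lattice (- m) + x) \<partial>count_space UNIV) = f x * ?I x"
      by (simp add: nn_integral_cmult)
  qed
  finally have "(\<integral>\<^sup>+x. f (a + x) * ?I x \<partial>lebesgue) = (\<integral>\<^sup>+x. f x * ?I x \<partial>lebesgue)" .
  then show ?thesis
    by (simp only: nn_integral_torus[OF assms(1)] nn_integral_torus[OF fs])
qed

lemma periodic_lattice:
  fixes f :: "real^'d \<Rightarrow> 'a"
  assumes "\<And>x j. f (x + axis j (2 * pi)) = f x"
  shows "f (x + lattice m) = f x"
proof -
  have pos: "f (x + real n *\<^sub>R axis j (2 * pi)) = f x" for n x j
  proof (induction n)
    case (Suc n)
    have "x + real (Suc n) *\<^sub>R axis j (2 * pi) = (x + real n *\<^sub>R axis j (2 * pi)) + axis j (2 * pi)"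
      by (simp add: scaleR_add_left)
    then show ?case using assms Suc by (simp only:)
  qed simp
  have one: "f (x + of_int z *\<^sub>R axis j (2 * pi)) = f x" for z x j
  proof (cases z rule: int_cases2)
    case (nonneg n) then show ?thesis using pos[of x n j] by simp
  next
    case (nonpos n) then show ?thesis using pos[of "x - real n *\<^sub>R axis j (2 * pi)" n j] by simp
  qed
  have "f (x + (\<Sum>j\<in>A. of_int (m $ j) *\<^sub>R axis j (2 * pi))) = f x" if "finite A" for A
    using that
  proof (induction A)
    case (insert j A)
    then show ?case using one[of "x + (\<Sum>j\<in>A. of_int (m $ j) *\<^sub>R axis j (2 * pi))" "m $ j" j]
      by (simp add: add_ac)
  qed simp
  moreover have "lattice m = (\<Sum>j\<in>UNIV. of_int (m $ j) *\<^sub>R axis j (2 * pi))"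
    by (simp add: vec_eq_iff lattice_def axis_def if_distrib[of "\<lambda>x. _ * x"] cong: if_cong)
  ultimately show ?thesis by simp
qed

lemma L1_torusI:
  "(\<And>x j. f (x + axis j (2 * pi)) = f x) \<Longrightarrow> integrable torus_measure f \<Longrightarrow> f \<in> L1_torus"
  by (simp add: L1_torus_def)

lemma L1_torusD:
  assumes "f \<in> L1_torus"
  shows "f (x + axis j (2 * pi)) = f x" "integrable torus_measure f" "f (x + lattice m) = f x"
proof -
  show *: "f (x + axis j (2 * pi)) = f x" "integrable torus_measure f" for x j
    using assms by (auto simp: L1_torus_def)
  show "f (x + lattice m) = f x"
    by (rule periodic_lattice) (rule *)
qed

lemma torus_integrable_translate:
  fixes f :: "real^'d \<Rightarrow> complex"
  assumes "f \<in> L1_torus"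
  shows "integrable torus_measure (\<lambda>x. f (a + x))"
proof -
  have f: "f \<in> borel_measurable lebesgue"
    using L1_torusD(2)[OF assms] by (auto dest!: borel_measurable_integrable)
  note [measurable] = f measurable_compose[OF lebesgue_measurable_plus f]
  have "(\<integral>\<^sup>+x. norm (f (a + x)) \<partial>torus_measure) = (\<integral>\<^sup>+x. norm (f x) \<partial>torus_measure)"
    using L1_torusD(3)[OF assms] by (intro nn_integral_torus_translate) auto
  then show ?thesis
    using L1_torusD(2)[OF assms] by (auto simp: integrable_iff_bounded)
qed

text \<open>Invariance is known for nonnegative integrands, so real and imaginary parts are split
  further: \<open>ennreal\<close> cuts negative values to 0, hence the two integrals compared below
  are those of the positive and the negative part.\<close>

lemma torus_integral_translate:
  fixes f :: "real^'d \<Rightarrow> complex"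
  assumes f: "f \<in> L1_torus"
  shows "(LINT x|torus_measure. f (a + x)) = (LINT x|torus_measure. f x)"
proof -
  have m [measurable]: "f \<in> borel_measurable lebesgue"
    using L1_torusD(2)[OF assms] by (auto dest!: borel_measurable_integrable)
  have real: "(LINT x|torus_measure. h (f (a + x))) = (LINT x|torus_measure. h (f x) :: real)"
    if h: "bounded_linear h" for h
  proof -
    have [measurable]: "h \<in> borel_measurable borel"
      using h by (intro borel_measurable_continuous_onI linear_continuous_on)
    have 1: "integrable torus_measure (\<lambda>x. h (f (a + x)))" "integrable torus_measure (\<lambda>x. h (f x))"
      using integrable_bounded_linear[OF h] torus_integrable_translate[OF f, of a] L1_torusD(2)[OF f]
      by auto
    have "(\<integral>\<^sup>+x. ennreal (h (f (a + x))) \<partial>torus_measure) = (\<integral>\<^sup>+x. ennreal (h (f x)) \<partial>torus_measure)"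
      by (rule nn_integral_torus_translate) (simp_all add: L1_torusD(3)[OF f])
    moreover have "(\<integral>\<^sup>+x. ennreal (- h (f (a + x))) \<partial>torus_measure) = (\<integral>\<^sup>+x. ennreal (- h (f x)) \<partial>torus_measure)"
      by (rule nn_integral_torus_translate) (simp_all add: L1_torusD(3)[OF f])
    ultimately show ?thesis
      by (simp only: real_lebesgue_integral_def[OF 1(1)] real_lebesgue_integral_def[OF 1(2)])
  qed
  show ?thesis
    using real[OF bounded_linear_Re] real[OF bounded_linear_Im]
      torus_integrable_translate[OF f, of a] L1_torusD(2)[OF f]
    by (intro complex_eqI) (simp_all flip: integral_Re integral_Im)
qed

section \<open>Fourier coefficients and trigonometric series\<close>

definition trig :: "int^'d \<Rightarrow> real^'d \<Rightarrow> complex" where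
  "trig k x = exp (\<i> * complex_of_real (freq_inner k x))"

lemma freq_inner_add_right: "freq_inner k (x + y) = freq_inner k x + freq_inner k y"
  by (simp add: freq_inner_def algebra_simps sum.distrib)

lemma freq_inner_add_left: "freq_inner (k + l) x = freq_inner k x + freq_inner l x"
  by (simp add: freq_inner_def algebra_simps sum.distrib)

lemma freq_inner_uminus: "freq_inner (- k) x = - freq_inner k x"
  by (simp add: freq_inner_def sum_negf)

lemma trig_add_right: "trig k (x + y) = trig k x * trig k y"
  by (simp add: trig_def freq_inner_add_right algebra_simps exp_add)

lemma trig_add_left: "trig (k + l) x = trig k x * trig l x"
  by (simp add: trig_def freq_inner_add_left algebra_simps exp_add)

lemma trig_uminus: "trig (- k) x = exp (- \<i> * complex_of_real (freq_inner k x))"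
  by (simp add: trig_def freq_inner_uminus)

lemma cnj_trig: "cnj (trig k x) = trig (- k) x"
  by (simp add: trig_def freq_inner_uminus exp_cnj)

lemma norm_trig [simp]: "norm (trig k x) = 1"
  by (simp add: trig_def)

lemma trig_zero [simp]: "trig 0 x = 1"
  by (simp add: trig_def freq_inner_def)

lemma trig_inverse: "trig (- k) x * trig k x = 1"
  by (simp flip: trig_add_left)

lemma freq_inner_axis: "freq_inner k (axis j a) = of_int (k $ j) * a"
  by (simp add: freq_inner_def axis_def if_distrib[of "\<lambda>x. _ * x"] cong: if_cong)

lemma trig_periodic: "trig k (x + axis j (2 * pi)) = trig k x"
proof -
  have "trig k (axis j (2 * pi)) = exp (complex_of_real (2 * of_int (k $ j) * pi) * \<i>)"
    by (simp add: trig_def freq_inner_axis mult_ac)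
  also have "\<dots> = 1" using exp_integer_2pi[of "of_int (k $ j)"] by simp
  finally show ?thesis by (simp add: trig_add_right)
qed

lemma continuous_on_trig [continuous_intros]: "continuous_on A (trig k)"
  unfolding trig_def[abs_def] freq_inner_def by (intro continuous_intros)

lemma borel_measurable_trig [measurable]: "trig k \<in> borel_measurable lebesgue"
  by (intro measurable_completion) (simp add: borel_measurable_continuous_onI continuous_on_trig)

lemma fourier_coeff_trig: "fourier_coeff f k = (LINT x|torus_measure. f x * trig (- k) x)"
  by (simp add: fourier_coeff_def trig_uminus)

lemma integrable_mult_trig:
  assumes "integrable torus_measure f"
  shows "integrable torus_measure (\<lambda>x. f x * trig k x)"
proof (rule Bochner_Integration.integrable_bound[OF assms])
  show "(\<lambda>x. f x * trig k x) \<in> borel_measurable torus_measure"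
    using borel_measurable_integrable[OF assms] by measurable
qed (simp add: norm_mult)

lemma L1_torus_mult_trig: "f \<in> L1_torus \<Longrightarrow> (\<lambda>x. f x * trig k x) \<in> L1_torus"
  by (auto simp: L1_torus_def trig_periodic integrable_mult_trig)

lemma trig_L1: "trig k \<in> L1_torus"
  using L1_torus_mult_trig[of "\<lambda>_. 1" k] by (simp add: L1_torus_def)

lemma integrable_trig: "integrable torus_measure (trig k)"
  using trig_L1 by (rule L1_torusD)

lemma L1_torus_diff: "f \<in> L1_torus \<Longrightarrow> g \<in> L1_torus \<Longrightarrow> (\<lambda>x. f x - g x) \<in> L1_torus"
  by (auto simp: L1_torus_def)

lemma fourier_coeff_diff:
  assumes "f \<in> L1_torus" "g \<in> L1_torus"
  shows "fourier_coeff (\<lambda>x. f x - g x) k = fourier_coeff f k - fourier_coeff g k"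
  using assms[THEN L1_torusD(2)]
  by (simp add: fourier_coeff_trig left_diff_distrib integrable_mult_trig)

lemma norm_fourier_coeff_le: "norm (fourier_coeff f k) \<le> (LINT x|torus_measure. norm (f x))"
  unfolding fourier_coeff_trig
  using integral_norm_bound[of torus_measure "\<lambda>x. f x * trig (- k) x"] by (simp add: norm_mult)

lemma L1_torus_translate: "f \<in> L1_torus \<Longrightarrow> (\<lambda>x. f (a + x)) \<in> L1_torus"
  using torus_integrable_translate by (auto simp: L1_torus_def simp flip: add.assoc)

lemma fourier_coeff_translate:
  assumes "f \<in> L1_torus"
  shows "fourier_coeff (\<lambda>x. f (a + x)) k = trig k a * fourier_coeff f k"
proof -
  have "f (a + x) * trig (- k) x = trig k a * (f (a + x) * trig (- k) (a + x))" for x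
    using trig_inverse[of "- k" a] by (simp add: trig_add_right)
  then have "fourier_coeff (\<lambda>x. f (a + x)) k
      = trig k a * (LINT x|torus_measure. f (a + x) * trig (- k) (a + x))"
    by (simp only: fourier_coeff_trig integral_mult_right_zero)
  also have "(LINT x|torus_measure. f (a + x) * trig (- k) (a + x)) = fourier_coeff f k"
    using torus_integral_translate[OF L1_torus_mult_trig[OF assms]] by (simp add: fourier_coeff_trig)
  finally show ?thesis .
qed

text \<open>By translation invariance the integral of \<open>trig k\<close> is multiplied by \<open>trig k a\<close>
  for every shift \<open>a\<close>, and \<open>trig k a = - 1\<close> for a suitable one.\<close>

lemma integral_trig: "(LINT x|torus_measure. trig k x) = (if k = 0 then 1 else 0)"
proof (cases "k = 0")
  case True
  then show ?thesis by (simp add: torus.prob_space)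
next
  case False
  then obtain j where j: "k $ j \<noteq> 0" by (auto simp: vec_eq_iff)
  define a where "a = axis j (pi / of_int (k $ j))"
  have "trig k a = exp (\<i> * of_real pi)"
    using j by (simp add: trig_def a_def freq_inner_axis)
  then have a: "trig k a = - 1" by (simp add: mult.commute)
  have "(LINT x|torus_measure. trig k x) = (LINT x|torus_measure. trig k (a + x))"
    by (rule torus_integral_translate[OF trig_L1, symmetric])
  also have "\<dots> = - (LINT x|torus_measure. trig k x)"
    by (simp add: trig_add_right a)
  finally show ?thesis using False by simp
qed

lemma fourier_coeff_of_trig: "fourier_coeff (trig l) k = (if k = l then 1 else 0)"
  by (simp add: fourier_coeff_trig integral_trig flip: trig_add_left)

section \<open>Trigonometric polynomials, Parseval's identity and series of polynomial
  blocks\<close>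

definition trig_poly :: "(int^'d) set \<Rightarrow> (int^'d \<Rightarrow> complex) \<Rightarrow> real^'d \<Rightarrow> complex" where
  "trig_poly A c x = (\<Sum>k\<in>A. c k * trig k x)"

lemma trig_poly_L1: "trig_poly A c \<in> L1_torus"
  by (auto simp: L1_torus_def trig_poly_def[abs_def] trig_periodic integrable_trig)

lemma norm_trig_poly_le: "norm (trig_poly A c x) \<le> (\<Sum>k\<in>A. norm (c k))"
  unfolding trig_poly_def by (rule order_trans[OF norm_sum]) (simp add: norm_mult)

lemma fourier_coeff_trig_poly:
  assumes "finite A"
  shows "fourier_coeff (trig_poly A c) k = (if k \<in> A then c k else 0)"
proof -
  have "fourier_coeff (trig_poly A c) k = (\<Sum>l\<in>A. c l * fourier_coeff (trig l) k)"
    unfolding fourier_coeff_trig trig_poly_def sum_distrib_right mult.assoc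
    by (subst Bochner_Integration.integral_sum) (auto simp: integrable_mult_trig integrable_trig)
  then show ?thesis
    using assms by (simp add: fourier_coeff_of_trig if_distrib[of "\<lambda>x. _ * x"] cong: if_cong)
qed

text \<open>Parseval: only the conjugate factor of the square is expanded, so that integration
  leaves Fourier coefficients of the polynomial itself, which are its \<open>c k\<close>.\<close>

lemma integral_norm_trig_poly_sq:
  assumes "finite A"
  shows "integrable torus_measure (\<lambda>x. (norm (trig_poly A c x))\<^sup>2)"
    and "(LINT x|torus_measure. (norm (trig_poly A c x))\<^sup>2) = (\<Sum>k\<in>A. (norm (c k))\<^sup>2)"
proof -
  have eq: "complex_of_real ((norm (trig_poly A c x))\<^sup>2)
      = (\<Sum>k\<in>A. cnj (c k) * (trig_poly A c x * trig (- k) x))" for x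
  proof -
    have "complex_of_real ((norm (trig_poly A c x))\<^sup>2) = trig_poly A c x * cnj (trig_poly A c x)"
      by (rule complex_norm_square)
    also have "cnj (trig_poly A c x) = (\<Sum>k\<in>A. cnj (c k) * trig (- k) x)"
      by (simp add: trig_poly_def cnj_trig)
    finally show ?thesis by (simp add: sum_distrib_left mult_ac)
  qed
  have int: "integrable torus_measure (\<lambda>x. trig_poly A c x * trig (- k) x)" for k
    using trig_poly_L1[THEN L1_torusD(2)] by (rule integrable_mult_trig)
  have "integrable torus_measure (\<lambda>x. complex_of_real ((norm (trig_poly A c x))\<^sup>2))"
    unfolding eq using int by auto
  then show "integrable torus_measure (\<lambda>x. (norm (trig_poly A c x))\<^sup>2)"
    by (simp only: complex_of_real_integrable_eq)
  have "complex_of_real (LINT x|torus_measure. (norm (trig_poly A c x))\<^sup>2)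
      = (LINT x|torus_measure. (\<Sum>k\<in>A. cnj (c k) * (trig_poly A c x * trig (- k) x)))"
    by (simp only: eq flip: integral_complex_of_real)
  also have "\<dots> = (\<Sum>k\<in>A. cnj (c k) * fourier_coeff (trig_poly A c) k)"
    using int by (simp add: fourier_coeff_trig)
  also have "\<dots> = complex_of_real (\<Sum>k\<in>A. (norm (c k))\<^sup>2)"
    unfolding of_real_sum
    by (intro sum.cong) (simp_all add: fourier_coeff_trig_poly[OF assms] complex_norm_square mult.commute del: of_real_power)
  finally show "(LINT x|torus_measure. (norm (trig_poly A c x))\<^sup>2) = (\<Sum>k\<in>A. (norm (c k))\<^sup>2)"
    by (simp only: of_real_eq_iff)
qed

text \<open>The pointwise bound u \<le> (u^2 / s + s) / 2 takes the place of the Cauchy-Schwarz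
  inequality; it is sharp at u = s, so Parseval loses no constant.\<close>

lemma integral_norm_trig_poly_le:
  assumes "finite A" "0 < s" "(\<Sum>k\<in>A. (norm (c k))\<^sup>2) \<le> s\<^sup>2"
  shows "(LINT x|torus_measure. norm (trig_poly A c x)) \<le> s"
proof -
  have amgm: "norm (trig_poly A c x) \<le> ((norm (trig_poly A c x))\<^sup>2 / s + s) / 2" for x
  proof -
    have "0 \<le> (norm (trig_poly A c x) - s)\<^sup>2" by simp
    then show ?thesis using \<open>0 < s\<close> by (simp add: power2_eq_square field_simps)
  qed
  have "(LINT x|torus_measure. norm (trig_poly A c x))
      \<le> (LINT x|torus_measure. ((norm (trig_poly A c x))\<^sup>2 / s + s) / 2)"
    using amgm trig_poly_L1[THEN L1_torusD(2)] integral_norm_trig_poly_sq(1)[OF assms(1)]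
    by (intro integral_mono) auto
  also have "\<dots> = ((\<Sum>k\<in>A. (norm (c k))\<^sup>2) / s + s) / 2"
    using integral_norm_trig_poly_sq[OF assms(1), of c] by (simp add: torus.prob_space)
  also have "\<dots> \<le> (s\<^sup>2 / s + s) / 2"
    using assms by (intro divide_right_mono add_right_mono) auto
  finally show ?thesis by (simp add: power2_eq_square)
qed

text \<open>Summable L1 norms give convergence almost everywhere and allow coefficients to be
  computed termwise; each frequency occurs in exactly one block. The blocks stay general because
  they will be layers of constant norm for the approximation processes and adapted shells for
  Riesz-Fischer.\<close>

lemma trig_block_series:
  fixes c :: "int^'d \<Rightarrow> complex" and A :: "nat \<Rightarrow> (int^'d) set"
  assumes fin: "\<And>j. finite (A j)" and part: "\<And>k. \<exists>!j. k \<in> A j"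
    and sm: "summable (\<lambda>j. LINT x|torus_measure. norm (trig_poly (A j) c x))"
  shows "(\<lambda>x. \<Sum>j. trig_poly (A j) c x) \<in> L1_torus"
    and "fourier_coeff (\<lambda>x. \<Sum>j. trig_poly (A j) c x) k = c k"
proof -
  let ?G = "\<lambda>j. trig_poly (A j) c"
  have int: "integrable torus_measure (?G j)" for j
    using trig_poly_L1 by (rule L1_torusD)
  then have [measurable]: "?G j \<in> borel_measurable torus_measure" for j
    by (rule borel_measurable_integrable)
  have "(\<integral>\<^sup>+x. (\<Sum>j. ennreal (norm (?G j x))) \<partial>torus_measure) = (\<Sum>j. \<integral>\<^sup>+x. ennreal (norm (?G j x)) \<partial>torus_measure)"
    by (rule nn_integral_suminf) measurable
  also have "\<dots> = (\<Sum>j. ennreal (LINT x|torus_measure. norm (?G j x)))"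
    using int by (intro suminf_cong nn_integral_eq_integral integrable_norm AE_I2 norm_ge_zero)
  also have "\<dots> < \<infinity>"
    using sm by (simp add: ennreal_suminf_neq_top less_top[symmetric])
  finally have "AE x in torus_measure. (\<Sum>j. ennreal (norm (?G j x))) \<noteq> \<infinity>"
    by (intro nn_integral_PInf_AE) auto
  then have AE: "AE x in torus_measure. summable (\<lambda>j. norm (?G j x))"
    by eventually_elim (rule summable_suminf_not_top, simp_all)
  have "integrable torus_measure (\<lambda>x. \<Sum>j. ?G j x)"
    by (rule integrable_suminf[OF int AE sm])
  \<comment> \<open>Periodicity holds at every point, also where the series diverges: the terms are
    periodic, hence so is whatever value \<open>suminf\<close> takes.\<close>
  then show L1: "(\<lambda>x. \<Sum>j. ?G j x) \<in> L1_torus"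
    by (intro L1_torusI) (simp add: L1_torusD(1)[OF trig_poly_L1])
  obtain i where i: "k \<in> A i" "\<And>j. k \<in> A j \<Longrightarrow> j = i"
    using part[of k] by (elim ex1E) blast
  have "fourier_coeff (\<lambda>x. \<Sum>j. ?G j x) k = (LINT x|torus_measure. (\<Sum>j. ?G j x * trig (- k) x))"
    unfolding fourier_coeff_trig
  proof (rule integral_cong_AE)
    show "AE x in torus_measure. (\<Sum>j. ?G j x) * trig (- k) x = (\<Sum>j. ?G j x * trig (- k) x)"
      using AE by eventually_elim (simp add: suminf_mult2 summable_norm_cancel)
    show "(\<lambda>x. (\<Sum>j. ?G j x) * trig (- k) x) \<in> borel_measurable torus_measure"
      using L1[THEN L1_torusD(2)] by (intro borel_measurable_integrable integrable_mult_trig)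
    show "(\<lambda>x. \<Sum>j. ?G j x * trig (- k) x) \<in> borel_measurable torus_measure"
      using int by (intro borel_measurable_suminf borel_measurable_integrable integrable_mult_trig)
  qed
  also have "\<dots> = (\<Sum>j. fourier_coeff (?G j) k)"
    unfolding fourier_coeff_trig
  proof (rule integral_suminf)
    show "integrable torus_measure (\<lambda>x. ?G j x * trig (- k) x)" for j
      by (rule integrable_mult_trig[OF int])
  qed (simp_all only: norm_mult norm_trig mult_1_right AE sm)
  also have "\<dots> = (\<Sum>j. if j = i then c k else 0)"
  proof (rule suminf_cong)
    show "fourier_coeff (?G j) k = (if j = i then c k else 0)" for j
    proof (cases "k \<in> A j")
      case True
      then show ?thesis using i(2)[OF True] by (simp add: fourier_coeff_trig_poly[OF fin])
    next
      case False
      then have "j \<noteq> i" using i(1) by metis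
      then show ?thesis using False by (simp add: fourier_coeff_trig_poly[OF fin])
    qed
  qed
  also have "\<dots> = c k"
    using suminf_finite[of "{i}" "\<lambda>j. if j = i then c k else 0"] by simp
  finally show "fourier_coeff (\<lambda>x. \<Sum>j. ?G j x) k = c k" .
qed

text \<open>The ball lies in a cube with \<open>2 * n + 1\<close> lattice points per side. A
  polynomial count is enough, since it will meet geometric decay.\<close>

lemma finite_freq_norm_le: "finite {k :: int^'d. freq_norm k \<le> n}"
  and card_freq_norm_eq: "card {k :: int^'d. freq_norm k = n} \<le> (2 * n + 1) ^ CARD('d)"
proof -
  let ?B = "{k :: int^'d. \<forall>j. k $ j \<in> {- int n..int n}}"
  have bij: "bij_betw vec_nth ?B (PiE UNIV (\<lambda>_::'d. {- int n..int n}))"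
    by (rule bij_betwI[where g = vec_lambda]) auto
  have fin: "finite ?B"
    using bij_betw_finite[OF bij] by (simp add: finite_PiE)
  have "card ?B = (2 * n + 1) ^ CARD('d)"
    using bij_betw_same_card[OF bij] by (simp add: card_PiE nat_add_distrib nat_mult_distrib)
  moreover have sub: "{k :: int^'d. freq_norm k \<le> n} \<subseteq> ?B"
  proof safe
    fix k :: "int^'d" and j assume "freq_norm k \<le> n"
    moreover have "nat \<bar>k $ j\<bar> \<le> freq_norm k"
      unfolding freq_norm_def by (rule member_le_sum) auto
    ultimately show "k $ j \<in> {- int n..int n}" by auto
  qed
  moreover have "card {k :: int^'d. freq_norm k = n} \<le> card ?B"
    using sub fin by (intro card_mono) auto
  ultimately show "card {k :: int^'d. freq_norm k = n} \<le> (2 * n + 1) ^ CARD('d)" by simp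
  show "finite {k :: int^'d. freq_norm k \<le> n}" using finite_subset[OF sub fin] .
qed

lemma finite_freq_norm_eq: "finite {k :: int^'d. freq_norm k = n}"
  by (rule finite_subset[OF _ finite_freq_norm_le[of n]]) auto

lemma fourier_layer_trig_poly: "fourier_layer \<nu> f = trig_poly {k. freq_norm k = \<nu>} (fourier_coeff f)"
  by (simp add: fun_eq_iff fourier_layer_def trig_poly_def trig_def)

text \<open>Both approximation processes are series of this form, with coefficients multiplied by a
  function of the norm; their integrability and their coefficients are read off here.\<close>

lemma trig_series_layers:
  fixes c :: "int^'d \<Rightarrow> complex"
  assumes "summable (\<lambda>\<nu>. \<Sum>k | freq_norm k = \<nu>. norm (c k))"
  shows "(\<lambda>x. \<Sum>\<nu>. trig_poly {k. freq_norm k = \<nu>} c x) \<in> L1_torus"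
    and "fourier_coeff (\<lambda>x. \<Sum>\<nu>. trig_poly {k. freq_norm k = \<nu>} c x) k = c k"
proof -
  have "(LINT x|torus_measure. norm (trig_poly {k. freq_norm k = \<nu>} c x)) \<le> (\<Sum>k | freq_norm k = \<nu>. norm (c k))" for \<nu>
  proof -
    have "(LINT x|torus_measure. norm (trig_poly {k. freq_norm k = \<nu>} c x))
        \<le> (LINT x|(torus_measure :: (real^'d) measure). (\<Sum>k | freq_norm k = \<nu>. norm (c k)))"
      using trig_poly_L1[THEN L1_torusD(2)] by (intro integral_mono norm_trig_poly_le) auto
    then show ?thesis by (simp add: torus.prob_space)
  qed
  then have sm: "summable (\<lambda>\<nu>. LINT x|torus_measure. norm (trig_poly {k. freq_norm k = \<nu>} c x))"
    by (intro summable_comparison_test'[OF assms]) auto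
  have part: "\<exists>!\<nu>. k \<in> {k. freq_norm k = \<nu>}" for k :: "int^'d"
    by simp
  show "(\<lambda>x. \<Sum>\<nu>. trig_poly {k. freq_norm k = \<nu>} c x) \<in> L1_torus"
    by (rule trig_block_series(1)[OF finite_freq_norm_eq part sm])
  show "fourier_coeff (\<lambda>x. \<Sum>\<nu>. trig_poly {k. freq_norm k = \<nu>} c x) k = c k"
    by (rule trig_block_series(2)[OF finite_freq_norm_eq part sm])
qed

section \<open>Riesz-Fischer theorem and Poisson integrals\<close>

text \<open>The function is built as a series convergent in L1: the frequencies are cut into shells
  on which \<open>c\<close> has l^2 norm at most 2^(-j), and by Parseval the L1 norms of the
  corresponding polynomials are at most 2^(-j) as well.\<close>

lemma riesz_fischer:
  fixes c :: "int^'d \<Rightarrow> complex"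
  assumes bound: "\<And>K. finite K \<Longrightarrow> (\<Sum>k\<in>K. (norm (c k))\<^sup>2) \<le> M"
  shows "\<exists>g\<in>L1_torus. \<forall>k. fourier_coeff g k = c k"
proof -
  define s where "s = (\<lambda>n. \<Sum>k | freq_norm k < n. (norm (c k))\<^sup>2)"
  have fin: "finite {k :: int^'d. freq_norm k < n}" for n
    by (rule finite_subset[OF _ finite_freq_norm_le[of n]]) auto
  have "incseq s"
    unfolding s_def by (intro monoI sum_mono2 fin) auto
  then have "convergent s"
    using bound[OF fin] by (intro Bseq_mono_convergent BseqI'[of _ M]) (auto simp: s_def sum_nonneg mono_def)
  then have "Cauchy s" by (rule convergent_Cauchy)
  have "\<exists>n. \<forall>m\<ge>n. s m - s n \<le> ((1 / 2) ^ j)\<^sup>2" for j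
  proof -
    obtain n where "\<And>m m'. m \<ge> n \<Longrightarrow> m' \<ge> n \<Longrightarrow> norm (s m - s m') < ((1 / 2) ^ j)\<^sup>2"
      using CauchyD[OF \<open>Cauchy s\<close>, of "((1 / 2) ^ j)\<^sup>2"] by auto
    then have "s m - s n \<le> ((1 / 2) ^ j)\<^sup>2" if "m \<ge> n" for m
      using that by (smt (verit) order_refl real_norm_def)
    then show ?thesis by blast
  qed
  then obtain n where n: "\<And>j m. m \<ge> n j \<Longrightarrow> s m - s (n j) \<le> ((1 / 2) ^ j)\<^sup>2"
    by metis
  \<comment> \<open>\<open>Suc Nj\<close> keeps the radii strictly increasing, so that the shells
    cover every frequency exactly once; \<open>n (Suc j)\<close> makes the shell starting there
    small. Shell 0 starts at radius 0 and has no such bound, hence \<open>j \<ge> 1\<close>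
    below.\<close>
  define N where "N = rec_nat (0::nat) (\<lambda>j Nj. max (Suc Nj) (n (Suc j)))"
  have N0: "N 0 = 0" and N_Suc: "N (Suc j) = max (Suc (N j)) (n (Suc j))" for j
    by (simp_all add: N_def)
  have "strict_mono N" unfolding strict_mono_Suc_iff by (simp add: N_Suc less_max_iff_disj)
  define A where "A = (\<lambda>j. {k :: int^'d. N j \<le> freq_norm k \<and> freq_norm k < N (Suc j)})"
  have finA: "finite (A j)" for j
    by (rule finite_subset[OF _ fin[of "N (Suc j)"]]) (auto simp: A_def)
  have part: "\<exists>!j. k \<in> A j" for k
  proof -
    define j where "j = (LEAST j. freq_norm k < N (Suc j))"
    have ex: "freq_norm k < N (Suc (freq_norm k))"
      using strict_mono_imp_increasing[OF \<open>strict_mono N\<close>, of "Suc (freq_norm k)"] by simp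
    have j: "freq_norm k < N (Suc j)" unfolding j_def by (rule LeastI[of "\<lambda>j. freq_norm k < N (Suc j)", OF ex])
    have "N j \<le> freq_norm k"
    proof (cases j)
      case (Suc i)
      then show ?thesis using not_less_Least[of i "\<lambda>j. freq_norm k < N (Suc j)"] by (simp add: j_def)
    qed (simp add: N0)
    with j have "k \<in> A j" by (simp add: A_def)
    moreover have "i = j" if "k \<in> A i" for i
    proof (rule ccontr)
      assume "i \<noteq> j"
      then have "N (Suc i) \<le> N j \<or> N (Suc j) \<le> N i"
        using strict_mono_mono[OF \<open>strict_mono N\<close>] by (metis Suc_leI linorder_neqE_nat monoD)
      with that \<open>k \<in> A j\<close> show False by (auto simp: A_def)
    qed
    ultimately show ?thesis by blast
  qed
  have tail: "(\<Sum>k\<in>A j. (norm (c k))\<^sup>2) \<le> ((1 / 2) ^ j)\<^sup>2" if "j \<ge> 1" for j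
  proof -
    have nj: "n j \<le> N j" using that by (cases j) (auto simp: N_Suc)
    have le: "N j \<le> N (Suc j)" by (simp add: N_Suc)
    have "{k. freq_norm k < N (Suc j)} = {k. freq_norm k < N j} \<union> A j"
      using le by (auto simp: A_def)
    then have "s (N (Suc j)) = s (N j) + (\<Sum>k\<in>A j. (norm (c k))\<^sup>2)"
      unfolding s_def by (simp only:) (rule sum.union_disjoint[OF fin finA], auto simp: A_def)
    moreover have "s (n j) \<le> s (N j)" using \<open>incseq s\<close> nj by (simp add: incseqD)
    moreover have "s (N (Suc j)) - s (n j) \<le> ((1 / 2) ^ j)\<^sup>2" using n nj le by simp
    ultimately show ?thesis by linarith
  qed
  have "summable (\<lambda>j. LINT x|torus_measure. norm (trig_poly (A j) c x))"
  proof (rule summable_comparison_test')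
    show "summable (\<lambda>j. (1 / 2 :: real) ^ j)" by (rule summable_geometric) simp
    show "norm (LINT x|torus_measure. norm (trig_poly (A j) c x)) \<le> (1 / 2) ^ j" if "j \<ge> 1" for j
      using integral_norm_trig_poly_le[OF finA _ tail[OF that]] by simp
  qed
  from trig_block_series[of A c, OF finA part this] show ?thesis by blast
qed

text \<open>Termwise differentiation brings down one factor \<open>n\<close> and keeps convergence
  in the open disc. It asks for convergence on the whole disc, hence the induction over arbitrary
  \<open>q\<close>.\<close>

lemma summable_power_geometric:
  fixes q :: real
  assumes "norm q < 1"
  shows "summable (\<lambda>n. real n ^ m * q ^ n)"
  using assms
proof (induction m arbitrary: q)
  case 0
  then show ?case by (simp add: summable_geometric)
next
  case (Suc m)
  have "summable (\<lambda>n. diffs (\<lambda>n. real n ^ m) n * q ^ n)"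
    by (rule termdiff_converges[of q 1]) (use Suc in auto)
  from summable_mult[OF this, of q] have "summable (\<lambda>n. real (Suc n) ^ Suc m * q ^ Suc n)"
    by (simp add: diffs_def mult_ac)
  then show ?case by (subst (asm) summable_Suc_iff)
qed

text \<open>A layer has polynomially many frequencies, which geometric decay absorbs. The bound is
  asked for from norm 1 on, since at norm 0 its right side is 0 once \<open>m > 0\<close>; a single
  layer does not affect convergence.\<close>

lemma summable_layers:
  fixes c :: "int^'d \<Rightarrow> complex"
  assumes q: "0 \<le> q" "q < 1"
    and c: "\<And>k. 1 \<le> freq_norm k \<Longrightarrow> norm (c k) \<le> C * real (freq_norm k) ^ m * q ^ freq_norm k"
  shows "summable (\<lambda>\<nu>. \<Sum>k | freq_norm k = \<nu>. norm (c k))"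
proof (rule summable_comparison_test')
  show "summable (\<lambda>\<nu>. 3 ^ CARD('d) * \<bar>C\<bar> * (real \<nu> ^ (CARD('d) + m) * q ^ \<nu>))"
    using q by (intro summable_mult summable_power_geometric) auto
  fix \<nu> :: nat assume \<nu>: "1 \<le> \<nu>"
  have "(\<Sum>k :: int^'d | freq_norm k = \<nu>. norm (c k)) \<le> (\<Sum>k :: int^'d | freq_norm k = \<nu>. \<bar>C\<bar> * (real \<nu> ^ m * q ^ \<nu>))"
  proof (intro sum_mono)
    fix k :: "int^'d" assume "k \<in> {k. freq_norm k = \<nu>}"
    then have "norm (c k) \<le> C * (real \<nu> ^ m * q ^ \<nu>)" using c[of k] \<nu> by (simp add: mult.assoc)
    also have "\<dots> \<le> \<bar>C\<bar> * (real \<nu> ^ m * q ^ \<nu>)" using q by (intro mult_right_mono) auto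
    finally show "norm (c k) \<le> \<bar>C\<bar> * (real \<nu> ^ m * q ^ \<nu>)" .
  qed
  also have "\<dots> = real (card {k :: int^'d. freq_norm k = \<nu>}) * (\<bar>C\<bar> * (real \<nu> ^ m * q ^ \<nu>))"
    by simp
  also have "\<dots> \<le> real ((2 * \<nu> + 1) ^ CARD('d)) * (\<bar>C\<bar> * (real \<nu> ^ m * q ^ \<nu>))"
    using q card_freq_norm_eq[where 'd = 'd] by (intro mult_right_mono of_nat_mono) auto
  also have "real ((2 * \<nu> + 1) ^ CARD('d)) \<le> (3 * real \<nu>) ^ CARD('d)"
    using \<nu> unfolding of_nat_power by (intro power_mono) auto
  finally show "norm (\<Sum>k :: int^'d | freq_norm k = \<nu>. norm (c k))
      \<le> 3 ^ CARD('d) * \<bar>C\<bar> * (real \<nu> ^ (CARD('d) + m) * q ^ \<nu>)"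
    using q by (simp add: sum_nonneg power_mult_distrib power_add mult_ac mult_right_mono)
qed

text \<open>Two geometric series with z = \<rho> e^(i \<theta>): the indices n \<ge> 0 give 1 / (1 -
  z), and the indices -n - 1, which avoid counting 0 twice, give cnj z / (1 - cnj z).\<close>

lemma poisson_kernel_1:
  fixes \<rho> \<theta> :: real
  assumes "0 \<le> \<rho>" "\<rho> < 1"
  shows "((\<lambda>n::int. complex_of_real (\<rho> ^ nat \<bar>n\<bar>) * exp (\<i> * of_real (of_int n * \<theta>))) has_sum
    complex_of_real ((1 - \<rho>\<^sup>2) / (1 - 2 * \<rho> * cos \<theta> + \<rho>\<^sup>2))) UNIV" (is "(?f has_sum _) _")
proof -
  define z where "z = complex_of_real \<rho> * exp (\<i> * of_real \<theta>)"
  have nz: "norm z < 1" using assms by (simp add: z_def norm_mult)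
  have nc: "norm (cnj z) < 1" using nz by simp
  have geo: "((\<lambda>n. w ^ n) has_sum 1 / (1 - w)) UNIV" if "norm w < 1" for w :: complex
    using that by (intro norm_summable_imp_has_sum geometric_sums) (simp_all add: norm_power summable_geometric)
  have pz: "z ^ n = ?f (int n)" for n
    by (simp add: z_def power_mult_distrib exp_of_nat_mult[symmetric] mult_ac)
  have pc: "cnj z * cnj z ^ n = ?f (- int n - 1)" for n
  proof -
    have "cnj z * cnj z ^ n = cnj (z ^ Suc n)" by simp
    also have "\<dots> = cnj (?f (int (Suc n)))" by (simp only: pz)
    also have "\<dots> = complex_of_real (\<rho> ^ Suc n) * exp (cnj (\<i> * of_real (of_int (int (Suc n)) * \<theta>)))"
      by (simp add: exp_cnj nat_add_distrib)
    also have "cnj (\<i> * of_real (of_int (int (Suc n)) * \<theta>)) = \<i> * of_real (of_int (- int n - 1) * \<theta>)"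
      by (simp add: complex_eq_iff algebra_simps)
    also have "\<rho> ^ Suc n = \<rho> ^ nat \<bar>- int n - 1\<bar>"
      by (intro arg_cong[of _ _ "(^) \<rho>"]) simp
    finally show ?thesis .
  qed
  have "((?f \<circ> int) has_sum 1 / (1 - z)) UNIV"
    using geo[OF nz] by (simp add: pz o_def)
  then have 1: "(?f has_sum 1 / (1 - z)) (range int)"
    by (subst has_sum_reindex) (auto simp: inj_on_def)
  have "((\<lambda>n. cnj z * cnj z ^ n) has_sum (cnj z * (1 / (1 - cnj z)))) UNIV"
    by (rule has_sum_cmult_right[OF geo[OF nc]])
  then have "((?f \<circ> (\<lambda>n. - int n - 1)) has_sum (cnj z * (1 / (1 - cnj z)))) UNIV"
    unfolding pc o_def .
  then have 2: "(?f has_sum (cnj z * (1 / (1 - cnj z)))) (range (\<lambda>n. - int n - 1))"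
    by (subst has_sum_reindex) (auto simp: inj_on_def)
  have "(UNIV :: int set) = range int \<union> range (\<lambda>n. - int n - 1)"
  proof safe
    fix n :: int assume "n \<notin> range (\<lambda>n. - int n - 1)"
    then have "n \<noteq> - int (nat (- n - 1)) - 1" by blast
    then have "n = int (nat n)" by (cases "0 \<le> n") auto
    then show "n \<in> range int" by blast
  qed auto
  moreover have "range int \<inter> range (\<lambda>n. - int n - 1) = {}" by auto
  ultimately have "(?f has_sum (1 / (1 - z) + cnj z * (1 / (1 - cnj z)))) UNIV"
    using has_sum_Un_disjoint[OF 1 2] by simp
  moreover have "1 / (1 - z) + cnj z * (1 / (1 - cnj z))
      = complex_of_real ((1 - \<rho>\<^sup>2) / (1 - 2 * \<rho> * cos \<theta> + \<rho>\<^sup>2))"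
  proof -
    have ne: "1 - z \<noteq> 0" "1 - cnj z \<noteq> 0" using nz nc by auto
    have zc: "z * cnj z = complex_of_real (\<rho>\<^sup>2)"
      using assms by (simp flip: complex_norm_square) (simp add: z_def norm_mult)
    have "z + cnj z = complex_of_real (2 * Re z)" by (rule complex_add_cnj)
    then have zs: "z + cnj z = complex_of_real (2 * \<rho> * cos \<theta>)"
      by (simp add: z_def Re_exp)
    have "1 / (1 - z) + cnj z * (1 / (1 - cnj z)) = (1 - z * cnj z) / (1 - (z + cnj z) + z * cnj z)"
    proof -
      have "1 - (z + cnj z) + z * cnj z = (1 - z) * (1 - cnj z)" by (simp add: algebra_simps)
      then show ?thesis using ne by (simp only:) (simp add: divide_simps, simp add: algebra_simps)
    qed
    then show ?thesis by (simp add: zc zs)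
  qed
  ultimately show ?thesis by simp
qed

lemma freq_norm_uminus [simp]: "freq_norm (- k) = freq_norm k"
  by (simp add: freq_norm_def)

text \<open>Each coordinate contributes an absolutely convergent series, so their product multiplies
  out into a sum over all frequencies; absolute summability of that sum permits regrouping by
  layers.\<close>

lemma poisson_kernel:
  fixes t :: "real^'d"
  assumes \<rho>: "0 \<le> \<rho>" "\<rho> < 1"
  shows "(\<lambda>\<nu>. trig_poly {k. freq_norm k = \<nu>} (\<lambda>k. complex_of_real (\<rho> ^ freq_norm k)) t) sums
     complex_of_real (\<Prod>j\<in>UNIV. (1 - \<rho>\<^sup>2) / (1 - 2 * \<rho> * cos (t $ j) + \<rho>\<^sup>2))"
proof -
  let ?f = "\<lambda>j (n::int). complex_of_real (\<rho> ^ nat \<bar>n\<bar>) * exp (\<i> * of_real (of_int n * t $ j))"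
  let ?g = "\<lambda>k :: int^'d. complex_of_real (\<rho> ^ freq_norm k) * trig k t"
  have g: "?g k = (\<Prod>j\<in>UNIV. ?f j (k $ j))" for k
    by (simp add: trig_def freq_norm_def freq_inner_def power_sum prod.distrib sum_distrib_left exp_sum)
  have sums: "summable (\<lambda>\<nu>. \<Sum>k :: int^'d | freq_norm k = \<nu>. norm (complex_of_real (\<rho> ^ freq_norm k)))"
    using \<rho> by (intro summable_layers[of \<rho> _ 1 0]) (auto simp: norm_power)
  have abs: "(\<lambda>k. norm (?g k)) summable_on UNIV"
  proof (rule nonneg_bounded_partial_sums_imp_summable_on)
    show "\<forall>\<^sub>F K in finite_subsets_at_top UNIV. (\<Sum>k\<in>K. norm (?g k))
        \<le> (\<Sum>\<nu>. \<Sum>k :: int^'d | freq_norm k = \<nu>. norm (complex_of_real (\<rho> ^ freq_norm k)))"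
    proof (rule eventually_finite_subsets_at_top_weakI)
      fix K :: "(int^'d) set" assume K: "finite K"
      have "(\<Sum>k\<in>K. norm (?g k)) = (\<Sum>\<nu>\<in>freq_norm ` K. \<Sum>k\<in>{k\<in>K. freq_norm k = \<nu>}. norm (?g k))"
        by (rule sum.image_gen[OF K])
      also have "\<dots> \<le> (\<Sum>\<nu>\<in>freq_norm ` K. \<Sum>k | freq_norm k = \<nu>. norm (?g k))"
        by (intro sum_mono sum_mono2 finite_freq_norm_eq) auto
      also have "\<dots> = (\<Sum>\<nu>\<in>freq_norm ` K. \<Sum>k :: int^'d | freq_norm k = \<nu>. norm (complex_of_real (\<rho> ^ freq_norm k)))"
        by (simp add: norm_mult)
      also have "\<dots> \<le> (\<Sum>\<nu>. \<Sum>k :: int^'d | freq_norm k = \<nu>. norm (complex_of_real (\<rho> ^ freq_norm k)))"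
        using K by (intro sum_le_suminf sums) (auto intro!: sum_nonneg)
      finally show "(\<Sum>k\<in>K. norm (?g k)) \<le> \<dots>" .
    qed
  qed auto
  have "infsum ?g UNIV = infsum (\<lambda>k. \<Prod>j\<in>UNIV. ?f j (vec_nth k j)) UNIV"
    by (simp only: g)
  also have "\<dots> = infsum (\<lambda>h. \<Prod>j\<in>UNIV. ?f j (h j)) (PiE UNIV (\<lambda>_. UNIV))"
  proof (rule infsum_reindex_bij_betw)
    show "bij_betw vec_nth (UNIV :: (int^'d) set) (PiE UNIV (\<lambda>_. UNIV))"
      by (rule bij_betwI[where g = vec_lambda]) auto
  qed
  also have "\<dots> = (\<Prod>j\<in>UNIV. infsum (?f j) UNIV)"
  proof (rule infsum_prod_PiE_abs)
    fix j
    show "(\<lambda>n. norm (?f j n)) summable_on UNIV"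
      using poisson_kernel_1[OF \<rho>, of "t $ j"]
      unfolding summable_on_iff_abs_summable_on_complex[symmetric] by (auto simp: summable_on_def)
  qed simp
  also have "\<dots> = (\<Prod>j\<in>UNIV. complex_of_real ((1 - \<rho>\<^sup>2) / (1 - 2 * \<rho> * cos (t $ j) + \<rho>\<^sup>2)))"
    using poisson_kernel_1[OF \<rho>] by (intro prod.cong refl infsumI)
  finally have "(?g has_sum complex_of_real (\<Prod>j\<in>UNIV. (1 - \<rho>\<^sup>2) / (1 - 2 * \<rho> * cos (t $ j) + \<rho>\<^sup>2))) UNIV"
    using has_sum_infsum[OF abs_summable_summable[OF abs]] by (simp only: of_real_prod)
  moreover have "bij_betw snd (Sigma UNIV (\<lambda>\<nu>. {k :: int^'d. freq_norm k = \<nu>})) UNIV"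
    by (rule bij_betwI[where g = "\<lambda>k. (freq_norm k, k)"]) auto
  ultimately have S: "((\<lambda>x. ?g (snd x)) has_sum complex_of_real (\<Prod>j\<in>UNIV. (1 - \<rho>\<^sup>2) / (1 - 2 * \<rho> * cos (t $ j) + \<rho>\<^sup>2)))
      (Sigma UNIV (\<lambda>\<nu>. {k :: int^'d. freq_norm k = \<nu>}))"
    by (subst has_sum_reindex_bij_betw)
  have "((\<lambda>\<nu>. \<Sum>k | freq_norm k = \<nu>. ?g k) has_sum complex_of_real (\<Prod>j\<in>UNIV. (1 - \<rho>\<^sup>2) / (1 - 2 * \<rho> * cos (t $ j) + \<rho>\<^sup>2))) UNIV"
    by (rule has_sum_SigmaD[OF S]) (simp only: snd_conv, rule has_sum_finite[OF finite_freq_norm_eq])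
  then show ?thesis
    unfolding trig_poly_def by (rule has_sum_imp_sums)
qed

lemma poisson_integral_eq:
  fixes f :: "real^'d \<Rightarrow> complex"
  assumes f: "f \<in> L1_torus" and \<rho>: "0 \<le> \<rho>" "\<rho> < 1"
  shows "poisson_integral f \<rho> x = (\<Sum>\<nu>. fourier_layer \<nu> f x * complex_of_real \<rho> ^ \<nu>)"
proof -
  let ?T = "\<lambda>\<nu>. trig_poly {k :: int^'d. freq_norm k = \<nu>} (\<lambda>k. complex_of_real (\<rho> ^ freq_norm k))"
  let ?B = "\<lambda>\<nu>. \<Sum>k :: int^'d | freq_norm k = \<nu>. norm (complex_of_real (\<rho> ^ freq_norm k))"
  have sB: "summable ?B"
    using \<rho> by (intro summable_layers[of \<rho> _ 1 0]) (auto simp: norm_power)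
  have TB: "norm (?T \<nu> t) \<le> ?B \<nu>" for \<nu> t by (rule norm_trig_poly_le)
  have fx: "(\<lambda>t. f (x + t)) \<in> L1_torus" by (rule L1_torus_translate[OF f])
  then have int_fx: "integrable torus_measure (\<lambda>t. f (x + t))" by (rule L1_torusD)
  have expand: "f (x + t) * ?T \<nu> t = (\<Sum>k | freq_norm k = \<nu>. complex_of_real (\<rho> ^ freq_norm k) * (f (x + t) * trig k t))" for \<nu> t
    by (simp add: trig_poly_def sum_distrib_left mult_ac)
  have int: "integrable torus_measure (\<lambda>t. f (x + t) * ?T \<nu> t)" for \<nu>
    unfolding expand by (intro Bochner_Integration.integrable_sum integrable_mult_right integrable_mult_trig int_fx)
  have le: "norm (f (x + t) * ?T \<nu> t) \<le> ?B \<nu> * norm (f (x + t))" for \<nu> t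
    unfolding norm_mult by (subst mult.commute) (intro mult_right_mono TB norm_ge_zero)
  have "poisson_integral f \<rho> x = (LINT t|torus_measure. (\<Sum>\<nu>. f (x + t) * ?T \<nu> t))"
  proof -
    have "f (x + t) * complex_of_real (\<Prod>j\<in>UNIV. (1 - \<rho>\<^sup>2) / (1 - 2 * \<rho> * cos (t $ j) + \<rho>\<^sup>2))
        = (\<Sum>\<nu>. f (x + t) * ?T \<nu> t)" for t
      by (rule sums_unique[OF sums_mult[OF poisson_kernel[OF \<rho>]]])
    then show ?thesis by (simp only: poisson_integral_def)
  qed
  also have "\<dots> = (\<Sum>\<nu>. LINT t|torus_measure. f (x + t) * ?T \<nu> t)"
  proof (rule integral_suminf[OF int])
    have "summable (\<lambda>\<nu>. norm (f (x + t) * ?T \<nu> t))" for t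
    proof (rule summable_comparison_test')
      show "summable (\<lambda>\<nu>. ?B \<nu> * norm (f (x + t)))" by (intro summable_mult2 sB)
    qed (use le in simp)
    then show "AE t in torus_measure. summable (\<lambda>\<nu>. norm (f (x + t) * ?T \<nu> t))" by simp
    show "summable (\<lambda>\<nu>. LINT t|torus_measure. norm (f (x + t) * ?T \<nu> t))"
    proof (rule summable_comparison_test')
      show "summable (\<lambda>\<nu>. ?B \<nu> * (LINT t|torus_measure. norm (f (x + t))))" by (intro summable_mult2 sB)
      fix \<nu> :: nat
      have "(LINT t|torus_measure. norm (f (x + t) * ?T \<nu> t)) \<le> (LINT t|torus_measure. ?B \<nu> * norm (f (x + t)))"
        using int int_fx by (intro integral_mono le) auto
      then show "norm (LINT t|torus_measure. norm (f (x + t) * ?T \<nu> t)) \<le> ?B \<nu> * (LINT t|torus_measure. norm (f (x + t)))"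
        by simp
    qed
  qed
  also have "\<dots> = (\<Sum>\<nu>. fourier_layer \<nu> f x * complex_of_real \<rho> ^ \<nu>)"
  proof (rule suminf_cong)
    fix \<nu>
    \<comment> \<open>Integrated against \<open>f (x + t)\<close>, the factor
      \<open>trig k t\<close> produces the coefficient at \<open>- k\<close>. Layers are symmetric
      under \<open>k \<mapsto> - k\<close>, so the sign disappears on reindexing.\<close>
    have coeff: "(LINT t|torus_measure. f (x + t) * trig k t) = fourier_coeff f (- k) * trig (- k) x" for k
      using fourier_coeff_translate[OF f, of x "- k"] by (simp add: fourier_coeff_trig mult.commute)
    have "(LINT t|torus_measure. f (x + t) * ?T \<nu> t)
        = (\<Sum>k | freq_norm k = \<nu>. complex_of_real (\<rho> ^ freq_norm k) * (fourier_coeff f (- k) * trig (- k) x))"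
      unfolding expand by (subst Bochner_Integration.integral_sum)
        (auto intro!: integrable_mult_right integrable_mult_trig int_fx simp: coeff)
    also have "\<dots> = (\<Sum>k | freq_norm k = \<nu>. complex_of_real \<rho> ^ \<nu> * (fourier_coeff f k * trig k x))"
      by (rule sum.reindex_bij_witness[of _ uminus uminus]) auto
    also have "\<dots> = fourier_layer \<nu> f x * complex_of_real \<rho> ^ \<nu>"
      by (simp add: fourier_layer_trig_poly trig_poly_def sum_distrib_left mult.commute)
    finally show "(LINT t|torus_measure. f (x + t) * ?T \<nu> t) = fourier_layer \<nu> f x * complex_of_real \<rho> ^ \<nu>" .
  qed
  finally show ?thesis .
qed

text \<open>The factor is (n + 1) ... (n + r), left by \<open>r\<close> differentiations. It is
  written with a binomial coefficient because it is to be compared with the binomial tail 1 -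
  \<lambda>.\<close>

lemma funpow_diffs:
  "(diffs ^^ r) c n = of_nat (fact r * ((n + r) choose r)) * (c (n + r) :: complex)"
proof (induction r arbitrary: n)
  case (Suc r)
  have "fact (Suc r) * ((n + Suc r) choose Suc r) = fact r * (Suc r * ((n + Suc r) choose Suc r))"
    by (simp only: fact_Suc of_nat_id mult_ac)
  also have "Suc r * ((n + Suc r) choose Suc r) = ((n + Suc r) choose r) * (n + Suc r - r)"
    by (metis binomial_absorb_comp binomial_absorption mult.commute)
  finally have "fact (Suc r) * ((n + Suc r) choose Suc r) = Suc n * (fact r * ((Suc n + r) choose r))"
    by (simp add: mult_ac)
  then have eq: "of_nat (Suc n) * of_nat (fact r * ((Suc n + r) choose r))
      = (of_nat (fact (Suc r) * ((n + Suc r) choose Suc r)) :: complex)"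
    by (simp only: flip: of_nat_mult)
  have "(diffs ^^ Suc r) c n = of_nat (Suc n) * (diffs ^^ r) c (Suc n)"
    by (simp add: diffs_def)
  also have "\<dots> = of_nat (Suc n) * of_nat (fact r * ((Suc n + r) choose r)) * c (Suc n + r)"
    by (simp only: Suc.IH mult.assoc)
  finally show ?case by (simp only: eq) (simp only: add_Suc_shift)
qed simp

text \<open>The series represents \<open>P\<close> only on (0, 1), but the derivative at an interior
  point is local. So each further \<open>vector_derivative\<close> can be taken on the series, which
  stays convergent in the whole unit disc.\<close>

lemma funpow_vector_derivative_power_series:
  fixes P :: "real \<Rightarrow> complex"
  assumes P: "\<And>s. 0 < s \<Longrightarrow> s < 1 \<Longrightarrow> P s = (\<Sum>n. c n * complex_of_real s ^ n)"
    and sm: "\<And>z::complex. norm z < 1 \<Longrightarrow> summable (\<lambda>n. c n * z ^ n)"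
    and s: "0 < s" "s < 1"
  shows "((\<lambda>g s. vector_derivative g (at s)) ^^ r) P s = (\<Sum>n. (diffs ^^ r) c n * complex_of_real s ^ n)"
proof -
  have sm': "norm z < 1 \<Longrightarrow> summable (\<lambda>n. (diffs ^^ r) c n * z ^ n)" for r and z :: complex
  proof (induction r arbitrary: z)
    case (Suc r)
    have "summable (\<lambda>n. diffs ((diffs ^^ r) c) n * z ^ n)"
      by (rule termdiff_converges[of z 1]) (use Suc in auto)
    then show ?case by simp
  qed (use sm in simp)
  show ?thesis using s
  proof (induction r arbitrary: s)
    case (Suc r)
    have "((\<lambda>z. \<Sum>n. (diffs ^^ r) c n * z ^ n) has_field_derivative
        (\<Sum>n. diffs ((diffs ^^ r) c) n * complex_of_real s ^ n)) (at (complex_of_real s))"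
      by (rule termdiffs_strong'[of 1]) (use sm' Suc.prems in auto)
    then have "((\<lambda>s. \<Sum>n. (diffs ^^ r) c n * complex_of_real s ^ n) has_vector_derivative
        (\<Sum>n. diffs ((diffs ^^ r) c) n * complex_of_real s ^ n)) (at s)"
      by (rule has_vector_derivative_real_field)
    then have "(((\<lambda>g s. vector_derivative g (at s)) ^^ r) P has_vector_derivative
        (\<Sum>n. diffs ((diffs ^^ r) c) n * complex_of_real s ^ n)) (at s)"
      by (rule has_vector_derivative_transform_within_open[where S = "{0<..<1}"]) (use Suc in auto)
    then show ?case by (simp add: vector_derivative_at)
  qed (use P in simp)
qed

section \<open>Bounds in the sequence space of exponent p\<close>

text \<open>The endpoint 0 is included because coefficients may vanish; there convexity reduces to
  s^p \<le> s for 0 < s < 1.\<close>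

lemma powr_convex_nonneg:
  fixes p :: real
  assumes "1 \<le> p"
  shows "convex_on {0..} (\<lambda>x. x powr p)"
proof (rule convex_onI)
  show "convex {0::real..}" by simp
next
  fix t x y :: real
  assume t: "0 < t" "t < 1" and xy: "x \<in> {0..}" "y \<in> {0..}"
  have shrink: "(s * z) powr p \<le> s * z powr p" if "0 < s" "s < 1" "0 \<le> z" for s z :: real
  proof -
    have "s powr p \<le> s powr 1"
      using that assms by (intro powr_mono') auto
    then show ?thesis
      using that by (simp add: powr_mult mult_right_mono)
  qed
  consider "x = 0" | "y = 0" | "x > 0" "y > 0"
    using xy by fastforce
  then show "((1 - t) *\<^sub>R x + t *\<^sub>R y) powr p \<le> (1 - t) * x powr p + t * y powr p"
  proof cases
    case 3
    then show ?thesis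
      using convex_onD[OF powr_convex[OF assms], of t x y] t by auto
  qed (use t xy shrink[of t y] shrink[of "1 - t" x] in auto)
qed

text \<open>For nonnegative \<open>x\<close> and \<open>M\<close> this says at once that the sum of
  p-th powers converges and that the norm is at most \<open>M\<close>. Finite partial sums keep the
  default value of a divergent \<open>infsum\<close> out of all estimates.\<close>

definition lp_le :: "real \<Rightarrow> ('k \<Rightarrow> real) \<Rightarrow> real \<Rightarrow> bool" where
  "lp_le p x M \<longleftrightarrow> (\<forall>K. finite K \<longrightarrow> (\<Sum>k\<in>K. x k powr p) \<le> M powr p)"

lemma lp_le_mono:
  assumes "lp_le p y M" "0 \<le> p" "0 \<le> M" "M \<le> N" "\<And>k. 0 \<le> x k" "\<And>k. x k \<le> y k"
  shows "lp_le p x N"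
  unfolding lp_le_def
proof safe
  fix K :: "'a set" assume "finite K"
  have "(\<Sum>k\<in>K. x k powr p) \<le> (\<Sum>k\<in>K. y k powr p)"
    using assms by (intro sum_mono powr_mono2) auto
  also have "\<dots> \<le> M powr p"
    using assms \<open>finite K\<close> by (auto simp: lp_le_def)
  also have "\<dots> \<le> N powr p"
    using assms by (intro powr_mono2) auto
  finally show "(\<Sum>k\<in>K. x k powr p) \<le> N powr p" .
qed

lemma lp_le_scale:
  assumes "lp_le p x M" "0 \<le> c" "0 \<le> M" "\<And>k. 0 \<le> x k"
  shows "lp_le p (\<lambda>k. c * x k) (c * M)"
  using assms unfolding lp_le_def
  by (simp add: powr_mult flip: sum_distrib_left) (metis mult_left_mono powr_ge_zero)

lemma lp_le_coord:
  assumes "lp_le p x M" "0 < p" "0 \<le> M" "0 \<le> x k"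
  shows "x k \<le> M"
proof -
  have "(\<Sum>k\<in>{k}. x k powr p) \<le> M powr p"
    using assms unfolding lp_le_def by blast
  then show ?thesis
    using assms powr_less_mono2[of p M "x k"] by (cases "x k \<le> M") auto
qed

text \<open>Serves the finitely many low frequencies, where the multipliers give no information. The
  \<open>S + 1\<close> makes the constant positive even if \<open>x\<close> vanishes.\<close>

lemma lp_le_finite_support:
  assumes "finite A" "\<And>k. k \<notin> A \<Longrightarrow> x k = 0" "1 \<le> p"
  shows "\<exists>M>0. lp_le p x M"
proof (intro exI conjI)
  define S where "S = (\<Sum>k\<in>A. x k powr p)"
  have "S \<ge> 0" unfolding S_def by (intro sum_nonneg) auto
  show "0 < (S + 1) powr (1 / p)" using \<open>S \<ge> 0\<close> by simp
  have "(\<Sum>k\<in>K. x k powr p) \<le> S" if "finite K" for K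
  proof -
    have "(\<Sum>k\<in>K. x k powr p) = (\<Sum>k\<in>K \<inter> A. x k powr p)"
      using that assms by (intro sum.mono_neutral_right) auto
    also have "\<dots> \<le> S" unfolding S_def using assms by (intro sum_mono2) auto
    finally show ?thesis .
  qed
  moreover have "((S + 1) powr (1 / p)) powr p = S + 1"
    using \<open>S \<ge> 0\<close> assms by (simp add: powr_powr)
  ultimately show "lp_le p x ((S + 1) powr (1 / p))"
    unfolding lp_le_def by (smt (verit))
qed

text \<open>Minkowski's inequality: \<open>\<Sum>j. y j k\<close> is \<open>\<Sum>j. M j\<close> times a convex combination of the
  \<open>y j k / M j\<close>, and \<open>t \<mapsto> t\<^sup>p\<close> is convex.\<close>

lemma lp_le_sum:
  fixes y :: "'j \<Rightarrow> 'k \<Rightarrow> real"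
  assumes "1 \<le> p" "finite J" "J \<noteq> {}"
    and M: "\<And>j. j \<in> J \<Longrightarrow> 0 < M j" and y: "\<And>j k. j \<in> J \<Longrightarrow> 0 \<le> y j k"
    and le: "\<And>j. j \<in> J \<Longrightarrow> lp_le p (y j) (M j)"
  shows "lp_le p (\<lambda>k. \<Sum>j\<in>J. y j k) (\<Sum>j\<in>J. M j)"
  unfolding lp_le_def
proof safe
  fix K :: "'k set" assume "finite K"
  define S where "S = (\<Sum>j\<in>J. M j)"
  have "S > 0" unfolding S_def using assms by (intro sum_pos) auto
  have one: "((\<Sum>j\<in>J. y j k) / S) powr p \<le> (\<Sum>j\<in>J. M j / S * (y j k / M j) powr p)" for k
  proof -
    have "(\<Sum>j\<in>J. y j k) / S = (\<Sum>j\<in>J. (M j / S) *\<^sub>R (y j k / M j))"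
      unfolding sum_divide_distrib by (intro sum.cong) (auto dest: M)
    moreover have "((\<Sum>j\<in>J. (M j / S) *\<^sub>R (y j k / M j))) powr p
        \<le> (\<Sum>j\<in>J. M j / S * (y j k / M j) powr p)"
    proof (rule convex_on_sum[OF assms(2,3) powr_convex_nonneg[OF assms(1)]])
      show "(\<Sum>j\<in>J. M j / S) = 1"
        using \<open>S > 0\<close> by (simp add: S_def flip: sum_divide_distrib)
    qed (use M y \<open>S > 0\<close> in \<open>auto simp: less_imp_le\<close>)
    ultimately show ?thesis by simp
  qed
  have "(\<Sum>k\<in>K. ((\<Sum>j\<in>J. y j k) / S) powr p) \<le> (\<Sum>k\<in>K. \<Sum>j\<in>J. M j / S * (y j k / M j) powr p)"
    using one by (intro sum_mono)
  also have "\<dots> = (\<Sum>j\<in>J. M j / S * (\<Sum>k\<in>K. (y j k / M j) powr p))"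
    by (subst sum.swap) (simp add: sum_distrib_left)
  also have "\<dots> \<le> (\<Sum>j\<in>J. M j / S * 1)"
  proof (intro sum_mono mult_left_mono)
    fix j assume "j \<in> J"
    have "(\<Sum>k\<in>K. (y j k / M j) powr p) = (\<Sum>k\<in>K. y j k powr p) / M j powr p"
      using M[OF \<open>j \<in> J\<close>] y[OF \<open>j \<in> J\<close>]
      by (simp add: powr_divide less_imp_le flip: sum_divide_distrib)
    also have "\<dots> \<le> 1"
      using le[OF \<open>j \<in> J\<close>] \<open>finite K\<close> M[OF \<open>j \<in> J\<close>] by (auto simp: lp_le_def divide_le_eq_1)
    finally show "(\<Sum>k\<in>K. (y j k / M j) powr p) \<le> 1" .
    show "0 \<le> M j / S" using M[OF \<open>j \<in> J\<close>] \<open>S > 0\<close> by simp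
  qed
  also have "\<dots> = 1"
    using \<open>S > 0\<close> by (simp add: S_def flip: sum_divide_distrib)
  finally have "(\<Sum>k\<in>K. ((\<Sum>j\<in>J. y j k) / S) powr p) \<le> 1" .
  moreover have "(\<Sum>k\<in>K. ((\<Sum>j\<in>J. y j k) / S) powr p)
      = (\<Sum>k\<in>K. (\<Sum>j\<in>J. y j k) powr p) / S powr p"
    using \<open>S > 0\<close> y by (simp add: powr_divide sum_nonneg flip: sum_divide_distrib)
  ultimately show "(\<Sum>k\<in>K. (\<Sum>j\<in>J. y j k) powr p) \<le> (\<Sum>j\<in>J. M j) powr p"
    using \<open>S > 0\<close> by (simp add: divide_le_eq_1 flip: S_def)
qed

text \<open>On a finite index set the partial sums over \<open>j\<close> converge coordinatewise, so
  Minkowski's inequality for finitely many terms passes to the limit.\<close>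

lemma lp_le_suminf:
  fixes y :: "nat \<Rightarrow> 'k \<Rightarrow> real"
  assumes "1 \<le> p" "\<And>j. 0 < M j" "\<And>j k. 0 \<le> y j k" "\<And>j. lp_le p (y j) (M j)"
    and sM: "summable M" and sy: "\<And>k. summable (\<lambda>j. y j k)"
    and x: "\<And>k. 0 \<le> x k" "\<And>k. x k \<le> (\<Sum>j. y j k)"
  shows "lp_le p x (\<Sum>j. M j)"
proof -
  have "lp_le p (\<lambda>k. \<Sum>j. y j k) (\<Sum>j. M j)"
    unfolding lp_le_def
  proof safe
    fix K :: "'k set" assume "finite K"
    have lim: "(\<lambda>n. \<Sum>k\<in>K. (\<Sum>j<n. y j k) powr p) \<longlonglongrightarrow> (\<Sum>k\<in>K. (\<Sum>j. y j k) powr p)"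
      using summable_LIMSEQ[OF sy] assms(1,3)
      by (intro tendsto_sum tendsto_powr2) (auto intro!: always_eventually sum_nonneg suminf_nonneg[OF sy])
    show "(\<Sum>k\<in>K. (\<Sum>j. y j k) powr p) \<le> (\<Sum>j. M j) powr p"
    proof (rule LIMSEQ_le_const2[OF lim], intro exI allI impI)
      fix n :: nat assume "n \<ge> 1"
      then have "lp_le p (\<lambda>k. \<Sum>j<n. y j k) (\<Sum>j<n. M j)"
        using assms by (intro lp_le_sum) (auto simp: lessThan_empty_iff)
      then have "lp_le p (\<lambda>k. \<Sum>j<n. y j k) (\<Sum>j. M j)"
        using assms by (elim lp_le_mono)
          (auto intro!: sum_nonneg sum_le_suminf simp: less_imp_le)
      then show "(\<Sum>k\<in>K. (\<Sum>j<n. y j k) powr p) \<le> (\<Sum>j. M j) powr p"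
        using \<open>finite K\<close> by (auto simp: lp_le_def)
    qed
  qed
  then show ?thesis
    using assms by (elim lp_le_mono) (auto intro!: suminf_nonneg simp: less_imp_le)
qed

lemma lp_le_add:
  assumes "1 \<le> p" "lp_le p x M" "lp_le p y N" "0 < M" "0 < N" "\<And>k. 0 \<le> x k" "\<And>k. 0 \<le> y k"
  shows "lp_le p (\<lambda>k. x k + y k) (M + N)"
  using lp_le_sum[of p "UNIV :: bool set" "\<lambda>b. if b then M else N" "\<lambda>b. if b then x else y"] assms
  by (simp add: UNIV_bool add.commute)

section \<open>The modulus and the multipliers\<close>

text \<open>Cauchy condensation: the block m < v \<le> 2m has m terms, each at least \<omega>(1 /
  (2m)) / (2m), hence contributes at least \<omega>(1 / (2m)) / 2.\<close>

lemma dyadic_block_sum_le: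
  fixes \<omega> :: "real \<Rightarrow> real"
  assumes mono: "mono_on {0..1} \<omega>" and pos: "\<And>t. 0 < t \<Longrightarrow> t \<le> 1 \<Longrightarrow> 0 < \<omega> t" and "1 \<le> n"
  shows "(\<Sum>j<J. \<omega> (1 / (2 ^ Suc j * real n))) / 2 \<le> (\<Sum>v\<in>{n<..2 ^ J * n}. 1 / real v * \<omega> (1 / real v))"
proof (induction J)
  case (Suc J)
  define m where "m = 2 ^ J * n"
  have "m \<ge> 1" using \<open>1 \<le> n\<close> by (simp add: m_def)
  have m2: "2 ^ Suc J * n = 2 * m" by (simp add: m_def)
  have "n \<le> m" by (simp add: m_def)
  then have "{n<..2 * m} = {n<..m} \<union> {m<..2 * m}"
    by auto
  then have split: "(\<Sum>v\<in>{n<..2 * m}. 1 / real v * \<omega> (1 / real v))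
      = (\<Sum>v\<in>{n<..m}. 1 / real v * \<omega> (1 / real v)) + (\<Sum>v\<in>{m<..2 * m}. 1 / real v * \<omega> (1 / real v))"
    by (simp add: sum.union_disjoint)
  have "\<omega> (1 / (2 ^ Suc J * real n)) / 2 = (\<Sum>v\<in>{m<..2 * m}. 1 / (2 * real m) * \<omega> (1 / (2 * real m)))"
    using \<open>m \<ge> 1\<close> by (simp add: m_def field_simps)
  also have "\<dots> \<le> (\<Sum>v\<in>{m<..2 * m}. 1 / real v * \<omega> (1 / real v))"
  proof (intro sum_mono mult_mono mono_onD[OF mono])
    show "0 \<le> \<omega> (1 / (2 * real m))"
      using \<open>m \<ge> 1\<close> by (intro less_imp_le[OF pos]) auto
  qed (use \<open>m \<ge> 1\<close> in \<open>auto simp: field_simps\<close>)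
  finally show ?case using Suc by (simp only: m2 split) (simp add: m_def add_divide_distrib)
qed auto

text \<open>The series condition speaks of the points 1/n. For small t put n = floor(1/t), so that
  1/(n + 1) < t \<le> 1/n, and compare the dyadic sum starting at t with the one starting at 1/(n +
  1), which condensation bounds by the given series. \<open>\<delta>\<close> is chosen so that n is
  past the threshold of the O-estimate.\<close>

lemma dini_dyadic:
  fixes \<omega> :: "real \<Rightarrow> real"
  assumes mono: "mono_on {0..1} \<omega>" and pos: "\<And>t. 0 < t \<Longrightarrow> t \<le> 1 \<Longrightarrow> 0 < \<omega> t"
    and sm: "summable (\<lambda>v. 1 / real (Suc v) * \<omega> (1 / real (Suc v)))"
    and bigo: "(\<lambda>n. \<Sum>v. 1 / real (n + 1 + v) * \<omega> (1 / real (n + 1 + v))) \<in> O(\<lambda>n. \<omega> (1 / real n))"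
  shows "\<exists>C>0. \<exists>\<delta>>0. \<delta> \<le> 1 \<and> (\<forall>t. 0 < t \<longrightarrow> t \<le> \<delta> \<longrightarrow>
           summable (\<lambda>j. \<omega> (t / 2 ^ j)) \<and> (\<Sum>j. \<omega> (t / 2 ^ j)) \<le> C * \<omega> t)"
proof -
  define g where "g = (\<lambda>v. 1 / real v * \<omega> (1 / real v))"
  have g0: "g v \<ge> 0" for v
    using pos[of "1 / real v"] by (cases "v = 0") (auto simp: g_def)
  have sg: "summable (\<lambda>v. g (n + 1 + v))" for n
    using summable_ignore_initial_segment[OF sm, of n] by (simp add: g_def add_ac)
  from bigo obtain C where C: "C > 0"
    and "\<forall>\<^sub>F n in sequentially. norm (\<Sum>v. g (n + 1 + v)) \<le> C * norm (\<omega> (1 / real n))"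
    unfolding g_def by (elim landau_o.bigE)
  then obtain n0 where n0: "\<And>n. n \<ge> n0 \<Longrightarrow> norm (\<Sum>v. g (n + 1 + v)) \<le> C * norm (\<omega> (1 / real n))"
    unfolding eventually_sequentially by blast
  have block: "(\<Sum>j<J. \<omega> (1 / (2 ^ Suc j * real n))) \<le> 2 * C * \<omega> (1 / real n)"
    if n: "n \<ge> n0" "n \<ge> 1" for n J
  proof -
    have "(\<Sum>j<J. \<omega> (1 / (2 ^ Suc j * real n))) / 2 \<le> (\<Sum>v\<in>{n<..2 ^ J * n}. g v)"
      using dyadic_block_sum_le[OF mono pos \<open>n \<ge> 1\<close>] by (simp add: g_def)
    also have "{n<..2 ^ J * n} = (\<lambda>v. n + 1 + v) ` {..<2 ^ J * n - n}"
    proof safe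
      fix v assume "v \<in> {n<..2 ^ J * n}"
      then show "v \<in> (\<lambda>v. n + 1 + v) ` {..<2 ^ J * n - n}"
        by (intro image_eqI[of _ _ "v - n - 1"]) auto
    qed auto
    also have "(\<Sum>v\<in>(\<lambda>v. n + 1 + v) ` {..<2 ^ J * n - n}. g v) = (\<Sum>v<2 ^ J * n - n. g (n + 1 + v))"
      by (subst sum.reindex) (auto simp: inj_on_def)
    also have "\<dots> \<le> (\<Sum>v. g (n + 1 + v))"
      by (intro sum_le_suminf sg g0) auto
    also have "\<dots> \<le> C * \<omega> (1 / real n)"
      using n0[OF n(1)] pos[of "1 / real n"] n(2) by auto
    finally show ?thesis by simp
  qed
  have bound: "(\<Sum>j<J. \<omega> (t / 2 ^ j)) \<le> (2 + 2 * C) * \<omega> t"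
    if t: "0 < t" "t \<le> 1 / (real n0 + 1)" for t J
  proof -
    have t1: "t \<le> 1" by (rule order_trans[OF t(2)]) simp
    define n where "n = nat \<lfloor>1 / t\<rfloor>"
    have n: "real n \<le> 1 / t" "1 / t < real (n + 1)"
      using t by (simp_all add: n_def) linarith
    have "real n0 + 1 \<le> 1 / t" using t by (simp add: field_simps)
    then have nn: "n \<ge> n0" "n \<ge> 1"
      using n by linarith+
    have pos': "0 < \<omega> (t / 2 ^ j)" for j
      using t t1 by (intro pos) (auto simp: divide_le_eq intro: order_trans[OF _ one_le_power])
    have le: "t / 2 ^ (j + 2) \<le> 1 / (2 ^ Suc j * real (n + 1))" for j
    proof -
      have "t * real (n + 1) \<le> t * (2 * real n)"
        using t nn by (intro mult_left_mono) auto
      also have "\<dots> \<le> 2" using n t by (simp add: field_simps)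
      finally have "t \<le> 2 / real (n + 1)" by (simp add: le_divide_eq)
      then have "t / 2 ^ (j + 2) \<le> 2 / real (n + 1) / 2 ^ (j + 2)"
        by (intro divide_right_mono) auto
      then show ?thesis by (simp add: mult_ac)
    qed
    \<comment> \<open>Two terms are split off so that the remaining arguments
      \<open>t / 2 ^ (j + 2)\<close> lie below \<open>1 / (2 ^ Suc j * real (n + 1))\<close>, as
      \<open>t * real (n + 1) \<le> 2\<close>. They account for the summand 2 in the
      constant.\<close>
    have "(\<Sum>j<J. \<omega> (t / 2 ^ j)) \<le> (\<Sum>j<J + 2. \<omega> (t / 2 ^ j))"
      using pos' by (intro sum_mono2) (auto simp: less_imp_le)
    also have "\<dots> = \<omega> t + \<omega> (t / 2) + (\<Sum>j<J. \<omega> (t / 2 ^ (j + 2)))"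
      by (simp only: add_2_eq_Suc' sum.lessThan_Suc_shift) simp
    also have "(\<Sum>j<J. \<omega> (t / 2 ^ (j + 2))) \<le> (\<Sum>j<J. \<omega> (1 / (2 ^ Suc j * real (n + 1))))"
    proof (intro sum_mono mono_onD[OF mono] le)
      fix j
      have "1 / (2 ^ Suc j * real (n + 1)) \<le> 1" 
        using mult_mono[of 1 "2 ^ Suc j" 1 "real (n + 1)"] one_le_power[of "2::real" "Suc j"]
        by (simp del: power_Suc)
      moreover have "0 \<le> t / 2 ^ (j + 2)" "0 \<le> 1 / (2 ^ Suc j * real (n + 1))" using t by simp_all
      ultimately show "t / 2 ^ (j + 2) \<in> {0..1}" "1 / (2 ^ Suc j * real (n + 1)) \<in> {0..1}"
        using le[of j] unfolding atLeastAtMost_iff by linarith+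
    qed
    also have "\<dots> \<le> 2 * C * \<omega> (1 / real (n + 1))"
      using nn by (intro block) auto
    also have "\<dots> \<le> 2 * C * \<omega> t"
      using n t t1 C by (intro mult_left_mono mono_onD[OF mono]) (auto simp: field_simps)
    also have "\<omega> (t / 2) \<le> \<omega> t"
      using t t1 by (intro mono_onD[OF mono]) auto
    finally show ?thesis by (simp add: algebra_simps)
  qed
  show ?thesis
  proof (intro exI conjI allI impI)
    show "2 + 2 * C > 0" using C by simp
    show "1 / (real n0 + 1) > 0" "1 / (real n0 + 1) \<le> 1" by auto
    fix t :: real assume t: "0 < t" "t \<le> 1 / (real n0 + 1)"
    have t1: "t \<le> 1" by (rule order_trans[OF t(2)]) simp
    have pos': "0 < \<omega> (t / 2 ^ j)" for j
      using t t1 by (intro pos) (auto simp: divide_le_eq intro: order_trans[OF _ one_le_power])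
    show s: "summable (\<lambda>j. \<omega> (t / 2 ^ j))"
      using bound[OF t] pos' by (intro summableI_nonneg_bounded) (auto simp: less_imp_le)
    show "(\<Sum>j. \<omega> (t / 2 ^ j)) \<le> (2 + 2 * C) * \<omega> t"
      by (rule suminf_le_const[OF s bound[OF t]])
  qed
qed

text \<open>The sum telescopes: of the two parts of the derivative of the term added in the
  induction step, one cancels the derivative of the previous sum, and the other has the same form
  with \<open>r + 1\<close>, by the absorption identity.\<close>

lemma tap_multiplier_has_derivative:
  "(tap_multiplier \<nu> r has_real_derivative
      real r * real (\<nu> choose r) * (1 - s) ^ (r - 1) * s ^ (\<nu> - r)) (at s)"
proof (induction r)
  case 0
  then show ?case by (simp add: tap_multiplier_def[abs_def])
next
  case (Suc r)
  have eq: "tap_multiplier \<nu> (Suc r) =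
      (\<lambda>s. tap_multiplier \<nu> r s + real (\<nu> choose r) * (1 - s) ^ r * s ^ (\<nu> - r))"
    by (simp add: tap_multiplier_def[abs_def])
  have absorb: "real (\<nu> choose r) * real (\<nu> - r) = real (Suc r) * real (\<nu> choose Suc r)"
  proof -
    have "(\<nu> choose r) * (\<nu> - r) = Suc r * (\<nu> choose Suc r)"
      by (metis binomial_absorb_comp binomial_absorption mult.commute)
    then show ?thesis by (metis of_nat_mult)
  qed
  have "((\<lambda>s. tap_multiplier \<nu> r s + real (\<nu> choose r) * (1 - s) ^ r * s ^ (\<nu> - r)) has_real_derivative
      real r * real (\<nu> choose r) * (1 - s) ^ (r - 1) * s ^ (\<nu> - r) +
      real (\<nu> choose r) * (- (real r * (1 - s) ^ (r - 1)) * s ^ (\<nu> - r)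
        + (1 - s) ^ r * (real (\<nu> - r) * s ^ (\<nu> - r - 1)))) (at s)"
    by (rule derivative_eq_intros Suc refl | simp)+ (simp add: algebra_simps)
  moreover have "real r * real (\<nu> choose r) * (1 - s) ^ (r - 1) * s ^ (\<nu> - r) +
      real (\<nu> choose r) * (- (real r * (1 - s) ^ (r - 1)) * s ^ (\<nu> - r)
        + (1 - s) ^ r * (real (\<nu> - r) * s ^ (\<nu> - r - 1)))
      = (real (\<nu> choose r) * real (\<nu> - r)) * (1 - s) ^ r * s ^ (\<nu> - Suc r)"
    by (simp add: algebra_simps)
  ultimately show ?case
    unfolding eq absorb by simp
qed

lemma tap_multiplier_mono:
  assumes "0 \<le> s" "s \<le> s'" "s' \<le> 1"
  shows "tap_multiplier \<nu> r s \<le> tap_multiplier \<nu> r s'"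
  using assms by (intro DERIV_nonneg_imp_nondecreasing[OF assms(2)])
    (auto intro!: exI tap_multiplier_has_derivative mult_nonneg_nonneg zero_le_power)

text \<open>Mean value theorem, with the decreasing factor taken at the left end and the increasing
  one at the right end: the power of \<open>s'\<close> is the one that a hypothesis at
  \<open>s'\<close> controls.\<close>

lemma tap_multiplier_diff_le:
  assumes "0 \<le> s" "s < s'" "s' \<le> 1"
  shows "tap_multiplier \<nu> r s' - tap_multiplier \<nu> r s
    \<le> (s' - s) * (real r * real (\<nu> choose r) * (1 - s) ^ (r - 1) * s' ^ (\<nu> - r))"
proof -
  obtain z where z: "s < z" "z < s'"
    and eq: "tap_multiplier \<nu> r s' - tap_multiplier \<nu> r s
      = (s' - s) * (real r * real (\<nu> choose r) * (1 - z) ^ (r - 1) * z ^ (\<nu> - r))"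
    using MVT2[OF assms(2) tap_multiplier_has_derivative] by blast
  show ?thesis unfolding eq
    using z assms by (intro mult_left_mono mult_mono power_mono) auto
qed

lemma tap_multiplier_1: "1 \<le> r \<Longrightarrow> tap_multiplier \<nu> r 1 = 1"
  by (induction r rule: dec_induct) (simp_all add: tap_multiplier_def)

lemma tap_multiplier_le_1:
  "1 \<le> r \<Longrightarrow> 0 \<le> s \<Longrightarrow> s \<le> 1 \<Longrightarrow> tap_multiplier \<nu> r s \<le> 1"
  using tap_multiplier_mono[of s 1 \<nu> r] tap_multiplier_1[of r \<nu>] by simp

lemma tap_multiplier_ge_0: "0 \<le> s \<Longrightarrow> s \<le> 1 \<Longrightarrow> 0 \<le> tap_multiplier \<nu> r s"
  unfolding tap_multiplier_def by (intro sum_nonneg) auto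

lemma tap_multiplier_binomial: "tap_multiplier \<nu> (Suc \<nu>) s = 1"
  using binomial_ring[of "1 - s" s \<nu>]
  by (simp add: tap_multiplier_def lessThan_Suc_atMost)

text \<open>All binomial probabilities are then included in the sum. Hence the finite sum and the
  series in \<open>taylor_abel_poisson\<close> form one series with a single multiplier.\<close>

lemma tap_multiplier_low:
  assumes "\<nu> < r"
  shows "tap_multiplier \<nu> r s = 1"
proof -
  have "tap_multiplier \<nu> r s = tap_multiplier \<nu> (Suc \<nu>) s"
    unfolding tap_multiplier_def using assms by (intro sum.mono_neutral_right) auto
  then show ?thesis by (simp add: tap_multiplier_binomial)
qed

lemma tap_multiplier_gap:
  assumes "0 \<le> s" "s \<le> 1"
  shows "real (\<nu> choose r) * (1 - s) ^ r * s ^ \<nu> \<le> 1 - tap_multiplier \<nu> r s"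
proof (cases "\<nu> < r")
  case True
  then show ?thesis by (simp add: tap_multiplier_low binomial_eq_0)
next
  case False
  have "real (\<nu> choose r) * (1 - s) ^ r * s ^ \<nu> \<le> real (\<nu> choose r) * (1 - s) ^ r * s ^ (\<nu> - r)"
    using assms by (intro mult_left_mono power_decreasing) auto
  also have "\<dots> = tap_multiplier \<nu> (Suc r) s - tap_multiplier \<nu> r s"
    by (simp add: tap_multiplier_def)
  also have "tap_multiplier \<nu> (Suc r) s \<le> 1"
    using assms by (intro tap_multiplier_le_1) auto
  finally show ?thesis by simp
qed

lemma tap_multiplier_tendsto:
  assumes "1 \<le> r" "\<sigma> \<longlonglongrightarrow> 1"
  shows "(\<lambda>j. tap_multiplier \<nu> r (\<sigma> j)) \<longlonglongrightarrow> 1"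
  using isCont_tendsto_compose[OF DERIV_isCont[OF tap_multiplier_has_derivative[of \<nu> r 1]] assms(2)]
  by (simp add: tap_multiplier_1[OF assms(1)])

text \<open>The series condition enters the estimates in its dyadic form. The families
  \<open>a\<close> and the norms \<open>n\<close> below stay abstract because
  \<open>deriv_imp_gap\<close> is applied to f at order \<open>r\<close> and again to its derivative
  at order 1.\<close>

locale dini_modulus =
  fixes \<omega> :: "real \<Rightarrow> real" and D \<delta> :: real
  assumes pos: "\<And>t. 0 < t \<Longrightarrow> t \<le> 1 \<Longrightarrow> 0 < \<omega> t"
    and mono: "\<And>s t. 0 < s \<Longrightarrow> s \<le> t \<Longrightarrow> t \<le> 1 \<Longrightarrow> \<omega> s \<le> \<omega> t"
    and D_pos: "0 < D" and \<delta>_pos: "0 < \<delta>" and \<delta>_le: "\<delta> \<le> 1"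
    and dini_summable: "\<And>t. 0 < t \<Longrightarrow> t \<le> \<delta> \<Longrightarrow> summable (\<lambda>j. \<omega> (t / 2 ^ j))"
    and dini_le: "\<And>t. 0 < t \<Longrightarrow> t \<le> \<delta> \<Longrightarrow> (\<Sum>j. \<omega> (t / 2 ^ j)) \<le> D * \<omega> t"
begin

lemma dyadic_le: "0 < t \<Longrightarrow> t / 2 ^ j \<le> (t::real)"
  by (simp add: divide_le_eq)

text \<open>The comparison takes place at one and the same \<rho>: dividing the hypothesis by (1 -
  \<rho>)^r leaves exactly \<omega>(1 - \<rho>) / (1 - \<rho>).\<close>

lemma gap_imp_deriv:
  assumes \<rho>: "0 < \<rho>" "\<rho> < 1" and "1 \<le> r" "1 \<le> p" "0 < B" and a: "\<And>k. 0 \<le> a k"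
    and le: "lp_le p (\<lambda>k. (1 - tap_multiplier (n k) r \<rho>) * a k) (B * ((1 - \<rho>) ^ (r - 1) * \<omega> (1 - \<rho>)))"
  shows "lp_le p (\<lambda>k. real (n k choose r) * \<rho> ^ n k * a k) (B * (\<omega> (1 - \<rho>) / (1 - \<rho>)))"
proof -
  have w: "0 < \<omega> (1 - \<rho>)" using \<rho> by (intro pos) auto
  have "(1 - \<rho>) ^ r = (1 - \<rho>) * (1 - \<rho>) ^ (r - 1)"
    using \<open>1 \<le> r\<close> by (simp flip: power_Suc)
  then have eq: "1 / (1 - \<rho>) ^ r * (B * ((1 - \<rho>) ^ (r - 1) * \<omega> (1 - \<rho>))) = B * (\<omega> (1 - \<rho>) / (1 - \<rho>))"
    using \<rho> by simp
  have "lp_le p (\<lambda>k. 1 / (1 - \<rho>) ^ r * ((1 - tap_multiplier (n k) r \<rho>) * a k))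
     (1 / (1 - \<rho>) ^ r * (B * ((1 - \<rho>) ^ (r - 1) * \<omega> (1 - \<rho>))))"
    using \<rho> w assms by (intro lp_le_scale[OF le]) (auto intro!: mult_nonneg_nonneg tap_multiplier_le_1)
  then show ?thesis unfolding eq
  proof (rule lp_le_mono)
    fix k
    have "real (n k choose r) * \<rho> ^ n k \<le> 1 / (1 - \<rho>) ^ r * (1 - tap_multiplier (n k) r \<rho>)"
      using tap_multiplier_gap[of \<rho> "n k" r] \<rho> by (simp add: field_simps)
    from mult_right_mono[OF this a]
    show "real (n k choose r) * \<rho> ^ n k * a k
        \<le> 1 / (1 - \<rho>) ^ r * ((1 - tap_multiplier (n k) r \<rho>) * a k)"
      by (simp only: mult.assoc)
  qed (use assms w in auto)
qed

text \<open>With \<open>\<rho>\<^sub>j = 1 - t / 2\<^sup>j\<close> the factor \<open>1 - \<lambda>(\<rho>)\<close> telescopes into the increments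
  \<open>\<lambda>(\<rho>\<^sub>j\<^sub>+\<^sub>1) - \<lambda>(\<rho>\<^sub>j)\<close>, each of which the mean value theorem compares with the hypothesis
  at \<open>\<rho>\<^sub>j\<^sub>+\<^sub>1\<close>.\<close>

lemma deriv_imp_gap:
  assumes "1 \<le> r" "1 \<le> p" "0 < B" and a: "\<And>k. 0 \<le> a k"
    and ev: "\<forall>\<^sub>F \<rho> in at_left 1. lp_le p (\<lambda>k. real (n k choose r) * \<rho> ^ n k * a k)
               (B * (\<omega> (1 - \<rho>) / (1 - \<rho>)))"
  shows "\<exists>B'>0. \<forall>\<^sub>F \<rho> in at_left 1. lp_le p (\<lambda>k. (1 - tap_multiplier (n k) r \<rho>) * a k)
               (B' * ((1 - \<rho>) ^ (r - 1) * \<omega> (1 - \<rho>)))"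
proof -
  obtain b where b: "b < 1"
    and H: "\<And>\<rho>. b < \<rho> \<Longrightarrow> \<rho> < 1 \<Longrightarrow> lp_le p (\<lambda>k. real (n k choose r) * \<rho> ^ n k * a k)
               (B * (\<omega> (1 - \<rho>) / (1 - \<rho>)))"
    using ev unfolding eventually_at_left_field by blast
  \<comment> \<open>\<open>real r\<close> comes from the derivative of \<lambda>;
    \<open>2 ^ r\<close> pays for raising the exponent \<open>n k - r\<close> to \<open>n k\<close>
    at points above 1/2.\<close>
  define A where "A = real r * 2 ^ r * B"
  have A: "A > 0" using assms by (simp add: A_def)
  have main: "lp_le p (\<lambda>k. (1 - tap_multiplier (n k) r \<rho>) * a k)
               (A * D * ((1 - \<rho>) ^ (r - 1) * \<omega> (1 - \<rho>)))"
    if \<rho>: "max b (max (1 / 2) (1 - \<delta>)) < \<rho>" "\<rho> < 1" for \<rho>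
  proof -
    define t where "t = 1 - \<rho>"
    have t: "0 < t" "t < 1 / 2" "t \<le> \<delta>" "t < 1 - b" "t \<le> 1" using \<rho> by (auto simp: t_def)
    define \<sigma> where "\<sigma> = (\<lambda>j. 1 - t / 2 ^ j)"
    have \<sigma>: "1 / 2 < \<sigma> j" "b < \<sigma> j" "\<sigma> j < 1" "0 \<le> \<sigma> j" for j
    proof -
      have "0 < t / 2 ^ j" using t by simp
      then show "1 / 2 < \<sigma> j" "b < \<sigma> j" "\<sigma> j < 1" "0 \<le> \<sigma> j"
        using t dyadic_le[of t j] unfolding \<sigma>_def by linarith+
    qed
    have \<sigma>_less: "\<sigma> j < \<sigma> (Suc j)" for j
      using t by (simp add: \<sigma>_def field_simps)
    define y where "y = (\<lambda>j k. (tap_multiplier (n k) r (\<sigma> (Suc j)) - tap_multiplier (n k) r (\<sigma> j)) * a k)"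
    define M where "M = (\<lambda>j. A * t ^ (r - 1) * \<omega> (t / 2 ^ j))"
    have w: "0 < \<omega> (t / 2 ^ j)" for j
    proof -
      have "0 < t / 2 ^ j" "t / 2 ^ j \<le> t" using t dyadic_le[of t j] by auto
      then show ?thesis using t by (intro pos) linarith+
    qed
    have "(\<lambda>j. t * (1 / 2) ^ j) \<longlonglongrightarrow> t * 0"
      by (intro tendsto_mult tendsto_const LIMSEQ_power_zero) auto
    from tendsto_diff[OF tendsto_const[of 1] this] have "\<sigma> \<longlonglongrightarrow> 1"
      by (simp add: \<sigma>_def[abs_def] power_one_over)
    then have sums: "(\<lambda>j. y j k) sums ((1 - tap_multiplier (n k) r \<rho>) * a k)" for k
      using sums_mult2[OF telescope_sums[OF tap_multiplier_tendsto[OF \<open>1 \<le> r\<close>, of \<sigma> "n k"]], of "a k"]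
      by (simp add: y_def \<sigma>_def t_def)
    have "lp_le p (\<lambda>k. (1 - tap_multiplier (n k) r \<rho>) * a k) (\<Sum>j. M j)"
    proof (rule lp_le_suminf[OF \<open>1 \<le> p\<close>, of M y])
      show "0 < M j" for j using A t w by (simp add: M_def)
      show "0 \<le> y j k" for j k
        using \<sigma>_less[of j] \<sigma>[of j] \<sigma>[of "Suc j"] a[of k]
        by (auto simp: y_def intro!: mult_nonneg_nonneg tap_multiplier_mono)
      then show "lp_le p (y j) (M j)" for j
      proof -
        define c where "c = t / 2 ^ Suc j * real r * (t / 2 ^ j) ^ (r - 1) * 2 ^ r"
        have c: "c \<ge> 0" using t by (simp add: c_def)
        have u: "0 < \<omega> (t / 2 ^ Suc j)" by (rule w)
        have "t / 2 ^ j \<le> 1" using dyadic_le[of t j] t by linarith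
        have 1: "lp_le p (\<lambda>k. c * (real (n k choose r) * \<sigma> (Suc j) ^ n k * a k))
            (c * (B * (\<omega> (t / 2 ^ Suc j) / (t / 2 ^ Suc j))))"
          using H[OF \<sigma>(2,3), of "Suc j"] c u t \<sigma>[of "Suc j"] \<open>0 < B\<close> a
          by (intro lp_le_scale) (auto simp: \<sigma>_def)
        show ?thesis
        proof (rule lp_le_mono[OF 1])
          have "c * (B * (\<omega> (t / 2 ^ Suc j) / (t / 2 ^ Suc j))) = A * (t / 2 ^ j) ^ (r - 1) * \<omega> (t / 2 ^ Suc j)"
            using t by (simp add: c_def A_def)
          \<comment> \<open>The gain 2^(-j (r - 1)) is given away, since for \<open>r = 1\<close>
            there is none: summability over \<open>j\<close> comes from the modulus.\<close>
          also have "\<dots> \<le> A * t ^ (r - 1) * \<omega> (t / 2 ^ j)"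
            using A t u \<open>t / 2 ^ j \<le> 1\<close>
            by (intro mult_mono power_mono mono) (auto simp: field_simps less_imp_le)
          finally show "c * (B * (\<omega> (t / 2 ^ Suc j) / (t / 2 ^ Suc j))) \<le> M j"
            by (simp add: M_def)
          show "0 \<le> c * (B * (\<omega> (t / 2 ^ Suc j) / (t / 2 ^ Suc j)))"
            using c u t \<open>0 < B\<close> by simp
          show "y j k \<le> c * (real (n k choose r) * \<sigma> (Suc j) ^ n k * a k)" for k
          proof (cases "n k < r")
            case True
            then show ?thesis by (simp add: y_def tap_multiplier_low binomial_eq_0)
          next
            case False
            have "1 \<le> (2 * \<sigma> (Suc j)) ^ r"
              using \<sigma>(1)[of "Suc j"] by (intro one_le_power) simp
            then have "\<sigma> (Suc j) ^ (n k - r) * 1 \<le> \<sigma> (Suc j) ^ (n k - r) * (2 * \<sigma> (Suc j)) ^ r"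
              using \<sigma>(4)[of "Suc j"] by (intro mult_left_mono) auto
            also have "\<dots> = 2 ^ r * (\<sigma> (Suc j) ^ (n k - r) * \<sigma> (Suc j) ^ r)"
              by (simp add: power_mult_distrib)
            also have "\<dots> = 2 ^ r * \<sigma> (Suc j) ^ n k"
              using False by (simp flip: power_add)
            finally have pw: "\<sigma> (Suc j) ^ (n k - r) \<le> 2 ^ r * \<sigma> (Suc j) ^ n k" by simp
            have "tap_multiplier (n k) r (\<sigma> (Suc j)) - tap_multiplier (n k) r (\<sigma> j)
              \<le> (\<sigma> (Suc j) - \<sigma> j) * (real r * real (n k choose r) * (1 - \<sigma> j) ^ (r - 1) * \<sigma> (Suc j) ^ (n k - r))"
              using \<sigma>_less \<sigma>[of "Suc j"] \<sigma>[of j] by (intro tap_multiplier_diff_le) auto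
            also have "\<dots> \<le> (\<sigma> (Suc j) - \<sigma> j) * (real r * real (n k choose r) * (1 - \<sigma> j) ^ (r - 1) * (2 ^ r * \<sigma> (Suc j) ^ n k))"
              using \<sigma>_less[of j] \<sigma>[of j] pw by (intro mult_left_mono) auto
            also have "\<sigma> (Suc j) - \<sigma> j = t / 2 ^ Suc j"
              by (simp add: \<sigma>_def field_simps)
            also have "1 - \<sigma> j = t / 2 ^ j" by (simp add: \<sigma>_def)
            also have "t / 2 ^ Suc j * (real r * real (n k choose r) * (t / 2 ^ j) ^ (r - 1) * (2 ^ r * \<sigma> (Suc j) ^ n k))
               = c * (real (n k choose r) * \<sigma> (Suc j) ^ n k)"
              by (simp add: c_def)
            finally have "tap_multiplier (n k) r (\<sigma> (Suc j)) - tap_multiplier (n k) r (\<sigma> j)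
                \<le> c * (real (n k choose r) * \<sigma> (Suc j) ^ n k)" .
            from mult_right_mono[OF this a[of k]] show ?thesis
              by (simp only: y_def mult.assoc)
          qed
        qed (use assms \<open>\<And>j k. 0 \<le> y j k\<close> in auto)
      qed
      show "summable M"
        unfolding M_def by (intro summable_mult dini_summable t)
      show "summable (\<lambda>j. y j k)" "(1 - tap_multiplier (n k) r \<rho>) * a k \<le> (\<Sum>j. y j k)" for k
        using sums[of k] by (auto simp: sums_iff)
      show "0 \<le> (1 - tap_multiplier (n k) r \<rho>) * a k" for k
        using a[of k] \<rho> \<open>1 \<le> r\<close> by (intro mult_nonneg_nonneg) (auto intro!: tap_multiplier_le_1)
    qed
    then show ?thesis
    proof (rule lp_le_mono)
      show "0 \<le> (\<Sum>j. M j)"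
        using A t w unfolding M_def
        by (intro suminf_nonneg summable_mult dini_summable) (auto simp: less_imp_le)
      have "(\<Sum>j. M j) = A * t ^ (r - 1) * (\<Sum>j. \<omega> (t / 2 ^ j))"
        unfolding M_def by (intro suminf_mult dini_summable t)
      also have "\<dots> \<le> A * t ^ (r - 1) * (D * \<omega> t)"
        using A t by (intro mult_left_mono dini_le) auto
      finally show "(\<Sum>j. M j) \<le> A * D * ((1 - \<rho>) ^ (r - 1) * \<omega> (1 - \<rho>))"
        by (simp add: t_def mult_ac)
      show "0 \<le> (1 - tap_multiplier (n k) r \<rho>) * a k" for k
        using a[of k] \<rho> \<open>1 \<le> r\<close> by (intro mult_nonneg_nonneg) (auto intro!: tap_multiplier_le_1)
    qed (use assms in auto)
  qed
  show ?thesis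
  proof (intro exI conjI)
    show "A * D > 0" using A D_pos by simp
    show "\<forall>\<^sub>F \<rho> in at_left 1. lp_le p (\<lambda>k. (1 - tap_multiplier (n k) r \<rho>) * a k)
               (A * D * ((1 - \<rho>) ^ (r - 1) * \<omega> (1 - \<rho>)))"
      unfolding eventually_at_left_field
      using main b \<delta>_pos by (intro exI[of _ "max b (max (1 / 2) (1 - \<delta>))"]) auto
  qed
qed

text \<open>The frequencies are split at \<open>n k \<approx> 2\<^sup>j / t\<close>, \<open>t = 1 - \<rho>\<close>; above \<open>2\<^sup>j\<^sup>-\<^sup>1 / t\<close>
  the factor \<open>\<rho> ^ n k\<close> is below \<open>exp (- 2\<^sup>j\<^sup>-\<^sup>1) \<le> 8 / 4\<^sup>j\<close>, which outweighs the growth of the block.\<close>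

lemma truncated_imp_deriv:
  assumes "1 \<le> p" "0 < B" "0 < \<eta>" and b: "\<And>k. 0 \<le> b k"
    and H: "\<And>h. 0 < h \<Longrightarrow> h < \<eta> \<Longrightarrow>
              lp_le p (\<lambda>k. if real (n k) * h \<le> 1 then real (n k) * h * b k else 0) (B * \<omega> h)"
  shows "\<exists>B'>0. \<forall>\<^sub>F \<rho> in at_left 1.
           lp_le p (\<lambda>k. real (n k) * \<rho> ^ n k * b k) (B' * (\<omega> (1 - \<rho>) / (1 - \<rho>)))"
proof -
  have main: "lp_le p (\<lambda>k. real (n k) * \<rho> ^ n k * b k) (16 * B * (\<omega> (1 - \<rho>) / (1 - \<rho>)))"
    if \<rho>: "max 0 (1 - \<eta>) < \<rho>" "\<rho> < 1" for \<rho>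
  proof -
    define t where "t = 1 - \<rho>"
    have t: "0 < t" "t < \<eta>" "t \<le> 1" using \<rho> by (auto simp: t_def)
    have w: "0 < \<omega> t" using t by (intro pos) auto
    \<comment> \<open>\<open>y j\<close> keeps all frequencies up to 2^j / t and not just a dyadic
      shell: the hypothesis at h = t / 2^j bounds them together, and for each \<open>k\<close> one
      well-chosen \<open>j\<close> already dominates.\<close>
    define y where "y = (\<lambda>j k. if real (n k) * (t / 2 ^ j) \<le> 1 then real (n k) * b k * (8 / 4 ^ j) else 0)"
    \<comment> \<open>Frequencies up to 2^j / t cost a factor 2^j against the gain 8 / 4^j; the
      resulting geometric series doubles 8 to the 16 of the claim.\<close>
    define M where "M = (\<lambda>j. 8 * B * \<omega> t / t * (1 / 2) ^ j)"
    have y0: "0 \<le> y j k" for j k using b[of k] by (simp add: y_def)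
    have geo: "summable (\<lambda>j. 8 * (1 / 4) ^ j :: real)"
      by (intro summable_mult summable_geometric) auto
    have sy: "summable (\<lambda>j. y j k)" for k
    proof (rule summable_comparison_test')
      show "summable (\<lambda>j. real (n k) * b k * (8 * (1 / 4) ^ j))"
        by (intro summable_mult geo)
      show "norm (y j k) \<le> real (n k) * b k * (8 * (1 / 4) ^ j)" for j
        using b[of k] by (auto simp: y_def power_one_over)
    qed
    have "lp_le p (\<lambda>k. real (n k) * \<rho> ^ n k * b k) (\<Sum>j. M j)"
    proof (rule lp_le_suminf[OF \<open>1 \<le> p\<close>, of M y])
      show "0 < M j" for j using w t \<open>0 < B\<close> by (simp add: M_def)
      show "lp_le p (y j) (M j)" for j
      proof -
        have h: "0 < t / 2 ^ j" "t / 2 ^ j \<le> t" using t dyadic_le[of t j] by auto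
        have wj: "0 < \<omega> (t / 2 ^ j)" using h t by (intro pos) linarith+
        have 1: "lp_le p (\<lambda>k. 8 / (2 ^ j * t) * (if real (n k) * (t / 2 ^ j) \<le> 1 then real (n k) * (t / 2 ^ j) * b k else 0))
            (8 / (2 ^ j * t) * (B * \<omega> (t / 2 ^ j)))"
          using h t wj \<open>0 < B\<close> b by (intro lp_le_scale[OF H]) auto
        show ?thesis
        proof (rule lp_le_mono[OF 1])
          have "\<omega> (t / 2 ^ j) \<le> \<omega> t" using h t by (intro mono) auto
          then have "8 / (2 ^ j * t) * (B * \<omega> (t / 2 ^ j)) \<le> 8 / (2 ^ j * t) * (B * \<omega> t)"
            using t \<open>0 < B\<close> by (intro mult_left_mono) auto
          then show "8 / (2 ^ j * t) * (B * \<omega> (t / 2 ^ j)) \<le> M j"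
            by (simp add: M_def power_one_over field_simps)
          show "y j k \<le> 8 / (2 ^ j * t) * (if real (n k) * (t / 2 ^ j) \<le> 1 then real (n k) * (t / 2 ^ j) * b k else 0)" for k
          proof -
            have "(4::real) ^ j = 2 ^ j * 2 ^ j" by (simp flip: power_mult_distrib)
            then show ?thesis using t by (simp add: y_def field_simps)
          qed
        qed (use assms y0 t wj in auto)
      qed
      show "summable M"
        unfolding M_def by (intro summable_mult summable_geometric) auto
      show "real (n k) * \<rho> ^ n k * b k \<le> (\<Sum>j. y j k)" for k
      proof (cases "n k = 0")
        case True
        then show ?thesis using y0 sy by (simp add: suminf_nonneg)
      next
        case False
        define j where "j = (LEAST j. real (n k) * (t / 2 ^ j) \<le> 1)"
        have "(\<lambda>j. real (n k) * t * (1 / 2) ^ j) \<longlonglongrightarrow> real (n k) * t * 0"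
          by (intro tendsto_mult tendsto_const LIMSEQ_power_zero) auto
        then have "\<forall>\<^sub>F j in sequentially. real (n k) * t * (1 / 2) ^ j < 1"
          by (intro order_tendstoD(2)) auto
        then obtain j0 where "real (n k) * t * (1 / 2) ^ j0 < 1"
          unfolding eventually_sequentially by blast
        then have ex: "real (n k) * (t / 2 ^ j0) \<le> 1"
          by (simp add: power_one_over)
        have j: "real (n k) * (t / 2 ^ j) \<le> 1"
          unfolding j_def by (rule LeastI[of _ j0]) (rule ex)
        have "\<rho> ^ n k \<le> 8 / 4 ^ j"
        proof (cases j)
          case 0
          have "\<rho> ^ n k \<le> 1" using \<rho> by (intro power_le_one) auto
          then show ?thesis using 0 by simp
        next
          case (Suc i)
          then have i: "2 ^ i < real (n k) * t"
            using not_less_Least[of i "\<lambda>j. real (n k) * (t / 2 ^ j) \<le> 1"] by (simp add: j_def field_simps)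
          have "\<rho> ^ n k \<le> exp (- t) ^ n k"
            using exp_ge_add_one_self[of "- t"] \<rho> by (intro power_mono) (auto simp: t_def)
          also have "\<dots> = exp (- (real (n k) * t))"
            by (simp flip: exp_of_nat_mult)
          also have "\<dots> \<le> exp (- (2 ^ i))" using i by simp
          also have "\<dots> = 1 / exp (2 ^ i)" by (simp add: exp_minus inverse_eq_divide)
          also have "\<dots> \<le> 1 / ((2 ^ i)\<^sup>2 / 2)"
          proof (intro divide_left_mono)
            show "(2 ^ i)\<^sup>2 / 2 \<le> exp (2 ^ i :: real)"
              using exp_lower_Taylor_quadratic[of "2 ^ i"] zero_le_power[of "2::real" i] by linarith
          qed auto
          also have "\<dots> = 8 / 4 ^ j"
            by (simp add: Suc power2_eq_square flip: power_mult_distrib)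
          finally show ?thesis .
        qed
        then have "real (n k) * b k * \<rho> ^ n k \<le> real (n k) * b k * (8 / 4 ^ j)"
          using b[of k] by (intro mult_left_mono) auto
        then have "real (n k) * \<rho> ^ n k * b k \<le> y j k"
          using j by (simp add: y_def mult_ac)
        also have "\<dots> = (\<Sum>j\<in>{j}. y j k)" by simp
        also have "\<dots> \<le> (\<Sum>j. y j k)"
          by (intro sum_le_suminf sy y0) auto
        finally show ?thesis .
      qed
    qed (use y0 sy b \<rho> in auto)
    moreover have "(\<Sum>j. M j) = 16 * B * (\<omega> (1 - \<rho>) / (1 - \<rho>))"
      unfolding M_def by (subst suminf_mult) (auto simp: suminf_geometric t_def)
    ultimately show ?thesis by simp
  qed
  show ?thesis
  proof (intro exI conjI)
    show "16 * B > 0" using \<open>0 < B\<close> by simp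
    show "\<forall>\<^sub>F \<rho> in at_left 1. lp_le p (\<lambda>k. real (n k) * \<rho> ^ n k * b k) (16 * B * (\<omega> (1 - \<rho>) / (1 - \<rho>)))"
      unfolding eventually_at_left_field
      using main \<open>0 < \<eta>\<close> by (intro exI[of _ "max 0 (1 - \<eta>)"]) auto
  qed
qed

end

section \<open>The two approximation processes in terms of coefficients\<close>

lemma fourier_coeff_bounded: "\<exists>A\<ge>0. \<forall>k. norm (fourier_coeff f k) \<le> A"
  using norm_fourier_coeff_le[of f] by (intro exI[of _ "LINT x|torus_measure. norm (f x)"]) auto

lemma trig_poly_layer_mult:
  "trig_poly {k. freq_norm k = \<nu>} (\<lambda>k. complex_of_real (m (freq_norm k)) * fourier_coeff f k) x
    = complex_of_real (m \<nu>) * fourier_layer \<nu> f x"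
  by (simp add: fourier_layer_trig_poly trig_poly_def sum_distrib_left mult_ac)

lemma summable_trig_poly_layers:
  assumes "summable (\<lambda>\<nu>. \<Sum>k | freq_norm k = \<nu>. norm (c k))"
  shows "summable (\<lambda>\<nu>. trig_poly {k. freq_norm k = \<nu>} c x)"
  by (rule summable_comparison_test'[OF assms]) (rule norm_trig_poly_le)

lemma summable_multiplier_layers:
  fixes f :: "real^'d \<Rightarrow> complex"
  assumes q: "0 \<le> q" "q < 1" and m: "\<And>\<nu>. 1 \<le> \<nu> \<Longrightarrow> \<bar>m \<nu>\<bar> \<le> C * real \<nu> ^ r * q ^ \<nu>"
  shows "summable (\<lambda>\<nu>. \<Sum>k | freq_norm k = \<nu>. norm (complex_of_real (m (freq_norm k)) * fourier_coeff f k))"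
proof -
  obtain A where A: "0 \<le> A" "\<And>k. norm (fourier_coeff f k) \<le> A"
    using fourier_coeff_bounded[of f] by blast
  show ?thesis
  proof (rule summable_layers[OF q, of _ "A * C" r])
    fix k :: "int^'d" assume k: "1 \<le> freq_norm k"
    have "\<bar>m (freq_norm k)\<bar> * norm (fourier_coeff f k) \<le> (C * real (freq_norm k) ^ r * q ^ freq_norm k) * A"
      using m[OF k] A by (intro mult_mono) auto
    then show "norm (complex_of_real (m (freq_norm k)) * fourier_coeff f k)
        \<le> A * C * real (freq_norm k) ^ r * q ^ freq_norm k"
      by (simp add: norm_mult mult_ac)
  qed
qed

lemma real_binomial_le_power: "real (\<nu> choose r) \<le> real \<nu> ^ r"
proof (cases "r \<le> \<nu>")
  case True
  then show ?thesis using binomial_le_pow[OF True] by (simp flip: of_nat_power)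
next
  case False
  then show ?thesis by (simp add: binomial_eq_0)
qed

text \<open>Needed for convergence at a fixed \<rho>, so the constant may blow up as \<rho> tends to
  0; it comes from \<rho>^(\<nu> - j) = \<rho>^(-j) \<rho>^\<nu>.\<close>

lemma tap_multiplier_bound:
  assumes \<rho>: "0 < \<rho>" "\<rho> < 1" and \<nu>: "1 \<le> \<nu>"
  shows "\<bar>tap_multiplier \<nu> r \<rho>\<bar> \<le> (real r * (1 / \<rho>) ^ r) * real \<nu> ^ r * \<rho> ^ \<nu>"
proof -
  have "tap_multiplier \<nu> r \<rho> \<le> (\<Sum>j<r. (1 / \<rho>) ^ r * real \<nu> ^ r * \<rho> ^ \<nu>)"
    unfolding tap_multiplier_def
  proof (rule sum_mono)
    fix j assume "j \<in> {..<r}"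
    then have j: "j \<le> r" by simp
    show "real (\<nu> choose j) * (1 - \<rho>) ^ j * \<rho> ^ (\<nu> - j) \<le> (1 / \<rho>) ^ r * real \<nu> ^ r * \<rho> ^ \<nu>"
    proof (cases "j \<le> \<nu>")
      case True
      have "real (\<nu> choose j) * (1 - \<rho>) ^ j * \<rho> ^ (\<nu> - j) \<le> real \<nu> ^ j * 1 * ((1 / \<rho>) ^ j * \<rho> ^ \<nu>)"
      proof (intro mult_mono real_binomial_le_power power_le_one)
        show "\<rho> ^ (\<nu> - j) \<le> (1 / \<rho>) ^ j * \<rho> ^ \<nu>"
          using \<rho> True by (simp add: power_diff power_one_over field_simps)
      qed (use \<rho> in auto)
      also have "\<dots> \<le> real \<nu> ^ r * 1 * ((1 / \<rho>) ^ r * \<rho> ^ \<nu>)"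
        using \<rho> \<nu> j by (intro mult_mono order_refl power_increasing) auto
      finally show ?thesis by (simp add: mult_ac)
    next
      case False
      then show ?thesis using \<rho> by (simp add: binomial_eq_0)
    qed
  qed
  then show ?thesis
    using tap_multiplier_ge_0[of \<rho> \<nu> r] \<rho> by (simp add: mult_ac)
qed

lemma taylor_abel_poisson_coeffs:
  fixes f :: "real^'d \<Rightarrow> complex"
  assumes f: "f \<in> L1_torus" and \<rho>: "0 < \<rho>" "\<rho> < 1"
  shows "(\<lambda>x. f x - taylor_abel_poisson \<rho> r f x) \<in> L1_torus"
    and "fourier_coeff (\<lambda>x. f x - taylor_abel_poisson \<rho> r f x) k
      = complex_of_real (1 - tap_multiplier (freq_norm k) r \<rho>) * fourier_coeff f k"
proof -
  define c where "c = (\<lambda>k. complex_of_real (tap_multiplier (freq_norm k) r \<rho>) * fourier_coeff f k)"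
  have sm: "summable (\<lambda>\<nu>. \<Sum>k | freq_norm k = \<nu>. norm (c k))"
    unfolding c_def using \<rho>
    by (intro summable_multiplier_layers[where q = \<rho> and r = r and C = "real r * (1 / \<rho>) ^ r"]
      tap_multiplier_bound) auto
  have "taylor_abel_poisson \<rho> r f = (\<lambda>x. \<Sum>\<nu>. trig_poly {k. freq_norm k = \<nu>} c x)"
  proof
    fix x
    have layer: "trig_poly {k. freq_norm k = \<nu>} c x = complex_of_real (tap_multiplier \<nu> r \<rho>) * fourier_layer \<nu> f x" for \<nu>
      unfolding c_def by (rule trig_poly_layer_mult)
    show "taylor_abel_poisson \<rho> r f x = (\<Sum>\<nu>. trig_poly {k. freq_norm k = \<nu>} c x)"
      unfolding suminf_split_initial_segment[OF summable_trig_poly_layers[OF sm], of _ r]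
      unfolding layer taylor_abel_poisson_def
      by (simp add: tap_multiplier_low add.commute)
  qed
  with trig_series_layers[OF sm] have 1: "taylor_abel_poisson \<rho> r f \<in> L1_torus"
    and 2: "fourier_coeff (taylor_abel_poisson \<rho> r f) k = c k" for k
    by simp_all
  show "(\<lambda>x. f x - taylor_abel_poisson \<rho> r f x) \<in> L1_torus"
    by (rule L1_torus_diff[OF f 1])
  show "fourier_coeff (\<lambda>x. f x - taylor_abel_poisson \<rho> r f x) k
      = complex_of_real (1 - tap_multiplier (freq_norm k) r \<rho>) * fourier_coeff f k"
    by (simp add: fourier_coeff_diff[OF f 1] 2 c_def left_diff_distrib)
qed

lemma poisson_integral_deriv_coeffs:
  fixes f :: "real^'d \<Rightarrow> complex"
  assumes f: "f \<in> L1_torus" and \<rho>: "0 < \<rho>" "\<rho> < 1"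
  shows "poisson_integral_deriv r f \<rho> \<in> L1_torus"
    and "fourier_coeff (poisson_integral_deriv r f \<rho>) k
      = complex_of_real (fact r * real (freq_norm k choose r) * \<rho> ^ freq_norm k) * fourier_coeff f k"
proof -
  define m where "m = (\<lambda>\<nu>. fact r * real (\<nu> choose r) * \<rho> ^ \<nu>)"
  define c where "c = (\<lambda>k. complex_of_real (m (freq_norm k)) * fourier_coeff f k)"
  have sm: "summable (\<lambda>\<nu>. \<Sum>k | freq_norm k = \<nu>. norm (c k))"
    unfolding c_def
  proof (rule summable_multiplier_layers[where q = \<rho> and r = r and C = "fact r"])
    fix \<nu> :: nat
    show "\<bar>m \<nu>\<bar> \<le> fact r * real \<nu> ^ r * \<rho> ^ \<nu>"
      using \<rho> real_binomial_le_power[of \<nu> r] by (simp add: m_def abs_mult mult_left_mono mult_right_mono)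
  qed (use \<rho> in auto)
  have "poisson_integral_deriv r f \<rho> = (\<lambda>x. \<Sum>\<nu>. trig_poly {k. freq_norm k = \<nu>} c x)"
  proof
    fix x
    let ?h = "\<lambda>\<nu>. fourier_layer \<nu> f x"
    have sz: "summable (\<lambda>\<nu>. ?h \<nu> * z ^ \<nu>)" if z: "norm z < 1" for z :: complex
    proof (rule summable_norm_cancel)
      have "summable (\<lambda>\<nu>. \<Sum>k | freq_norm k = \<nu>. norm (complex_of_real (norm z ^ freq_norm k) * fourier_coeff f k))"
        by (rule summable_multiplier_layers[where q = "norm z" and r = 0 and C = 1]) (use z in auto)
      then have "summable (\<lambda>\<nu>. norm (complex_of_real (norm z ^ \<nu>) * ?h \<nu>))"
        by (rule summable_comparison_test') (subst trig_poly_layer_mult[symmetric], simp only: real_norm_def abs_norm_cancel norm_trig_poly_le)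
      then show "summable (\<lambda>\<nu>. norm (?h \<nu> * z ^ \<nu>))"
        by (simp add: norm_mult norm_power mult.commute)
    qed
    have "((\<lambda>g s. vector_derivative g (at s)) ^^ r) (\<lambda>s. poisson_integral f s x) \<rho>
        = (\<Sum>\<nu>. (diffs ^^ r) ?h \<nu> * complex_of_real \<rho> ^ \<nu>)"
      by (rule funpow_vector_derivative_power_series) (use sz \<rho> poisson_integral_eq[OF f] in auto)
    then have "poisson_integral_deriv r f \<rho> x
        = complex_of_real (\<rho> ^ r) * (\<Sum>\<nu>. (diffs ^^ r) ?h \<nu> * complex_of_real \<rho> ^ \<nu>)"
      by (simp only: poisson_integral_deriv_def)
    also have "\<dots> = (\<Sum>\<nu>. complex_of_real (\<rho> ^ r) * ((diffs ^^ r) ?h \<nu> * complex_of_real \<rho> ^ \<nu>))"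
    proof (rule suminf_mult[symmetric])
      have "norm z < 1 \<Longrightarrow> summable (\<lambda>\<nu>. (diffs ^^ n) ?h \<nu> * z ^ \<nu>)" for z :: complex and n
      proof (induction n arbitrary: z)
        case (Suc n)
        have "summable (\<lambda>\<nu>. diffs ((diffs ^^ n) ?h) \<nu> * z ^ \<nu>)"
          by (rule termdiff_converges[of z 1]) (use Suc in auto)
        then show ?case by simp
      qed (use sz in simp)
      then show "summable (\<lambda>\<nu>. (diffs ^^ r) ?h \<nu> * complex_of_real \<rho> ^ \<nu>)" using \<rho> by simp
    qed
    \<comment> \<open>The prefactor \<rho>^r restores the powers lost in differentiation. The
      missing layers below \<open>r\<close> have binomial weight 0, so the index shift can be
      undone.\<close>
    also have "\<dots> = (\<Sum>\<nu>. trig_poly {k. freq_norm k = \<nu> + r} c x)"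
      unfolding c_def trig_poly_layer_mult funpow_diffs
      by (rule suminf_cong) (simp add: m_def power_add mult_ac)
    also have "\<dots> = (\<Sum>\<nu>. trig_poly {k. freq_norm k = \<nu>} c x)"
    proof -
      have "trig_poly {k. freq_norm k = \<nu>} c x = 0" if "\<nu> < r" for \<nu>
        using that unfolding c_def trig_poly_layer_mult by (simp add: m_def binomial_eq_0)
      then show ?thesis
        by (simp add: suminf_split_initial_segment[OF summable_trig_poly_layers[OF sm], of _ r])
    qed
    finally show "poisson_integral_deriv r f \<rho> x = (\<Sum>\<nu>. trig_poly {k. freq_norm k = \<nu>} c x)" .
  qed
  with trig_series_layers[OF sm] show "poisson_integral_deriv r f \<rho> \<in> L1_torus"
    and "fourier_coeff (poisson_integral_deriv r f \<rho>) k
      = complex_of_real (fact r * real (freq_norm k choose r) * \<rho> ^ freq_norm k) * fourier_coeff f k"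
    by (simp_all add: c_def m_def)
qed

section \<open>Norm estimates as bounds on finite sums of coefficients\<close>

lemma Sp_iff:
  assumes "1 \<le> p"
  shows "f \<in> Sp p \<longleftrightarrow> f \<in> L1_torus \<and> (\<exists>M>0. lp_le p (\<lambda>k. norm (fourier_coeff f k)) M)"
proof safe
  assume "f \<in> Sp p"
  then have f: "f \<in> L1_torus" and s: "(\<lambda>k. norm (fourier_coeff f k) powr p) summable_on UNIV"
    by (auto simp: Sp_def)
  show "f \<in> L1_torus" by fact
  define S where "S = (\<Sum>\<^sub>\<infinity>k. norm (fourier_coeff f k) powr p)"
  have "S \<ge> 0" unfolding S_def by (rule infsum_nonneg) simp
  then have "((S + 1) powr (1 / p)) powr p = S + 1" using assms by (simp add: powr_powr)
  moreover have "(\<Sum>k\<in>K. norm (fourier_coeff f k) powr p) \<le> S" if "finite K" for K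
    unfolding S_def by (rule finite_sum_le_infsum[OF s that]) auto
  ultimately have "lp_le p (\<lambda>k. norm (fourier_coeff f k)) ((S + 1) powr (1 / p))"
    unfolding lp_le_def by (smt (verit))
  moreover have "(S + 1) powr (1 / p) > 0" using \<open>S \<ge> 0\<close> by simp
  ultimately show "\<exists>M>0. lp_le p (\<lambda>k. norm (fourier_coeff f k)) M" by blast
next
  fix M assume "f \<in> L1_torus" and "lp_le p (\<lambda>k. norm (fourier_coeff f k)) M"
  then show "f \<in> Sp p"
    by (auto simp: Sp_def lp_le_def
      intro!: nonneg_bounded_partial_sums_imp_summable_on[where C = "M powr p"] eventually_finite_subsets_at_top_weakI)
qed

lemma Sp_norm_le_iff:
  assumes "1 \<le> p" "f \<in> Sp p" "0 \<le> M"
  shows "Sp_norm p f \<le> M \<longleftrightarrow> lp_le p (\<lambda>k. norm (fourier_coeff f k)) M"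
proof -
  have s: "(\<lambda>k. norm (fourier_coeff f k) powr p) summable_on UNIV"
    using assms by (auto simp: Sp_def)
  define S where "S = (\<Sum>\<^sub>\<infinity>k. norm (fourier_coeff f k) powr p)"
  have "S \<ge> 0" unfolding S_def by (rule infsum_nonneg) simp
  have "Sp_norm p f \<le> M \<longleftrightarrow> S \<le> M powr p"
  proof
    assume "Sp_norm p f \<le> M"
    then have "(S powr (1 / p)) powr p \<le> M powr p"
      using assms by (intro powr_mono2) (auto simp: Sp_norm_def S_def)
    then show "S \<le> M powr p" using \<open>S \<ge> 0\<close> assms by (simp add: powr_powr)
  next
    assume "S \<le> M powr p"
    then have "S powr (1 / p) \<le> (M powr p) powr (1 / p)"
      using assms \<open>S \<ge> 0\<close> by (intro powr_mono2) auto
    then show "Sp_norm p f \<le> M" using assms by (simp add: powr_powr Sp_norm_def S_def)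
  qed
  also have "S \<le> M powr p \<longleftrightarrow> lp_le p (\<lambda>k. norm (fourier_coeff f k)) M"
  proof
    assume "S \<le> M powr p"
    moreover have "(\<Sum>k\<in>K. norm (fourier_coeff f k) powr p) \<le> S" if "finite K" for K
      unfolding S_def by (rule finite_sum_le_infsum[OF s that]) auto
    ultimately show "lp_le p (\<lambda>k. norm (fourier_coeff f k)) M"
      unfolding lp_le_def by (meson order_trans)
  next
    assume "lp_le p (\<lambda>k. norm (fourier_coeff f k)) M"
    then show "S \<le> M powr p"
      unfolding S_def lp_le_def by (intro infsum_le_finite_sums[OF s]) auto
  qed
  finally show ?thesis .
qed

text \<open>The membership conjunct is what gives \<open>Sp_norm\<close> its meaning, and a finite
  bound on partial sums returns it. Eventual positivity of \<open>\<phi>\<close> removes the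
  absolute value from the O-estimate and makes the bound positive.\<close>

lemma Sp_bigo_iff:
  assumes p: "1 \<le> p" and L1: "\<forall>\<^sub>F s in F. h s \<in> L1_torus" and pos: "\<forall>\<^sub>F s in F. 0 < \<phi> s"
  shows "Sp_bigo p F h \<phi> \<longleftrightarrow>
    (\<exists>C>0. \<forall>\<^sub>F s in F. lp_le p (\<lambda>k. norm (fourier_coeff (h s) k)) (C * \<phi> s))"
proof
  assume "Sp_bigo p F h \<phi>"
  then have ev: "\<forall>\<^sub>F s in F. h s \<in> Sp p" and big: "(\<lambda>s. Sp_norm p (h s)) \<in> O[F](\<phi>)"
    by (auto simp: Sp_bigo_def)
  from big obtain C where C: "C > 0" "\<forall>\<^sub>F s in F. norm (Sp_norm p (h s)) \<le> C * norm (\<phi> s)"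
    by (elim landau_o.bigE)
  from C(2) ev pos have "\<forall>\<^sub>F s in F. lp_le p (\<lambda>k. norm (fourier_coeff (h s) k)) (C * \<phi> s)"
  proof eventually_elim
    case (elim s)
    then show ?case
      using C(1) Sp_norm_le_iff[OF p, of "h s" "C * \<phi> s"] by auto
  qed
  with C(1) show "\<exists>C>0. \<forall>\<^sub>F s in F. lp_le p (\<lambda>k. norm (fourier_coeff (h s) k)) (C * \<phi> s)" by blast
next
  assume "\<exists>C>0. \<forall>\<^sub>F s in F. lp_le p (\<lambda>k. norm (fourier_coeff (h s) k)) (C * \<phi> s)"
  then obtain C where C: "C > 0" "\<forall>\<^sub>F s in F. lp_le p (\<lambda>k. norm (fourier_coeff (h s) k)) (C * \<phi> s)"
    by blast
  have ev: "\<forall>\<^sub>F s in F. h s \<in> Sp p"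
    using C(2) L1 pos by eventually_elim (use C(1) in \<open>auto simp: Sp_iff[OF p] intro: mult_pos_pos\<close>)
  have "\<forall>\<^sub>F s in F. norm (Sp_norm p (h s)) \<le> C * norm (\<phi> s)"
    using C(2) ev pos
  proof eventually_elim
    case (elim s)
    then show ?case
      using C(1) Sp_norm_le_iff[OF p, of "h s" "C * \<phi> s"] by (auto simp: Sp_norm_def)
  qed
  then have "(\<lambda>s. Sp_norm p (h s)) \<in> O[F](\<phi>)" by (rule landau_o.bigI[OF C(1)])
  with ev show "Sp_bigo p F h \<phi>" by (simp add: Sp_bigo_def)
qed

section \<open>Equivalence of the estimates\<close>

text \<open>The factor by which the derivative of order \<open>r - 1\<close> multiplies a
  coefficient, but cut off below \<open>r\<close> instead of \<open>r - 1\<close>: the layer of norm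
  \<open>r - 1\<close> is invisible to the first two statements and is treated separately.\<close>

definition deriv_weight :: "nat \<Rightarrow> nat \<Rightarrow> real" where
  "deriv_weight r \<nu> = (if r \<le> \<nu> then fact \<nu> / fact (\<nu> - (r - 1)) else 0)"

lemma deriv_weight_nonneg: "0 \<le> deriv_weight r \<nu>"
  by (simp add: deriv_weight_def)

lemma deriv_weight_eq:
  assumes "1 \<le> r"
  shows "fact r * real (\<nu> choose r) = (real \<nu> - real r + 1) * deriv_weight r \<nu>"
proof (cases "r \<le> \<nu>")
  case True
  then have "\<nu> - (r - 1) = Suc (\<nu> - r)" using assms by simp
  moreover have "real \<nu> - real r + 1 = real (Suc (\<nu> - r))"
    using True by (simp add: of_nat_diff)
  ultimately show ?thesis
    using True by (simp add: deriv_weight_def binomial_fact del: of_nat_Suc)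
next
  case False
  then show ?thesis by (simp add: deriv_weight_def binomial_eq_0)
qed

text \<open>\<nu> \<le> r (\<nu> - r + 1) amounts to (r - 1) (\<nu> - r) \<ge> 0. So weights of
  order \<open>r\<close> on f control weights of order 1 on its derivative of order
  \<open>r - 1\<close>.\<close>

lemma deriv_weight_le:
  assumes "1 \<le> r"
  shows "real \<nu> * deriv_weight r \<nu> \<le> real r * (fact r * real (\<nu> choose r))"
proof (cases "r \<le> \<nu>")
  case True
  have "0 \<le> (real r - 1) * (real \<nu> - real r)" using True assms by simp
  then have "real \<nu> \<le> real r * (real \<nu> - real r + 1)" by (simp add: algebra_simps)
  then show ?thesis
    unfolding deriv_weight_eq[OF assms] mult.assoc[symmetric]
    by (intro mult_right_mono deriv_weight_nonneg)
qed (simp add: deriv_weight_def)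

lemma binomial_le_deriv_weight:
  assumes "1 \<le> r"
  shows "real (\<nu> choose r) \<le> real \<nu> * deriv_weight r \<nu>"
proof -
  have "real (\<nu> choose r) \<le> fact r * real (\<nu> choose r)"
    using mult_right_mono[of 1 "fact r :: real" "real (\<nu> choose r)"] fact_ge_1[of r] by simp
  also have "\<dots> \<le> real \<nu> * deriv_weight r \<nu>"
    unfolding deriv_weight_eq[OF assms] using assms by (intro mult_right_mono deriv_weight_nonneg) auto
  finally show ?thesis .
qed

lemma is_derivative_coeff:
  assumes "is_derivative (r - 1) f g" "r \<le> freq_norm k"
  shows "norm (fourier_coeff g k) = deriv_weight r (freq_norm k) * norm (fourier_coeff f k)"
proof (cases "r - 1 = 0")
  case True
  then show ?thesis using assms by (simp add: is_derivative_def deriv_weight_def)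
next
  case False
  then have "fourier_coeff f k =
      complex_of_real (fact (freq_norm k - (r - 1)) / fact (freq_norm k)) * fourier_coeff g k"
    using assms by (auto simp: is_derivative_def)
  then show ?thesis using assms(2) by (simp add: deriv_weight_def norm_mult norm_divide)
qed

lemma is_derivative_L1: "is_derivative s f g \<Longrightarrow> f \<in> L1_torus \<Longrightarrow> g \<in> L1_torus"
  by (auto simp: is_derivative_def split: if_splits)

section \<open>Size of the factors by which a diagonal shift changes coefficients\<close>

lemma eventually_at_left_one: "\<forall>\<^sub>F \<rho>::real in at_left 1. 0 < \<rho> \<and> \<rho> < 1"
  using eventually_at_left_real[of 0 "1::real"] by (simp add: greaterThanLessThan_iff)

lemma norm_1_minus_exp_le: "norm (1 - exp (\<i> * complex_of_real \<theta>)) \<le> \<bar>\<theta>\<bar>"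
  using dist_exp_i_1[of \<theta>] abs_sin_x_le_abs_x[of "\<theta> / 2"] by (simp add: norm_minus_commute)

text \<open>The norm is 2 |sin(\<theta>/2)|, and sin x \<ge> x/2 on [0, 1] because cos \<ge> 1/2 up
  to pi/3 > 1.\<close>

lemma norm_1_minus_exp_ge:
  assumes "\<bar>\<theta>\<bar> \<le> 1"
  shows "\<bar>\<theta>\<bar> / 2 \<le> norm (1 - exp (\<i> * complex_of_real \<theta>))"
proof -
  have main: "x / 2 \<le> sin x" if "0 \<le> x" "x \<le> 1" for x :: real
  proof -
    have "\<exists>d. ((\<lambda>x. sin x - x / 2) has_real_derivative d) (at y) \<and> 0 \<le> d" if "0 \<le> y" "y \<le> x" for y
    proof (intro exI conjI)
      show "((\<lambda>x. sin x - x / 2) has_real_derivative (cos y - 1 / 2)) (at y)"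
        by (auto intro!: derivative_eq_intros)
      have "cos (pi / 3) \<le> cos y"
        using that \<open>x \<le> 1\<close> pi_gt3 by (intro cos_monotone_0_pi_le) auto
      then show "0 \<le> cos y - 1 / 2" by (simp add: cos_60)
    qed
    from DERIV_nonneg_imp_nondecreasing[OF \<open>0 \<le> x\<close> this] show ?thesis by simp
  qed
  have "\<bar>sin (\<theta> / 2)\<bar> = sin (\<bar>\<theta>\<bar> / 2)"
    using assms main[of "\<bar>\<theta>\<bar> / 2"] by (cases "\<theta> \<ge> 0") auto
  then show ?thesis
    using dist_exp_i_1[of \<theta>] main[of "\<bar>\<theta>\<bar> / 2"] assms by (simp add: norm_minus_commute)
qed

text \<open>With x = t n: (1 - t)^n \<le> e^(-x) \<le> 1 / (1 + x) \<le> 1 - min(1, x) / 2.\<close>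

lemma min_le_gap:
  assumes "0 \<le> t" "t \<le> (1::real)"
  shows "min 1 (t * real n) \<le> 2 * (1 - (1 - t) ^ n)"
proof -
  let ?x = "t * real n"
  have x: "0 \<le> ?x" using assms by simp
  have "(1 - t) ^ n \<le> exp (- t) ^ n"
    using exp_ge_add_one_self[of "- t"] assms by (intro power_mono) auto
  also have "\<dots> = exp (real n * (- t))" by (simp only: exp_of_nat_mult)
  also have "\<dots> = 1 / exp ?x" by (simp add: exp_minus inverse_eq_divide mult.commute)
  also have "\<dots> \<le> 1 / (1 + ?x)"
    using x exp_ge_add_one_self[of ?x] by (intro divide_left_mono) auto
  also have "\<dots> \<le> 1 - min 1 ?x / 2"
  proof -
    have "1 \<le> (1 - min 1 ?x / 2) * (1 + ?x)"
    proof (cases "?x \<le> 1")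
      case True
      have "0 \<le> ?x * (1 - ?x)" by (rule mult_nonneg_nonneg[OF x]) (use True in simp)
      then show ?thesis using True by (simp add: algebra_simps)
    next
      case False
      then show ?thesis by simp
    qed
    then show ?thesis using x by (simp add: divide_le_eq)
  qed
  finally show ?thesis by simp
qed

lemma freq_inner_diag: "freq_inner k (\<chi> j. h) = h * of_int (\<Sum>j\<in>UNIV. k $ j)"
  by (simp add: freq_inner_def sum_distrib_left mult.commute)

lemma abs_freq_sum_le: "\<bar>\<Sum>j\<in>UNIV. k $ j\<bar> \<le> int (freq_norm k)"
  by (simp add: freq_norm_def sum_abs)

text \<open>All coordinates have the same sign, so nothing cancels. Off \<open>freq_Y\<close> the
  sum can vanish at large norm, and a diagonal shift then does not see the frequency.\<close>

lemma abs_freq_sum_Y: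
  assumes "k \<in> freq_Y"
  shows "\<bar>\<Sum>j\<in>UNIV. k $ j\<bar> = int (freq_norm k)"
proof -
  have eq: "int (freq_norm k) = (\<Sum>j\<in>UNIV. \<bar>k $ j\<bar>)"
    by (simp add: freq_norm_def)
  consider "\<forall>j. 0 \<le> k $ j" | "\<forall>j. k $ j < 0" using assms by (auto simp: freq_Y_def)
  then show ?thesis
  proof cases
    case 1
    then show ?thesis by (simp add: eq sum_nonneg)
  next
    case 2
    then have "(\<Sum>j\<in>UNIV. \<bar>k $ j\<bar>) = (\<Sum>j\<in>UNIV. - (k $ j))" by (intro sum.cong) (auto simp: abs_of_neg)
    moreover have "(\<Sum>j\<in>UNIV. k $ j) \<le> 0" using 2 by (intro sum_nonpos) (auto intro: less_imp_le)
    ultimately show ?thesis by (simp add: eq sum_negf)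
  qed
qed

lemma shift_diff_coeffs:
  assumes "g \<in> L1_torus"
  shows "(\<lambda>x. g x - g (x + (\<chi> j. h))) \<in> L1_torus"
    and "norm (fourier_coeff (\<lambda>x. g x - g (x + (\<chi> j. h))) k)
      = norm (1 - exp (\<i> * complex_of_real (h * of_int (\<Sum>j\<in>UNIV. k $ j)))) * norm (fourier_coeff g k)"
proof -
  have s: "(\<lambda>x. g (x + (\<chi> j. h))) = (\<lambda>x. g ((\<chi> j. h) + x))" by (simp add: add.commute)
  have L: "(\<lambda>x. g (x + (\<chi> j. h))) \<in> L1_torus" unfolding s by (rule L1_torus_translate[OF assms])
  then show "(\<lambda>x. g x - g (x + (\<chi> j. h))) \<in> L1_torus" by (rule L1_torus_diff[OF assms])
  have "fourier_coeff (\<lambda>x. g x - g (x + (\<chi> j. h))) k = (1 - trig k (\<chi> j. h)) * fourier_coeff g k"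
    unfolding fourier_coeff_diff[OF assms L] unfolding s fourier_coeff_translate[OF assms]
    by (simp add: algebra_simps)
  then show "norm (fourier_coeff (\<lambda>x. g x - g (x + (\<chi> j. h))) k)
      = norm (1 - exp (\<i> * complex_of_real (h * of_int (\<Sum>j\<in>UNIV. k $ j)))) * norm (fourier_coeff g k)"
    by (simp add: norm_mult trig_def freq_inner_diag)
qed

section \<open>Passage between the three statements for a fixed modulus\<close>

context dini_modulus
begin

definition gap_bound :: "real \<Rightarrow> nat \<Rightarrow> (real^'d \<Rightarrow> complex) \<Rightarrow> bool" where
  "gap_bound p r f \<longleftrightarrow> (\<exists>C>0. \<forall>\<^sub>F \<rho> in at_left 1.
     lp_le p (\<lambda>k. (1 - tap_multiplier (freq_norm k) r \<rho>) * norm (fourier_coeff f k))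
       (C * ((1 - \<rho>) ^ (r - 1) * \<omega> (1 - \<rho>))))"

text \<open>The factor \<open>fact r\<close> of the r-th derivative is absorbed in the
  constant.\<close>

definition deriv_bound :: "real \<Rightarrow> nat \<Rightarrow> (real^'d \<Rightarrow> complex) \<Rightarrow> bool" where
  "deriv_bound p r f \<longleftrightarrow> (\<exists>C>0. \<forall>\<^sub>F \<rho> in at_left 1.
     lp_le p (\<lambda>k. real (freq_norm k choose r) * \<rho> ^ freq_norm k * norm (fourier_coeff f k))
       (C * (\<omega> (1 - \<rho>) / (1 - \<rho>))))"

lemma gap_bound_iff_deriv_bound:
  assumes "1 \<le> r" "1 \<le> p"
  shows "gap_bound p r f \<longleftrightarrow> deriv_bound p r f"
proof
  assume "gap_bound p r f"
  then obtain C where C: "C > 0" "\<forall>\<^sub>F \<rho> in at_left 1.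
     lp_le p (\<lambda>k. (1 - tap_multiplier (freq_norm k) r \<rho>) * norm (fourier_coeff f k))
       (C * ((1 - \<rho>) ^ (r - 1) * \<omega> (1 - \<rho>)))"
    by (auto simp: gap_bound_def)
  have "\<forall>\<^sub>F \<rho> in at_left 1.
     lp_le p (\<lambda>k. real (freq_norm k choose r) * \<rho> ^ freq_norm k * norm (fourier_coeff f k))
       (C * (\<omega> (1 - \<rho>) / (1 - \<rho>)))"
    using C(2) eventually_at_left_one
  proof eventually_elim
    case (elim \<rho>)
    then show ?case
      by (intro gap_imp_deriv[OF _ _ assms C(1) _ elim(1)]) auto
  qed
  with C(1) show "deriv_bound p r f" by (auto simp: deriv_bound_def)
next
  assume "deriv_bound p r f"
  then obtain C where C: "C > 0" "\<forall>\<^sub>F \<rho> in at_left 1.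
     lp_le p (\<lambda>k. real (freq_norm k choose r) * \<rho> ^ freq_norm k * norm (fourier_coeff f k))
       (C * (\<omega> (1 - \<rho>) / (1 - \<rho>)))"
    by (auto simp: deriv_bound_def)
  from deriv_imp_gap[OF assms C(1) norm_ge_zero C(2)] show "gap_bound p r f"
    by (simp only: gap_bound_def)
qed

lemma eventually_pos_at_left_one: "\<forall>\<^sub>F \<rho> in at_left 1. 0 < \<omega> (1 - \<rho>)"
  using eventually_at_left_one by eventually_elim (auto intro: pos)

lemma Sp_bigo_taylor_abel:
  assumes f: "f \<in> L1_torus" and "1 \<le> r" "1 \<le> p"
  shows "Sp_bigo p (at_left 1) (\<lambda>\<rho> x. f x - taylor_abel_poisson \<rho> r f x)
      (\<lambda>\<rho>. (1 - \<rho>) ^ (r - 1) * \<omega> (1 - \<rho>)) \<longleftrightarrow> gap_bound p r f"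
proof -
  have L: "\<forall>\<^sub>F \<rho> in at_left 1. (\<lambda>x. f x - taylor_abel_poisson \<rho> r f x) \<in> L1_torus"
    using eventually_at_left_one by eventually_elim (auto intro: taylor_abel_poisson_coeffs(1)[OF f])
  have P: "\<forall>\<^sub>F \<rho> in at_left 1. 0 < (1 - \<rho>) ^ (r - 1) * \<omega> (1 - \<rho>)"
    using eventually_at_left_one eventually_pos_at_left_one by eventually_elim auto
  have "\<forall>\<^sub>F \<rho> in at_left 1. \<forall>k. norm (fourier_coeff (\<lambda>x. f x - taylor_abel_poisson \<rho> r f x) k)
      = (1 - tap_multiplier (freq_norm k) r \<rho>) * norm (fourier_coeff f k)"
    using eventually_at_left_one
  proof eventually_elim
    case (elim \<rho>)
    then have "0 \<le> 1 - tap_multiplier \<nu> r \<rho>" for \<nu>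
      using tap_multiplier_le_1[OF \<open>1 \<le> r\<close>, of \<rho> \<nu>] by simp
    with elim show ?case
      by (simp only: taylor_abel_poisson_coeffs(2)[OF f] norm_mult norm_of_real abs_of_nonneg simp_thms)
  qed
  then have "\<forall>\<^sub>F \<rho> in at_left 1. lp_le p (\<lambda>k. norm (fourier_coeff (\<lambda>x. f x - taylor_abel_poisson \<rho> r f x) k)) (M \<rho>)
      = lp_le p (\<lambda>k. (1 - tap_multiplier (freq_norm k) r \<rho>) * norm (fourier_coeff f k)) (M \<rho>)" for M
    by eventually_elim (simp only:)
  note eventually_subst[OF this]
  then show ?thesis
    unfolding Sp_bigo_iff[OF \<open>1 \<le> p\<close> L P] gap_bound_def by simp
qed

lemma Sp_bigo_poisson_deriv:
  assumes f: "f \<in> L1_torus" and "1 \<le> r" "1 \<le> p"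
  shows "Sp_bigo p (at_left 1) (\<lambda>\<rho>. poisson_integral_deriv r f \<rho>)
      (\<lambda>\<rho>. \<omega> (1 - \<rho>) / (1 - \<rho>)) \<longleftrightarrow> deriv_bound p r f"
proof -
  have L: "\<forall>\<^sub>F \<rho> in at_left 1. poisson_integral_deriv r f \<rho> \<in> L1_torus"
    using eventually_at_left_one by eventually_elim (auto intro: poisson_integral_deriv_coeffs(1)[OF f])
  have P: "\<forall>\<^sub>F \<rho> in at_left 1. 0 < \<omega> (1 - \<rho>) / (1 - \<rho>)"
    using eventually_at_left_one eventually_pos_at_left_one by eventually_elim auto
  let ?d = "\<lambda>\<rho> k. real (freq_norm k choose r) * \<rho> ^ freq_norm k * norm (fourier_coeff f k)"
  have coeff: "norm (fourier_coeff (poisson_integral_deriv r f \<rho>) k) = fact r * ?d \<rho> k"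
    if "0 < \<rho>" "\<rho> < 1" for \<rho> k
    using that by (simp add: poisson_integral_deriv_coeffs(2)[OF f] norm_mult norm_power)
  have "(\<exists>C>0. \<forall>\<^sub>F \<rho> in at_left 1.
      lp_le p (\<lambda>k. norm (fourier_coeff (poisson_integral_deriv r f \<rho>) k)) (C * (\<omega> (1 - \<rho>) / (1 - \<rho>))))
    \<longleftrightarrow> deriv_bound p r f"
  proof
    assume "\<exists>C>0. \<forall>\<^sub>F \<rho> in at_left 1.
      lp_le p (\<lambda>k. norm (fourier_coeff (poisson_integral_deriv r f \<rho>) k)) (C * (\<omega> (1 - \<rho>) / (1 - \<rho>)))"
    then obtain C where C: "C > 0" "\<forall>\<^sub>F \<rho> in at_left 1.
      lp_le p (\<lambda>k. norm (fourier_coeff (poisson_integral_deriv r f \<rho>) k)) (C * (\<omega> (1 - \<rho>) / (1 - \<rho>)))" by blast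
    have "\<forall>\<^sub>F \<rho> in at_left 1. lp_le p (?d \<rho>) (C * (\<omega> (1 - \<rho>) / (1 - \<rho>)))"
      using C(2) eventually_at_left_one P
    proof eventually_elim
      case (elim \<rho>)
      have "?d \<rho> k \<le> norm (fourier_coeff (poisson_integral_deriv r f \<rho>) k)" for k
        using mult_right_mono[of 1 "fact r" "?d \<rho> k"] elim fact_ge_1[of r] by (simp add: coeff)
      moreover have "0 \<le> C * (\<omega> (1 - \<rho>) / (1 - \<rho>))"
        using C(1) elim(3) by (intro mult_nonneg_nonneg less_imp_le)
      ultimately show ?case
        using elim(2) assms by (intro lp_le_mono[OF elim(1)]) auto
    qed
    with C(1) show "deriv_bound p r f" by (auto simp: deriv_bound_def)
  next
    assume "deriv_bound p r f"
    then obtain C where C: "C > 0" "\<forall>\<^sub>F \<rho> in at_left 1. lp_le p (?d \<rho>) (C * (\<omega> (1 - \<rho>) / (1 - \<rho>)))"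
      by (auto simp: deriv_bound_def)
    have "\<forall>\<^sub>F \<rho> in at_left 1. lp_le p (\<lambda>k. norm (fourier_coeff (poisson_integral_deriv r f \<rho>) k))
        (fact r * C * (\<omega> (1 - \<rho>) / (1 - \<rho>)))"
      using C(2) eventually_at_left_one P
    proof eventually_elim
      case (elim \<rho>)
      have "0 \<le> C * (\<omega> (1 - \<rho>) / (1 - \<rho>))"
        using C(1) elim(3) by (intro mult_nonneg_nonneg less_imp_le)
      then have "lp_le p (\<lambda>k. fact r * ?d \<rho> k) (fact r * (C * (\<omega> (1 - \<rho>) / (1 - \<rho>))))"
        using elim(2) by (intro lp_le_scale elim(1)) auto
      then show ?case using elim(2) by (simp only: coeff mult.assoc)
    qed
    moreover have "fact r * C > 0" using C(1) by simp
    ultimately show "\<exists>C>0. \<forall>\<^sub>F \<rho> in at_left 1.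
      lp_le p (\<lambda>k. norm (fourier_coeff (poisson_integral_deriv r f \<rho>) k)) (C * (\<omega> (1 - \<rho>) / (1 - \<rho>)))"
      by blast
  qed
  then show ?thesis unfolding Sp_bigo_iff[OF \<open>1 \<le> p\<close> L P] .
qed

text \<open>The case \<open>r = 1\<close> of \<open>deriv_imp_gap\<close>, applied to the coefficients of the derivative
  of order \<open>r - 1\<close>.\<close>

lemma deriv_bound_high:
  assumes "1 \<le> r" "1 \<le> p" and D: "deriv_bound p r f"
  shows "\<exists>C>0. \<forall>\<^sub>F \<rho> in at_left 1.
    lp_le p (\<lambda>k. (1 - \<rho> ^ freq_norm k) * (deriv_weight r (freq_norm k) * norm (fourier_coeff f k))) (C * \<omega> (1 - \<rho>))"
proof -
  let ?b = "\<lambda>k. deriv_weight r (freq_norm k) * norm (fourier_coeff f k)"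
  obtain C where C: "C > 0" "\<forall>\<^sub>F \<rho> in at_left 1.
     lp_le p (\<lambda>k. real (freq_norm k choose r) * \<rho> ^ freq_norm k * norm (fourier_coeff f k))
       (C * (\<omega> (1 - \<rho>) / (1 - \<rho>)))"
    using D by (auto simp: deriv_bound_def)
  have b0: "0 \<le> ?b k" for k by (simp add: deriv_weight_nonneg)
  have "\<forall>\<^sub>F \<rho> in at_left 1. lp_le p (\<lambda>k. real (freq_norm k choose 1) * \<rho> ^ freq_norm k * ?b k)
      (real r * fact r * C * (\<omega> (1 - \<rho>) / (1 - \<rho>)))"
    using C(2) eventually_at_left_one eventually_pos_at_left_one
  proof eventually_elim
    case (elim \<rho>)
    have "lp_le p (\<lambda>k. real r * fact r * (real (freq_norm k choose r) * \<rho> ^ freq_norm k * norm (fourier_coeff f k)))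
        (real r * fact r * (C * (\<omega> (1 - \<rho>) / (1 - \<rho>))))"
      using elim C(1) by (intro lp_le_scale) auto
    then show ?case
    proof (rule lp_le_mono)
      fix k
      show "0 \<le> real (freq_norm k choose 1) * \<rho> ^ freq_norm k * ?b k" using elim b0 by simp
      have "real (freq_norm k) * deriv_weight r (freq_norm k) * (\<rho> ^ freq_norm k * norm (fourier_coeff f k))
         \<le> real r * (fact r * real (freq_norm k choose r)) * (\<rho> ^ freq_norm k * norm (fourier_coeff f k))"
        using elim deriv_weight_le[OF \<open>1 \<le> r\<close>] by (intro mult_right_mono) auto
      then show "real (freq_norm k choose 1) * \<rho> ^ freq_norm k * ?b k
         \<le> real r * fact r * (real (freq_norm k choose r) * \<rho> ^ freq_norm k * norm (fourier_coeff f k))"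
        by (simp add: mult_ac)
    qed (use elim C(1) \<open>1 \<le> p\<close> in \<open>auto simp: mult.assoc\<close>)
  qed
  moreover have "0 < real r * fact r * C" using C(1) \<open>1 \<le> r\<close> by simp
  ultimately have "\<exists>B'>0. \<forall>\<^sub>F \<rho> in at_left 1. lp_le p (\<lambda>k. (1 - tap_multiplier (freq_norm k) 1 \<rho>) * ?b k)
               (B' * ((1 - \<rho>) ^ (1 - 1) * \<omega> (1 - \<rho>)))"
    using b0 \<open>1 \<le> p\<close> by (intro deriv_imp_gap) auto
  then show ?thesis by (simp add: tap_multiplier_def)
qed

text \<open>A single \<rho> suffices: at norms \<nu> \<ge> r \<ge> 1 the factor 1 - \<rho>^\<nu> is
  at least 1 - \<rho>, and below \<open>r\<close> the weight is 0.\<close>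

lemma deriv_bound_high_lp:
  assumes "1 \<le> r" "1 \<le> p" and D: "deriv_bound p r f"
  shows "\<exists>M>0. lp_le p (\<lambda>k. deriv_weight r (freq_norm k) * norm (fourier_coeff f k)) M"
proof -
  let ?b = "\<lambda>k. deriv_weight r (freq_norm k) * norm (fourier_coeff f k)"
  obtain C where C: "C > 0" "\<forall>\<^sub>F \<rho> in at_left 1. lp_le p (\<lambda>k. (1 - \<rho> ^ freq_norm k) * ?b k) (C * \<omega> (1 - \<rho>))"
    using deriv_bound_high[OF assms] by blast
  have "\<forall>\<^sub>F \<rho> in at_left 1. (0 < \<rho> \<and> \<rho> < 1) \<and> 0 < \<omega> (1 - \<rho>) \<and> lp_le p (\<lambda>k. (1 - \<rho> ^ freq_norm k) * ?b k) (C * \<omega> (1 - \<rho>))"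
    using C(2) eventually_at_left_one eventually_pos_at_left_one by eventually_elim auto
  then obtain \<rho> where \<rho>: "0 < \<rho>" "\<rho> < 1" "0 < \<omega> (1 - \<rho>)"
    and le: "lp_le p (\<lambda>k. (1 - \<rho> ^ freq_norm k) * ?b k) (C * \<omega> (1 - \<rho>))"
    using eventually_happens[of _ "at_left (1::real)"] by (auto simp: trivial_limit_at_left_real)
  have "lp_le p (\<lambda>k. 1 / (1 - \<rho>) * ((1 - \<rho> ^ freq_norm k) * ?b k)) (1 / (1 - \<rho>) * (C * \<omega> (1 - \<rho>)))"
    using \<rho> C(1) by (intro lp_le_scale[OF le]) (auto intro!: mult_nonneg_nonneg power_le_one deriv_weight_nonneg)
  then have "lp_le p ?b (1 / (1 - \<rho>) * (C * \<omega> (1 - \<rho>)))"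
  proof (rule lp_le_mono)
    fix k :: "int^'a"
    show "?b k \<le> 1 / (1 - \<rho>) * ((1 - \<rho> ^ freq_norm k) * ?b k)"
    proof (cases "r \<le> freq_norm k")
      case True
      then have "\<rho> ^ freq_norm k \<le> \<rho> ^ 1" using \<rho> \<open>1 \<le> r\<close> by (intro power_decreasing) auto
      then have "(1 - \<rho>) * ?b k \<le> (1 - \<rho> ^ freq_norm k) * ?b k"
        by (intro mult_right_mono) (auto simp: deriv_weight_nonneg)
      then show ?thesis using \<rho> by (simp add: field_simps)
    qed (simp add: deriv_weight_def)
  qed (use \<rho> C(1) assms in \<open>auto simp: deriv_weight_nonneg\<close>)
  moreover have "0 < 1 / (1 - \<rho>) * (C * \<omega> (1 - \<rho>))" using \<rho> C(1) by simp
  ultimately show ?thesis by blast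
qed

text \<open>For \<open>p \<le> 2\<close> a p-summable sequence is square summable, so Riesz-Fischer
  realizes the coefficients prescribed for the derivative.\<close>

lemma deriv_bound_imp_derivative:
  assumes "1 \<le> r" "1 \<le> p" "p \<le> 2" and D: "deriv_bound p r f"
  shows "\<exists>g. is_derivative (r - 1) f g"
proof (cases "r = 1")
  case True
  then show ?thesis by (auto simp: is_derivative_def)
next
  case False
  \<comment> \<open>Prescribed from norm \<open>r - 1\<close> on, as \<open>is_derivative\<close>
    demands, and chosen as 0 below. So \<open>?l\<close> carries just the layer of norm
    \<open>r - 1\<close>, which \<open>?b\<close> omits.\<close>
  define c where "c k = (if r - 1 \<le> freq_norm k
    then complex_of_real (fact (freq_norm k) / fact (freq_norm k - (r - 1))) * fourier_coeff f k else 0)" for k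
  let ?b = "\<lambda>k. deriv_weight r (freq_norm k) * norm (fourier_coeff f k)"
  let ?l = "\<lambda>k. if freq_norm k < r then norm (c k) else 0"
  have b0: "0 \<le> ?b k" for k by (simp add: deriv_weight_nonneg)
  obtain M where M: "M > 0" "lp_le p ?b M" using deriv_bound_high_lp[OF assms(1,2) D] by blast
  have "lp_le 2 ?b M"
    unfolding lp_le_def
  proof safe
    fix K :: "(int^'a) set" assume K: "finite K"
    \<comment> \<open>Each entry is at most \<open>M\<close>, so the surplus exponent 2 - p is paid
      for by a power of \<open>M\<close>.\<close>
    have "(\<Sum>k\<in>K. ?b k powr 2) \<le> (\<Sum>k\<in>K. ?b k powr p * M powr (2 - p))"
    proof (intro sum_mono)
      fix k
      have "?b k \<le> M" using lp_le_coord[OF M(2), of k] M(1) assms b0 by simp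
      have "?b k powr 2 = ?b k powr p * ?b k powr (2 - p)" by (simp flip: powr_add)
      also have "\<dots> \<le> ?b k powr p * M powr (2 - p)"
        using \<open>?b k \<le> M\<close> b0 assms by (intro mult_left_mono powr_mono2) auto
      finally show "?b k powr 2 \<le> ?b k powr p * M powr (2 - p)" .
    qed
    also have "\<dots> = (\<Sum>k\<in>K. ?b k powr p) * M powr (2 - p)" by (simp add: sum_distrib_right)
    also have "\<dots> \<le> M powr p * M powr (2 - p)"
      using M(2) K by (intro mult_right_mono) (auto simp: lp_le_def)
    also have "\<dots> = M powr 2" by (simp flip: powr_add)
    finally show "(\<Sum>k\<in>K. ?b k powr 2) \<le> M powr 2" .
  qed
  moreover obtain L where L: "L > 0" "lp_le 2 ?l L"
    using lp_le_finite_support[OF finite_freq_norm_le[of r], of ?l 2] by (auto simp: not_le)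
  ultimately have sum: "lp_le 2 (\<lambda>k. ?b k + ?l k) (M + L)"
    using M(1) b0 by (intro lp_le_add) auto
  have "norm (c k) = ?b k + ?l k" for k
    by (auto simp: c_def deriv_weight_def norm_mult norm_divide)
  with sum have c: "lp_le 2 (\<lambda>k. norm (c k)) (M + L)" by simp
  have "\<exists>g\<in>L1_torus. \<forall>k. fourier_coeff g k = c k"
  proof (rule riesz_fischer)
    show "(\<Sum>k\<in>K. (norm (c k))\<^sup>2) \<le> (M + L) powr 2" if "finite K" for K
      using c that by (simp add: lp_le_def)
  qed
  then obtain g where "g \<in> L1_torus" "\<And>k. fourier_coeff g k = c k" by blast
  then have "is_derivative (r - 1) f g"
    using False \<open>1 \<le> r\<close> by (simp add: is_derivative_def c_def)
  then show ?thesis by blast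
qed

text \<open>The term of \<open>deriv_bound\<close> at one nonzero coefficient stays above a positive
  constant as \<rho> tends to 1, while the bound is a multiple of \<omega>(t) / t with t = 1 -
  \<rho>.\<close>

lemma deriv_bound_imp_linear:
  assumes "1 \<le> r" "1 \<le> p" and D: "deriv_bound p r f"
    and alt: "(\<exists>k. r \<le> freq_norm k \<and> fourier_coeff f k \<noteq> 0) \<or> (\<lambda>t. t) \<in> O[at_right 0](\<omega>)"
  shows "\<exists>C>0. \<forall>\<^sub>F t in at_right 0. t \<le> C * \<omega> t"
  using alt
proof
  assume "\<exists>k. r \<le> freq_norm k \<and> fourier_coeff f k \<noteq> 0"
  then obtain k where k: "r \<le> freq_norm k" "fourier_coeff f k \<noteq> 0" by blast
  obtain C b where C: "C > 0" "b < 1" and H: "\<And>\<rho>. b < \<rho> \<Longrightarrow> \<rho> < 1 \<Longrightarrow>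
     lp_le p (\<lambda>k. real (freq_norm k choose r) * \<rho> ^ freq_norm k * norm (fourier_coeff f k))
       (C * (\<omega> (1 - \<rho>) / (1 - \<rho>)))"
    using D unfolding deriv_bound_def eventually_at_left_field by blast
  \<comment> \<open>A lower bound for that term when 1 - t > 1/2; the binomial coefficient is at
    least 1.\<close>
  define A where "A = (1 / 2) ^ freq_norm k * norm (fourier_coeff f k)"
  have A: "A > 0" using k by (simp add: A_def)
  have main: "t \<le> C / A * \<omega> t" if t: "0 < t" "t < min (1 - b) (1 / 2)" for t
  proof -
    have w: "0 < \<omega> t" using t by (intro pos) auto
    have "A \<le> real (freq_norm k choose r) * (1 - t) ^ freq_norm k * norm (fourier_coeff f k)"
    proof -
      have "1 * (1 / 2) ^ freq_norm k \<le> real (freq_norm k choose r) * (1 - t) ^ freq_norm k"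
      proof (intro mult_mono power_mono)
        have "0 < freq_norm k choose r" using k(1) by (rule zero_less_binomial)
        then show "1 \<le> real (freq_norm k choose r)" by linarith
      qed (use t in auto)
      then show ?thesis unfolding A_def by (intro mult_right_mono) auto
    qed
    also have "\<dots> \<le> C * (\<omega> (1 - (1 - t)) / (1 - (1 - t)))"
      using t C(1) w \<open>1 \<le> p\<close> by (intro lp_le_coord[OF H]) auto
    finally have "A \<le> C * (\<omega> t / t)" by simp
    then show ?thesis using A t by (simp add: field_simps)
  qed
  show ?thesis
  proof (intro exI conjI)
    show "C / A > 0" using A C by simp
    show "\<forall>\<^sub>F t in at_right 0. t \<le> C / A * \<omega> t"
      unfolding eventually_at_right_field using main C(2) by (intro exI[of _ "min (1 - b) (1 / 2)"]) auto
  qed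
next
  assume "(\<lambda>t. t) \<in> O[at_right 0](\<omega>)"
  then obtain C where C: "C > 0" "\<forall>\<^sub>F t in at_right 0. norm t \<le> C * norm (\<omega> t)"
    by (elim landau_o.bigE)
  have "\<forall>\<^sub>F t::real in at_right 0. 0 < t \<and> t < 1"
    using eventually_at_right_real[of 0 "1::real"] by (simp add: greaterThanLessThan_iff)
  with C(2) have "\<forall>\<^sub>F t in at_right 0. t \<le> C * \<omega> t"
  proof eventually_elim
    case (elim t)
    then show ?case using pos[of t] by simp
  qed
  with C(1) show ?thesis by blast
qed

text \<open>The coefficients of \<open>g\<close> are split at norm \<open>r\<close>. The high part
  \<open>?b\<close> obeys the gap estimate of order 1. The low part \<open>l\<close> has finite
  support but is otherwise uncontrolled, and a shift changes it by O(|h|), which the linear bound on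
  the modulus absorbs; so any choice of the derivative \<open>g\<close> will do.\<close>

lemma deriv_bound_imp_SpH:
  assumes f: "f \<in> L1_torus" and r: "1 \<le> r" and p: "1 \<le> p" and D: "deriv_bound p r f"
    and alt: "r = 1 \<or> (\<exists>k. r \<le> freq_norm k \<and> fourier_coeff f k \<noteq> 0) \<or> (\<lambda>t. t) \<in> O[at_right 0](\<omega>)"
    and g: "is_derivative (r - 1) f g"
  shows "g \<in> SpH p \<omega>"
proof -
  have gL: "g \<in> L1_torus" by (rule is_derivative_L1[OF g f])
  let ?b = "\<lambda>k. deriv_weight r (freq_norm k) * norm (fourier_coeff f k)"
  define l where "l = (\<lambda>k. if freq_norm k < r then norm (fourier_coeff g k) else 0)"
  let ?l' = "\<lambda>k. real (freq_norm k) * l k"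
  have l0: "0 \<le> l k" for k by (simp add: l_def)
  have b0: "0 \<le> ?b k" for k by (simp add: deriv_weight_nonneg)
  have split: "norm (fourier_coeff g k) = ?b k + l k" for k
    using is_derivative_coeff[OF g, of k] by (simp add: deriv_weight_def l_def)
  obtain M where M: "M > 0" "lp_le p ?b M" using deriv_bound_high_lp[OF r p D] by blast
  obtain L where L: "L > 0" "lp_le p l L"
    using lp_le_finite_support[OF finite_freq_norm_le[of r] _ p, of l] by (auto simp: not_le l_def)
  have "lp_le p (\<lambda>k. ?b k + l k) (M + L)"
    using M L b0 l0 p by (intro lp_le_add) auto
  then have gS: "g \<in> Sp p"
    using gL M(1) L(1) unfolding Sp_iff[OF p] split by (auto intro!: exI[of _ "M + L"])
  obtain C \<beta> where C: "C > 0" "\<beta> < 1" and H: "\<And>\<rho>. \<beta> < \<rho> \<Longrightarrow> \<rho> < 1 \<Longrightarrow>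
      lp_le p (\<lambda>k. (1 - \<rho> ^ freq_norm k) * ?b k) (C * \<omega> (1 - \<rho>))"
    using deriv_bound_high[OF r p D] unfolding eventually_at_left_field by blast
  have "\<exists>B>0. \<forall>\<^sub>F t in at_right 0. lp_le p (\<lambda>k. t * ?l' k) (B * \<omega> t)"
  proof (cases "r = 1")
    case True
    \<comment> \<open>For \<open>r = 1\<close> the low part is supported at \<open>k = 0\<close>,
      where the norm is 0.\<close>
    then have "t * ?l' k = 0" for t k by (simp add: l_def)
    then show ?thesis by (intro exI[of _ 1]) (simp only: lp_le_def, simp)
  next
    case False
    then obtain A where A: "A > 0" "\<forall>\<^sub>F t in at_right 0. t \<le> A * \<omega> t"
      using deriv_bound_imp_linear[OF r p D] alt by blast
    obtain L' where L': "L' > 0" "lp_le p ?l' L'"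
      using lp_le_finite_support[OF finite_freq_norm_le[of r] _ p, of ?l'] by (auto simp: not_le l_def)
    have "\<forall>\<^sub>F t in at_right 0. lp_le p (\<lambda>k. t * ?l' k) (L' * A * \<omega> t)"
      using A(2) eventually_at_right_less[of 0]
    proof eventually_elim
      case (elim t)
      have "lp_le p (\<lambda>k. t * ?l' k) (t * L')"
        using elim L' l0 by (intro lp_le_scale) auto
      then show ?case
        using elim L' A p l0 mult_right_mono[OF elim(1), of L'] by (elim lp_le_mono) (auto simp: mult_ac)
    qed
    moreover have "L' * A > 0" using L' A by simp
    ultimately show ?thesis by blast
  qed
  then obtain B \<eta> where B: "B > 0" "\<eta> > 0" and low: "\<And>t. 0 < t \<Longrightarrow> t < \<eta> \<Longrightarrow> lp_le p (\<lambda>k. t * ?l' k) (B * \<omega> t)"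
    unfolding eventually_at_right_field by blast
  have main: "lp_le p (\<lambda>k. norm (fourier_coeff (\<lambda>x. g x - g (x + (\<chi> j. h))) k)) ((4 * C + B) * \<omega> \<bar>h\<bar>)"
    if h: "h \<noteq> 0" "\<bar>h\<bar> < min (min 1 \<eta>) (1 - \<beta>)" for h
  proof -
    define t where "t = \<bar>h\<bar>"
    have t: "0 < t" "t < 1" "t < \<eta>" "\<beta> < 1 - t" using h by (auto simp: t_def)
    have w: "0 < \<omega> t" using t by (intro pos) auto
    have "lp_le p (\<lambda>k. 4 * ((1 - (1 - t) ^ freq_norm k) * ?b k)) (4 * (C * \<omega> (1 - (1 - t))))"
      using t w C by (intro lp_le_scale H) (auto intro!: mult_nonneg_nonneg power_le_one deriv_weight_nonneg)
    then have "lp_le p (\<lambda>k. 4 * ((1 - (1 - t) ^ freq_norm k) * ?b k) + t * ?l' k) (4 * (C * \<omega> t) + B * \<omega> t)"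
      using low[OF t(1,3)] t w C B p l0
      by (intro lp_le_add) (auto intro!: mult_nonneg_nonneg power_le_one deriv_weight_nonneg)
    then have "lp_le p (\<lambda>k. norm (fourier_coeff (\<lambda>x. g x - g (x + (\<chi> j. h))) k)) (4 * (C * \<omega> t) + B * \<omega> t)"
    proof (rule lp_le_mono)
      fix k :: "int^'a"
      let ?e = "norm (1 - exp (\<i> * complex_of_real (h * of_int (\<Sum>j\<in>UNIV. k $ j))))"
      have "?e \<le> \<bar>h * of_int (\<Sum>j\<in>UNIV. k $ j)\<bar>" by (rule norm_1_minus_exp_le)
      also have "\<dots> \<le> t * real (freq_norm k)"
        unfolding abs_mult t_def using abs_freq_sum_le[of k] by (intro mult_left_mono) linarith+
      finally have e1: "?e \<le> t * real (freq_norm k)" .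
      have "?e \<le> norm (1::complex) + norm (exp (\<i> * complex_of_real (h * of_int (\<Sum>j\<in>UNIV. k $ j))))"
        by (rule norm_triangle_ineq4)
      then have "?e \<le> 2" by (simp only: norm_exp_i_times norm_one)
      moreover have "0 \<le> t * real (freq_norm k)" using t by simp
      ultimately have "?e \<le> 2 * min 1 (t * real (freq_norm k))"
        using e1 unfolding min_def by (simp only: split: if_split) linarith
      also have "\<dots> \<le> 4 * (1 - (1 - t) ^ freq_norm k)" using min_le_gap[of t "freq_norm k"] t by linarith
      finally have e2: "?e \<le> 4 * (1 - (1 - t) ^ freq_norm k)" .
      have "?e * (?b k + l k) \<le> 4 * (1 - (1 - t) ^ freq_norm k) * ?b k + t * real (freq_norm k) * l k"
        unfolding distrib_left using e1 e2 b0 l0 by (intro add_mono mult_right_mono) auto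
      then show "norm (fourier_coeff (\<lambda>x. g x - g (x + (\<chi> j. h))) k)
          \<le> 4 * ((1 - (1 - t) ^ freq_norm k) * ?b k) + t * ?l' k"
        unfolding shift_diff_coeffs(2)[OF gL] split by (simp only: mult.assoc)
    qed (use w C B p in auto)
    then show ?thesis by (simp add: t_def algebra_simps)
  qed
  have "Sp_bigo p (at 0) (\<lambda>h x. g x - g (x + (\<chi> j. h))) (\<lambda>h. \<omega> \<bar>h\<bar>)"
  proof (subst Sp_bigo_iff[OF p])
    show "\<forall>\<^sub>F h in at 0. (\<lambda>x. g x - g (x + (\<chi> j. h))) \<in> L1_torus"
      using shift_diff_coeffs(1)[OF gL] by simp
    show "\<forall>\<^sub>F h in at 0. 0 < \<omega> \<bar>h\<bar>"
      unfolding eventually_at by (intro exI[of _ 1]) (auto intro: pos)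
    show "\<exists>C>0. \<forall>\<^sub>F h in at 0. lp_le p (\<lambda>k. norm (fourier_coeff (\<lambda>x. g x - g (x + (\<chi> j. h))) k)) (C * \<omega> \<bar>h\<bar>)"
    proof (intro exI conjI)
      show "4 * C + B > 0" using C B by simp
      show "\<forall>\<^sub>F h in at 0. lp_le p (\<lambda>k. norm (fourier_coeff (\<lambda>x. g x - g (x + (\<chi> j. h))) k)) ((4 * C + B) * \<omega> \<bar>h\<bar>)"
        unfolding eventually_at using B C by (intro exI[of _ "min (min 1 \<eta>) (1 - \<beta>)"]) (auto intro!: main)
    qed
  qed
  with gS show ?thesis by (simp add: SpH_def)
qed

text \<open>The argument runs over nonzero coefficients of f, which lie in \<open>freq_Y\<close>,
  and over norms at least \<open>r\<close>, because the low coefficients of \<open>g\<close> are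
  arbitrary and may leave \<open>freq_Y\<close>. There the shift factor is at least h \<nu> / 2 when
  h \<nu> \<le> 1, which is the truncated hypothesis of \<open>truncated_imp_deriv\<close>.\<close>

lemma SpH_imp_deriv_bound:
  assumes f: "f \<in> L1_Y" and r: "1 \<le> r" and p: "1 \<le> p"
    and g: "is_derivative (r - 1) f g" and gH: "g \<in> SpH p \<omega>"
  shows "deriv_bound p r f"
proof -
  have fL: "f \<in> L1_torus" using f by (simp add: L1_Y_def)
  have gL: "g \<in> L1_torus" by (rule is_derivative_L1[OF g fL])
  let ?b = "\<lambda>k. deriv_weight r (freq_norm k) * norm (fourier_coeff f k)"
  have b0: "0 \<le> ?b k" for k by (simp add: deriv_weight_nonneg)
  have L1: "\<forall>\<^sub>F h in at 0. (\<lambda>x. g x - g (x + (\<chi> j. h))) \<in> L1_torus"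
    using shift_diff_coeffs(1)[OF gL] by simp
  have ps: "\<forall>\<^sub>F h in at 0. 0 < \<omega> \<bar>h\<bar>"
    unfolding eventually_at by (intro exI[of _ 1]) (auto intro: pos)
  obtain C where C: "C > 0" "\<forall>\<^sub>F h in at 0.
      lp_le p (\<lambda>k. norm (fourier_coeff (\<lambda>x. g x - g (x + (\<chi> j. h))) k)) (C * \<omega> \<bar>h\<bar>)"
  proof -
    have "Sp_bigo p (at 0) (\<lambda>h x. g x - g (x + (\<chi> j. h))) (\<lambda>h. \<omega> \<bar>h\<bar>)"
      using gH by (simp add: SpH_def)
    then show ?thesis using that by (auto simp only: Sp_bigo_iff[OF p L1 ps])
  qed
  obtain \<eta> where \<eta>: "\<eta> > 0" and H: "\<And>h. h \<noteq> 0 \<Longrightarrow> \<bar>h\<bar> < \<eta> \<Longrightarrow>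
      lp_le p (\<lambda>k. norm (fourier_coeff (\<lambda>x. g x - g (x + (\<chi> j. h))) k)) (C * \<omega> \<bar>h\<bar>)"
  proof -
    from C(2) obtain d where "d > 0" and d: "\<forall>h\<in>UNIV. h \<noteq> 0 \<and> dist h 0 < d \<longrightarrow>
        lp_le p (\<lambda>k. norm (fourier_coeff (\<lambda>x. g x - g (x + (\<chi> j. h))) k)) (C * \<omega> \<bar>h\<bar>)"
      unfolding eventually_at by blast
    show ?thesis
    proof (rule that[OF \<open>d > 0\<close>])
      fix h :: real assume "h \<noteq> 0" "\<bar>h\<bar> < d"
      then show "lp_le p (\<lambda>k. norm (fourier_coeff (\<lambda>x. g x - g (x + (\<chi> j. h))) k)) (C * \<omega> \<bar>h\<bar>)"
        using d by (simp only: dist_real_def diff_zero UNIV_I ball_UNIV simp_thms)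
    qed
  qed
  have "\<exists>B'>0. \<forall>\<^sub>F \<rho> in at_left 1.
      lp_le p (\<lambda>k. real (freq_norm k) * \<rho> ^ freq_norm k * ?b k) (B' * (\<omega> (1 - \<rho>) / (1 - \<rho>)))"
  proof (rule truncated_imp_deriv[OF p, of "2 * C" "min 1 \<eta>"])
    fix h :: real assume h: "0 < h" "h < min 1 \<eta>"
    have w: "0 < \<omega> h" using h by (intro pos) auto
    have "lp_le p (\<lambda>k. norm (fourier_coeff (\<lambda>x. g x - g (x + (\<chi> j. h))) k)) (C * \<omega> h)"
      using H[of h] h by simp
    then have "lp_le p (\<lambda>k. 2 * norm (fourier_coeff (\<lambda>x. g x - g (x + (\<chi> j. h))) k)) (2 * (C * \<omega> h))"
      using C w by (intro lp_le_scale) auto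
    then show "lp_le p (\<lambda>k. if real (freq_norm k) * h \<le> 1 then real (freq_norm k) * h * ?b k else 0) (2 * C * \<omega> h)"
    proof (rule lp_le_mono)
      fix k :: "int^'a"
      show "(if real (freq_norm k) * h \<le> 1 then real (freq_norm k) * h * ?b k else 0)
          \<le> 2 * norm (fourier_coeff (\<lambda>x. g x - g (x + (\<chi> j. h))) k)"
      proof (cases "real (freq_norm k) * h \<le> 1 \<and> ?b k \<noteq> 0")
        case True
        then have ne: "deriv_weight r (freq_norm k) \<noteq> 0" "fourier_coeff f k \<noteq> 0" by simp_all
        then have "r \<le> freq_norm k" by (simp add: deriv_weight_def split: if_splits)
        have "k \<in> freq_Y" using f ne(2) unfolding L1_Y_def by blast
        have abs: "\<bar>h * of_int (\<Sum>j\<in>UNIV. k $ j)\<bar> = real (freq_norm k) * h"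
        proof -
          have "\<bar>real_of_int (\<Sum>j\<in>UNIV. k $ j)\<bar> = real (freq_norm k)"
            using abs_freq_sum_Y[OF \<open>k \<in> freq_Y\<close>] by (metis of_int_abs of_int_of_nat_eq)
          then show ?thesis using h by (simp only: abs_mult) simp
        qed
        have "real (freq_norm k) * h / 2 \<le> norm (1 - exp (\<i> * complex_of_real (h * of_int (\<Sum>j\<in>UNIV. k $ j))))"
          using norm_1_minus_exp_ge[of "h * of_int (\<Sum>j\<in>UNIV. k $ j)"] True unfolding abs by simp
        from mult_right_mono[OF this b0[of k]] show ?thesis
          unfolding shift_diff_coeffs(2)[OF gL] is_derivative_coeff[OF g \<open>r \<le> freq_norm k\<close>]
          using True by simp
      qed auto
    qed (use C w p b0 h in auto)
  qed (use C \<eta> b0 in auto)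
  then obtain B where B: "B > 0" "\<forall>\<^sub>F \<rho> in at_left 1.
      lp_le p (\<lambda>k. real (freq_norm k) * \<rho> ^ freq_norm k * ?b k) (B * (\<omega> (1 - \<rho>) / (1 - \<rho>)))" by blast
  have "\<forall>\<^sub>F \<rho> in at_left 1.
     lp_le p (\<lambda>k. real (freq_norm k choose r) * \<rho> ^ freq_norm k * norm (fourier_coeff f k))
       (B * (\<omega> (1 - \<rho>) / (1 - \<rho>)))"
    using B(2) eventually_at_left_one eventually_pos_at_left_one
  proof eventually_elim
    case (elim \<rho>)
    show ?case
    proof (rule lp_le_mono[OF elim(1)])
      fix k :: "int^'a"
      have "real (freq_norm k choose r) * (\<rho> ^ freq_norm k * norm (fourier_coeff f k))
          \<le> real (freq_norm k) * deriv_weight r (freq_norm k) * (\<rho> ^ freq_norm k * norm (fourier_coeff f k))"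
        using elim by (intro mult_right_mono binomial_le_deriv_weight[OF r]) auto
      then show "real (freq_norm k choose r) * \<rho> ^ freq_norm k * norm (fourier_coeff f k)
          \<le> real (freq_norm k) * \<rho> ^ freq_norm k * ?b k"
        by (simp add: mult_ac)
    qed (use elim B(1) p in auto)
  qed
  with B(1) show ?thesis by (auto simp: deriv_bound_def)
qed

end

theorem theorem1:
  fixes f :: "(real^'d) \<Rightarrow> complex" and \<omega> :: "real \<Rightarrow> real" and p :: real and r :: nat
  assumes "1 \<le> p" and "1 \<le> r" and "f \<in> L1_torus"
    and "continuous_on {0..1} \<omega>" and "mono_on {0..1} \<omega>"
    and "\<forall>t\<in>{0<..1}. \<omega> t \<noteq> 0" and "(\<omega> \<longlongrightarrow> 0) (at_right 0)"
    and "summable (\<lambda>v. 1 / real (Suc v) * \<omega> (1 / real (Suc v)))"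
    and "(\<lambda>n. \<Sum>v. 1 / real (n + 1 + v) * \<omega> (1 / real (n + 1 + v))) \<in> O(\<lambda>n. \<omega> (1 / real n))"
  shows
    "let S1 = Sp_bigo p (at_left 1) (\<lambda>\<rho> x. f x - taylor_abel_poisson \<rho> r f x)
                (\<lambda>\<rho>. (1 - \<rho>) ^ (r - 1) * \<omega> (1 - \<rho>));
         S2 = Sp_bigo p (at_left 1) (\<lambda>\<rho>. poisson_integral_deriv r f \<rho>)
                (\<lambda>\<rho>. \<omega> (1 - \<rho>) / (1 - \<rho>));
         S3 = (\<exists>g. is_derivative (r - 1) f g \<and> g \<in> SpH p \<omega>);
         N = ((p \<le> 2 \<or> (\<exists>g. is_derivative (r - 1) f g)) \<and>
              (r = 1 \<or> (\<exists>k. r \<le> freq_norm k \<and> fourier_coeff f k \<noteq> 0) \<or>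
               (\<lambda>t. t) \<in> O[at_right 0](\<omega>)))
     in (S1 \<longleftrightarrow> S2) \<and>
        (N \<longrightarrow> S1 \<or> S2 \<longrightarrow> S3) \<and>
        (f \<in> L1_Y \<longrightarrow> (S3 \<longrightarrow> S1 \<and> S2) \<and> (N \<longrightarrow> (S1 \<longleftrightarrow> S2) \<and> (S2 \<longleftrightarrow> S3)))"
proof -
  note p = assms(1) and r = assms(2) and f = assms(3) and mono = assms(5)
  have pos: "0 < \<omega> t" if t: "0 < t" "t \<le> 1" for t
  proof -
    \<comment> \<open>The modulus is only assumed nonzero; its sign follows from monotonicity, since
      the limit 0 at the origin lies below every value.\<close>
    have "\<forall>\<^sub>F s in at_right 0. \<omega> s \<le> \<omega> t"
      unfolding eventually_at_right_field
      using t by (intro exI[of _ t]) (auto intro!: mono_onD[OF mono])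
    then have "0 \<le> \<omega> t" by (rule tendsto_upperbound[OF assms(7)]) simp
    then show ?thesis using assms(6) t by (simp add: less_le)
  qed
  obtain D \<delta> where D: "0 < D" "0 < \<delta>" "\<delta> \<le> 1"
    and dini: "\<And>t. 0 < t \<Longrightarrow> t \<le> \<delta> \<Longrightarrow> summable (\<lambda>j. \<omega> (t / 2 ^ j)) \<and> (\<Sum>j. \<omega> (t / 2 ^ j)) \<le> D * \<omega> t"
    using dini_dyadic[OF mono pos assms(8,9)] by blast
  interpret dini_modulus \<omega> D \<delta>
    by unfold_locales (use pos D dini in \<open>auto intro!: mono_onD[OF mono]\<close>)
  note S1 = Sp_bigo_taylor_abel[OF f r p] and S2 = Sp_bigo_poisson_deriv[OF f r p]
    and S12 = gap_bound_iff_deriv_bound[OF r p, of f]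
  have S23: "\<exists>g. is_derivative (r - 1) f g \<and> g \<in> SpH p \<omega>"
    if "deriv_bound p r f" "p \<le> 2 \<or> (\<exists>g. is_derivative (r - 1) f g)"
      "r = 1 \<or> (\<exists>k. r \<le> freq_norm k \<and> fourier_coeff f k \<noteq> 0) \<or> (\<lambda>t. t) \<in> O[at_right 0](\<omega>)"
    using that deriv_bound_imp_derivative[OF r p] deriv_bound_imp_SpH[OF f r p] by blast
  have S32: "deriv_bound p r f" if "f \<in> L1_Y" "\<exists>g. is_derivative (r - 1) f g \<and> g \<in> SpH p \<omega>"
    using that SpH_imp_deriv_bound[OF _ r p] by blast
  show ?thesis
    unfolding Let_def S1 S2 S12 using S23 S32 by blast
qed

end
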